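(* Let $\mathcal{C}$ be a rigid symmetric $\mathbb{C}$-linear monoidal category with $\operatorname{End}(\mathbf{1})=\mathbb{C}$ and let $Z$ be an object of $\mathcal{C}$. Suppose that $\dim\operatorname{End}(Z^{\otimes n})\le A^{n}$ for all $n\ge0$, for a real constant $A\ge1$, and let $s$ be any integer with $s>2e\sqrt{A}$. Then the square partition $(s^{s})$ (with $s$ parts equal to $s$) dies for $Z$, and for every $g\in\operatorname{End}(Z)$ the trace zeta function is rational: $\zeta_g=P_g/Q_g$ with $P_g,Q_g$ coprime polynomials with constant term $1$, $\deg P_g\le s-1$ and $\deg Q_g\le s-1$.
   Context: $e$ in the inequality is Euler's number. For $n\ge0$, $\Phi_n\colon\mathbb{C}[S_n]\to\operatorname{End}(Z^{\otimes n})$ is the algebra homomorphism given by the action of $S_n$ through the symmetry of $\mathcal{C}$ (permuting tensor factors). For a partition $\lambda\vdash n$, $\chi_\lambda$ is the irreducible character of $S_n$ indexed by $\lambda$, $d_\lambda$ its degree, and $e_\lambda=\frac{d_\lambda}{n!}\sum_{\pi\in S_n}\chi_\lambda(\pi)\pi$. The partition $\lambda$ dies for $Z$ if $\Phi_n(e_\lambda)=0$. $\operatorname{tr}$ is the categorical trace with values in $\operatorname{End}(\mathbf{1})=\mathbb{C}$. For $g\in\operatorname{End}(Z)$, the trace zeta function is $\zeta_g(z)=\exp\bigl(\sum_{m\ge1}\frac{\operatorname{tr}(g^m)}{m}z^m\bigr)\in\mathbb{C}[[z]]$. *)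

theory Defs
  imports
    Complex_Main
    "HOL-Library.Function_Algebras"
    "HOL-Combinatorics.Permutations"
    "HOL-Computational_Algebra.Computational_Algebra"
begin

section \<open>Rigid symmetric linear monoidal categories\<close>

text \<open>
  The objects are the elements of the type \<open>'o\<close>. All Hom spaces are linear subspaces of one complex
  vector space \<open>'m\<close>, which loses nothing: the direct sum of all Hom spaces of a category is such an
  ambient space. Hom spaces need not be disjoint, so domain and codomain are always
  given by the hypotheses \<open>f \<in> Hom a b\<close>; outside these hypotheses the operations are unspecified.
  \<open>g \<cdot> f\<close> is "first \<open>f\<close>, then \<open>g\<close>"; \<open>\<otimes>\<close> is the tensor product of objects and \<open>\<boxtimes>\<close> that of
  morphisms. No strictness is assumed.
\<close>

record ('o, 'm) sym_mon_cat =
  scl :: "complex \<Rightarrow> 'm \<Rightarrow> 'm"  (infixr "\<star>\<index>" 75)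
  hom_set :: "'o \<Rightarrow> 'o \<Rightarrow> 'm set"  ("Hom\<index>")
  Ident :: "'o \<Rightarrow> 'm"  ("Id\<index>")
  cmp :: "'m \<Rightarrow> 'm \<Rightarrow> 'm"  (infixl "\<cdot>\<index>" 55)
  unit_obj :: "'o"  ("\<one>\<index>")
  tens_obj :: "'o \<Rightarrow> 'o \<Rightarrow> 'o"  (infixr "\<otimes>\<index>" 70)
  tens_mor :: "'m \<Rightarrow> 'm \<Rightarrow> 'm"  (infixr "\<boxtimes>\<index>" 70)
  assoc :: "'o \<Rightarrow> 'o \<Rightarrow> 'o \<Rightarrow> 'm"  ("\<alpha>\<index>")
  lunit :: "'o \<Rightarrow> 'm"  ("\<l>\<index>")
  runit :: "'o \<Rightarrow> 'm"  ("\<r>\<index>")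
  braid :: "'o \<Rightarrow> 'o \<Rightarrow> 'm"  ("\<c>\<index>")

definition inverses :: "('o, 'm, 'x) sym_mon_cat_scheme \<Rightarrow> 'o \<Rightarrow> 'o \<Rightarrow> 'm \<Rightarrow> 'm \<Rightarrow> bool" where
  "inverses C a b f g \<longleftrightarrow> f \<in> Hom\<^bsub>C\<^esub> a b \<and> g \<in> Hom\<^bsub>C\<^esub> b a \<and>
     cmp C g f = Ident C a \<and> cmp C f g = Ident C b"

definition iso_mor :: "('o, 'm, 'x) sym_mon_cat_scheme \<Rightarrow> 'o \<Rightarrow> 'o \<Rightarrow> 'm \<Rightarrow> bool" where
  "iso_mor C a b f \<longleftrightarrow> (\<exists>g. inverses C a b f g)"

definition assoc_inv :: "('o, 'm, 'x) sym_mon_cat_scheme \<Rightarrow> 'o \<Rightarrow> 'o \<Rightarrow> 'o \<Rightarrow> 'm" where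
  "assoc_inv C a b c =
     (THE g. inverses C (tens_obj C (tens_obj C a b) c) (tens_obj C a (tens_obj C b c))
        (assoc C a b c) g)"

locale linear_category = vector_space "scl C"
  for C :: "('o, 'm::ab_group_add, 'x) sym_mon_cat_scheme" (structure) +
  assumes subspace_Hom: "subspace (Hom a b)"
    and Id_in_Hom: "Id a \<in> Hom a a"
    and comp_in_Hom: "\<lbrakk>f \<in> Hom a b; g \<in> Hom b c\<rbrakk> \<Longrightarrow> g \<cdot> f \<in> Hom a c"
    and comp_Id_right: "f \<in> Hom a b \<Longrightarrow> f \<cdot> Id a = f"
    and comp_Id_left: "f \<in> Hom a b \<Longrightarrow> Id b \<cdot> f = f"
    and comp_assoc: "\<lbrakk>f \<in> Hom a b; g \<in> Hom b c; h \<in> Hom c d\<rbrakk> \<Longrightarrow> (h \<cdot> g) \<cdot> f = h \<cdot> (g \<cdot> f)"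
    and comp_add_left: "\<lbrakk>f \<in> Hom a b; g \<in> Hom b c; g' \<in> Hom b c\<rbrakk> \<Longrightarrow> (g + g') \<cdot> f = (g \<cdot> f) + (g' \<cdot> f)"
    and comp_add_right: "\<lbrakk>f \<in> Hom a b; f' \<in> Hom a b; g \<in> Hom b c\<rbrakk> \<Longrightarrow> g \<cdot> (f + f') = (g \<cdot> f) + (g \<cdot> f')"
    and comp_scale_left: "\<lbrakk>f \<in> Hom a b; g \<in> Hom b c\<rbrakk> \<Longrightarrow> (k \<star> g) \<cdot> f = k \<star> (g \<cdot> f)"
    and comp_scale_right: "\<lbrakk>f \<in> Hom a b; g \<in> Hom b c\<rbrakk> \<Longrightarrow> g \<cdot> (k \<star> f) = k \<star> (g \<cdot> f)"

locale linear_monoidal_category = linear_category C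
  for C :: "('o, 'm::ab_group_add, 'x) sym_mon_cat_scheme" (structure) +
  assumes tens_in_Hom: "\<lbrakk>f \<in> Hom a b; g \<in> Hom c d\<rbrakk> \<Longrightarrow> f \<boxtimes> g \<in> Hom (a \<otimes> c) (b \<otimes> d)"
    and tens_Id: "Id a \<boxtimes> Id b = Id (a \<otimes> b)"
    and tens_comp: "\<lbrakk>f \<in> Hom a b; f' \<in> Hom b c; g \<in> Hom a' b'; g' \<in> Hom b' c'\<rbrakk>
        \<Longrightarrow> (f' \<cdot> f) \<boxtimes> (g' \<cdot> g) = (f' \<boxtimes> g') \<cdot> (f \<boxtimes> g)"
    and tens_add_left: "\<lbrakk>f \<in> Hom a b; f' \<in> Hom a b; g \<in> Hom c d\<rbrakk>
        \<Longrightarrow> (f + f') \<boxtimes> g = (f \<boxtimes> g) + (f' \<boxtimes> g)"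
    and tens_add_right: "\<lbrakk>f \<in> Hom a b; g \<in> Hom c d; g' \<in> Hom c d\<rbrakk>
        \<Longrightarrow> f \<boxtimes> (g + g') = (f \<boxtimes> g) + (f \<boxtimes> g')"
    and tens_scale_left: "\<lbrakk>f \<in> Hom a b; g \<in> Hom c d\<rbrakk> \<Longrightarrow> (k \<star> f) \<boxtimes> g = k \<star> (f \<boxtimes> g)"
    and tens_scale_right: "\<lbrakk>f \<in> Hom a b; g \<in> Hom c d\<rbrakk> \<Longrightarrow> f \<boxtimes> (k \<star> g) = k \<star> (f \<boxtimes> g)"
    and assoc_iso: "iso_mor C ((a \<otimes> b) \<otimes> c) (a \<otimes> (b \<otimes> c)) (\<alpha> a b c)"
    and lunit_iso: "iso_mor C (\<one> \<otimes> a) a (\<l> a)"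
    and runit_iso: "iso_mor C (a \<otimes> \<one>) a (\<r> a)"
    and assoc_natural: "\<lbrakk>f \<in> Hom a a'; g \<in> Hom b b'; h \<in> Hom c c'\<rbrakk>
        \<Longrightarrow> \<alpha> a' b' c' \<cdot> ((f \<boxtimes> g) \<boxtimes> h) = (f \<boxtimes> (g \<boxtimes> h)) \<cdot> \<alpha> a b c"
    and lunit_natural: "f \<in> Hom a b \<Longrightarrow> \<l> b \<cdot> (Id \<one> \<boxtimes> f) = f \<cdot> \<l> a"
    and runit_natural: "f \<in> Hom a b \<Longrightarrow> \<r> b \<cdot> (f \<boxtimes> Id \<one>) = f \<cdot> \<r> a"
    and pentagon: "\<alpha> a b (c \<otimes> d) \<cdot> \<alpha> (a \<otimes> b) c d
        = (Id a \<boxtimes> \<alpha> b c d) \<cdot> \<alpha> a (b \<otimes> c) d \<cdot> (\<alpha> a b c \<boxtimes> Id d)"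
    and triangle: "(Id a \<boxtimes> \<l> b) \<cdot> \<alpha> a \<one> b = \<r> a \<boxtimes> Id b"

text \<open>Since the braiding is symmetric, one hexagon implies the other.\<close>

locale linear_symmetric_category = linear_monoidal_category C
  for C :: "('o, 'm::ab_group_add, 'x) sym_mon_cat_scheme" (structure) +
  assumes braid_in_Hom: "\<c> a b \<in> Hom (a \<otimes> b) (b \<otimes> a)"
    and braid_natural: "\<lbrakk>f \<in> Hom a a'; g \<in> Hom b b'\<rbrakk>
        \<Longrightarrow> \<c> a' b' \<cdot> (f \<boxtimes> g) = (g \<boxtimes> f) \<cdot> \<c> a b"
    and braid_symmetric: "\<c> b a \<cdot> \<c> a b = Id (a \<otimes> b)"
    and hexagon: "\<alpha> b c a \<cdot> \<c> a (b \<otimes> c) \<cdot> \<alpha> a b c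
        = (Id b \<boxtimes> \<c> a c) \<cdot> \<alpha> b a c \<cdot> (\<c> a b \<boxtimes> Id c)"

definition is_dual :: "('o, 'm, 'x) sym_mon_cat_scheme \<Rightarrow> 'o \<Rightarrow> 'o \<Rightarrow> 'm \<Rightarrow> 'm \<Rightarrow> bool" where
  "is_dual C a b ev coev \<longleftrightarrow>
     ev \<in> Hom\<^bsub>C\<^esub> (tens_obj C b a) (unit_obj C) \<and>
     coev \<in> Hom\<^bsub>C\<^esub> (unit_obj C) (tens_obj C a b) \<and>
     runit C a \<cdot>\<^bsub>C\<^esub> (Ident C a \<boxtimes>\<^bsub>C\<^esub> ev) \<cdot>\<^bsub>C\<^esub> assoc C a b a \<cdot>\<^bsub>C\<^esub> (coev \<boxtimes>\<^bsub>C\<^esub> Ident C a) = lunit C a \<and>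
     lunit C b \<cdot>\<^bsub>C\<^esub> (ev \<boxtimes>\<^bsub>C\<^esub> Ident C b) \<cdot>\<^bsub>C\<^esub> assoc_inv C b a b \<cdot>\<^bsub>C\<^esub> (Ident C b \<boxtimes>\<^bsub>C\<^esub> coev) = runit C b"

text \<open>
  Because of the symmetry, a left dual is also a right dual. The last assumption is
  \<open>End(\<one>) = \<complex>\<close>.
\<close>

locale rigid_symmetric_linear_category = linear_symmetric_category C
  for C :: "('o, 'm::ab_group_add, 'x) sym_mon_cat_scheme" (structure) +
  assumes rigid: "\<exists>b ev coev. is_dual C a b ev coev"
    and End_unit: "bij_betw (\<lambda>k. k \<star> Id \<one>) UNIV (Hom \<one> \<one>)"


section \<open>Categorical trace and zeta function\<close>

text \<open>The trace is computed with a chosen dual; its value does not depend on the choice.\<close>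

definition cat_trace :: "('o, 'm, 'x) sym_mon_cat_scheme \<Rightarrow> 'o \<Rightarrow> 'm \<Rightarrow> complex" where
  "cat_trace C a g =
     (let (b, ev, coev) = (SOME (b, ev, coev). is_dual C a b ev coev)
      in THE k. k \<star>\<^bsub>C\<^esub> Ident C (unit_obj C) =
           ev \<cdot>\<^bsub>C\<^esub> braid C a b \<cdot>\<^bsub>C\<^esub> (g \<boxtimes>\<^bsub>C\<^esub> Ident C b) \<cdot>\<^bsub>C\<^esub> coev)"

primrec mor_pow :: "('o, 'm, 'x) sym_mon_cat_scheme \<Rightarrow> 'o \<Rightarrow> 'm \<Rightarrow> nat \<Rightarrow> 'm" where
  "mor_pow C a g 0 = Ident C a"
| "mor_pow C a g (Suc m) = g \<cdot>\<^bsub>C\<^esub> mor_pow C a g m"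

definition trace_zeta :: "('o, 'm, 'x) sym_mon_cat_scheme \<Rightarrow> 'o \<Rightarrow> 'm \<Rightarrow> complex fps" where
  "trace_zeta C a g =
     fps_compose (fps_exp 1)
       (Abs_fps (\<lambda>m. if m = 0 then 0 else cat_trace C a (mor_pow C a g m) / of_nat m))"


section \<open>The action of the symmetric groups on tensor powers\<close>

primrec tens_pow :: "('o, 'm, 'x) sym_mon_cat_scheme \<Rightarrow> 'o \<Rightarrow> nat \<Rightarrow> 'o" where
  "tens_pow C Z 0 = unit_obj C"
| "tens_pow C Z (Suc n) = Z \<otimes>\<^bsub>C\<^esub> tens_pow C Z n"

text \<open>
  For \<open>i + 1 < n\<close>, \<open>adj_swap C Z n i\<close> is the symmetry applied to the factors \<open>i\<close> and \<open>i + 1\<close> (counted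
  from \<open>0\<close>) of the \<open>n\<close>-th tensor power. The last two equations are never used.
\<close>

fun adj_swap :: "('o, 'm, 'x) sym_mon_cat_scheme \<Rightarrow> 'o \<Rightarrow> nat \<Rightarrow> nat \<Rightarrow> 'm" where
  "adj_swap C Z (Suc (Suc n)) 0 =
     assoc C Z Z (tens_pow C Z n) \<cdot>\<^bsub>C\<^esub> (braid C Z Z \<boxtimes>\<^bsub>C\<^esub> Ident C (tens_pow C Z n)) \<cdot>\<^bsub>C\<^esub>
       assoc_inv C Z Z (tens_pow C Z n)"
| "adj_swap C Z (Suc n) (Suc i) = Ident C Z \<boxtimes>\<^bsub>C\<^esub> adj_swap C Z n i"
| "adj_swap C Z (Suc 0) 0 = Ident C (tens_pow C Z (Suc 0))"
| "adj_swap C Z 0 i = Ident C (tens_pow C Z 0)"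

text \<open>
  The graph of the group homomorphism \<open>S_n \<rightarrow> End(Z^n)\<close> taking each adjacent transposition to the
  corresponding \<open>adj_swap\<close>.
\<close>

inductive perm_graph ::
  "('o, 'm, 'x) sym_mon_cat_scheme \<Rightarrow> 'o \<Rightarrow> nat \<Rightarrow> (nat \<Rightarrow> nat) \<Rightarrow> 'm \<Rightarrow> bool"
  for C Z n where
  "perm_graph C Z n id (Ident C (tens_pow C Z n))"
| "\<lbrakk>perm_graph C Z n \<pi> f; Suc i < n\<rbrakk>
    \<Longrightarrow> perm_graph C Z n (transpose i (Suc i) \<circ> \<pi>) (adj_swap C Z n i \<cdot>\<^bsub>C\<^esub> f)"

definition perm_mor :: "('o, 'm, 'x) sym_mon_cat_scheme \<Rightarrow> 'o \<Rightarrow> nat \<Rightarrow> (nat \<Rightarrow> nat) \<Rightarrow> 'm" where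
  "perm_mor C Z n \<pi> = (THE f. perm_graph C Z n \<pi> f)"

text \<open>
  \<open>S_n\<close> is the set of permutations of \<open>{0, ..., n - 1}\<close>. An element of \<open>\<complex>[S_n]\<close> is its coefficient
  function, which vanishes outside \<open>S_n\<close>.
\<close>

definition sym_grp :: "nat \<Rightarrow> (nat \<Rightarrow> nat) set" where
  "sym_grp n = {\<pi>. \<pi> permutes {..<n}}"

definition Phi ::
  "('o, 'm::ab_group_add, 'x) sym_mon_cat_scheme \<Rightarrow> 'o \<Rightarrow> nat \<Rightarrow> ((nat \<Rightarrow> nat) \<Rightarrow> complex) \<Rightarrow> 'm" where
  "Phi C Z n x = (\<Sum>\<pi>\<in>sym_grp n. x \<pi> \<star>\<^bsub>C\<^esub> perm_mor C Z n \<pi>)"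


section \<open>Irreducible characters of the symmetric groups\<close>

text \<open>
  The irreducible module of a partition \<open>\<lambda>\<close> of \<open>n\<close> is the left ideal of \<open>\<complex>[S_n]\<close> generated by the Young
  symmetrizer of \<open>\<lambda>\<close>.
\<close>

definition (in vector_space) trace_on :: "'b set \<Rightarrow> ('b \<Rightarrow> 'b) \<Rightarrow> 'a" where
  "trace_on V f = (let B = (SOME B. independent B \<and> span B = V) in \<Sum>b\<in>B. representation B (f b) b)"

definition (in vector_space) finite_dim :: "'b set \<Rightarrow> bool" where
  "finite_dim V \<longleftrightarrow> (\<exists>B. finite B \<and> V \<subseteq> span B)"

definition fun_scale :: "complex \<Rightarrow> ('a \<Rightarrow> complex) \<Rightarrow> ('a \<Rightarrow> complex)" where
  "fun_scale k x = (\<lambda>\<pi>. k * x \<pi>)"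

interpretation fun_vs: vector_space "fun_scale :: complex \<Rightarrow> ('a \<Rightarrow> complex) \<Rightarrow> ('a \<Rightarrow> complex)"
  by unfold_locales (auto simp: fun_scale_def fun_eq_iff algebra_simps)

definition grp_alg :: "nat \<Rightarrow> ((nat \<Rightarrow> nat) \<Rightarrow> complex) set" where
  "grp_alg n = {x. \<forall>\<pi>. \<pi> \<notin> sym_grp n \<longrightarrow> x \<pi> = 0}"

definition ga_single :: "(nat \<Rightarrow> nat) \<Rightarrow> (nat \<Rightarrow> nat) \<Rightarrow> complex" where
  "ga_single \<pi> = (\<lambda>\<tau>. if \<tau> = \<pi> then 1 else 0)"

definition ga_mult ::
  "nat \<Rightarrow> ((nat \<Rightarrow> nat) \<Rightarrow> complex) \<Rightarrow> ((nat \<Rightarrow> nat) \<Rightarrow> complex) \<Rightarrow> (nat \<Rightarrow> nat) \<Rightarrow> complex" where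
  "ga_mult n x y = (\<lambda>\<pi>. if \<pi> \<in> sym_grp n then \<Sum>\<sigma>\<in>sym_grp n. x \<sigma> * y (inv \<sigma> \<circ> \<pi>) else 0)"

definition is_partition :: "nat list \<Rightarrow> bool" where
  "is_partition \<mu> \<longleftrightarrow> sorted_wrt (\<ge>) \<mu> \<and> 0 \<notin> set \<mu>"

text \<open>
  \<open>cell \<mu> k\<close> is the (row, column) position of the number \<open>k < sum_list \<mu>\<close> in the tableau of shape \<open>\<mu>\<close>
  that is filled with \<open>0, 1, 2, ...\<close> row by row.
\<close>

fun cell :: "nat list \<Rightarrow> nat \<Rightarrow> nat \<times> nat" where
  "cell [] k = (0, k)"
| "cell (m # \<mu>) k = (if k < m then (0, k) else (case cell \<mu> (k - m) of (i, j) \<Rightarrow> (Suc i, j)))"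

definition row_grp :: "nat list \<Rightarrow> (nat \<Rightarrow> nat) set" where
  "row_grp \<mu> = {\<pi> \<in> sym_grp (sum_list \<mu>). \<forall>k < sum_list \<mu>. fst (cell \<mu> (\<pi> k)) = fst (cell \<mu> k)}"

definition col_grp :: "nat list \<Rightarrow> (nat \<Rightarrow> nat) set" where
  "col_grp \<mu> = {\<pi> \<in> sym_grp (sum_list \<mu>). \<forall>k < sum_list \<mu>. snd (cell \<mu> (\<pi> k)) = snd (cell \<mu> k)}"

definition young_symmetrizer :: "nat list \<Rightarrow> (nat \<Rightarrow> nat) \<Rightarrow> complex" where
  "young_symmetrizer \<mu> =
     ga_mult (sum_list \<mu>)
       (\<Sum>\<pi>\<in>row_grp \<mu>. ga_single \<pi>)
       (\<Sum>\<pi>\<in>col_grp \<mu>. fun_scale (of_int (sign \<pi>)) (ga_single \<pi>))"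

definition specht :: "nat list \<Rightarrow> ((nat \<Rightarrow> nat) \<Rightarrow> complex) set" where
  "specht \<mu> = (\<lambda>x. ga_mult (sum_list \<mu>) x (young_symmetrizer \<mu>)) ` grp_alg (sum_list \<mu>)"

definition irr_char :: "nat list \<Rightarrow> (nat \<Rightarrow> nat) \<Rightarrow> complex" where
  "irr_char \<mu> \<pi> = fun_vs.trace_on (specht \<mu>) (ga_mult (sum_list \<mu>) (ga_single \<pi>))"

definition char_degree :: "nat list \<Rightarrow> nat" where
  "char_degree \<mu> = fun_vs.dim (specht \<mu>)"

definition central_idem :: "nat list \<Rightarrow> (nat \<Rightarrow> nat) \<Rightarrow> complex" where
  "central_idem \<mu> =
     fun_scale (of_nat (char_degree \<mu>) / fact (sum_list \<mu>))
       (\<Sum>\<pi>\<in>sym_grp (sum_list \<mu>). fun_scale (irr_char \<mu> \<pi>) (ga_single \<pi>))"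

definition dies :: "('o, 'm::ab_group_add, 'x) sym_mon_cat_scheme \<Rightarrow> 'o \<Rightarrow> nat list \<Rightarrow> bool" where
  "dies C Z \<mu> \<longleftrightarrow> is_partition \<mu> \<and> Phi C Z (sum_list \<mu>) (central_idem \<mu>) = 0"

end

theory Submission
  imports Defs
begin

text \<open>
  Let \<open>n = s\<^sup>2\<close>, let \<open>c = a b\<close> be the Young symmetrizer of the square tableau (\<open>a\<close> is the sum of the row group,
  \<open>b\<close> the signed sum of the column group) and let \<open>\<Phi>\<close> be the action of \<open>\<complex>[S\<^sub>n]\<close> on the tensor power of \<open>Z\<close>. Both
  halves of the theorem follow from \<open>\<Phi> c = 0\<close> and from one identity, the content formula
    \<open>(\<Sum>p, q. sgn q * t ^ cycles (p q)) = (\<Prod>boxes. t + content)\<close>,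
  where \<open>p\<close> and \<open>q\<close> run through the row and the column group. It is proved by removing one corner box after
  the other (\<open>content_formula\<close>); the contents of the square lie strictly between \<open>-s\<close> and \<open>s\<close>.

  The square dies. All products \<open>c x c\<close> are multiples of \<open>c\<close>; let \<open>c c = N c\<close>. The two-sided ideal of \<open>c\<close> is
  simple, so if \<open>\<Phi> c \<noteq> 0\<close>, then \<open>\<Phi>\<close> is injective on it (\<open>block_simple\<close>). The ideal has dimension \<open>(n! / N)\<^sup>2\<close>
  (\<open>dim_block\<close>), hence \<open>n! / N \<le> A ^ (n / 2)\<close>. The number \<open>N\<close>, which is the product of the hook lengths,
  is bounded without knowing it: \<open>c / N\<close> acts as a projection on the \<open>n\<close>-th tensor power of \<open>\<complex>\<^sup>s\<close>, so its trace is
  a natural number \<open>r\<close>, and the content formula at \<open>t = s\<close> gives \<open>0 < N r \<le> (2 s) ^ n\<close>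
  (\<open>square_yc_scalar_bound\<close>). With \<open>n! \<ge> (n / e) ^ n\<close> this contradicts \<open>s > 2 e \<surd>A\<close>. So \<open>\<Phi> c = 0\<close>. The
  central idempotent of the square is a multiple of the sum of the conjugates of \<open>b a\<close> (\<open>left_ideal_char\<close>), and
  \<open>b a\<close> is in the ideal of \<open>c\<close>; so the square dies.

  The zeta function. The trace of \<open>f \<otimes> \<dots> \<otimes> f\<close> composed with a permutation \<open>\<pi>\<close> is the product of \<open>tr (f ^ l)\<close>
  over the lengths \<open>l\<close> of the cycles of \<open>\<pi>\<close>. Because of \<open>\<Phi> c = 0\<close>, the signed sum of these numbers over all
  \<open>\<pi> = p q\<close> is zero. If \<open>tr (f ^ l) = 0\<close> for \<open>l \<ge> 2\<close>, only \<open>p = q = id\<close> contributes, and \<open>tr f = 0\<close>; it follows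
  that nilpotent polynomials in \<open>g\<close> have trace zero. If \<open>tr (f ^ l) = t\<close> for all \<open>l \<ge> 1\<close>, the content formula
  shows that \<open>t\<close> is an integer with \<open>\<bar>t\<bar> < s\<close>. Since \<open>End(Z)\<close> has finite dimension, \<open>g\<close> is a root of a polynomial
  with finite root set \<open>X\<close>, and the two statements give \<open>tr (p(g)) = (\<Sum>x\<in>X. \<nu> x * p(x))\<close> with integers \<open>\<nu> x\<close> all of
  whose partial sums have absolute value less than \<open>s\<close> (\<open>point_functional\<close>). The zeta function is the
  product of the \<open>(1 - x z) ^ (- \<nu> x)\<close>.

  On the categorical side, the symmetric group has to act on tensor powers that are bracketed to the right
  (\<open>yang_baxter\<close>, \<open>perm_arrow_swap\<close>), and the trace of a permutation is computed by closing the first strand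
  (\<open>perm_trace_merge\<close>).
\<close>

section \<open>Permutations of initial segments\<close>

text \<open>  The embedding of \<open>S\<^sub>n\<close> in \<open>S\<^sub>n\<^sub>+\<^sub>1\<close> as the stabilizer of \<open>0\<close>. Tensor powers grow at the front, so inductions remove
  the point \<open>0\<close>, not the last point.\<close>

definition shiftp :: "(nat \<Rightarrow> nat) \<Rightarrow> nat \<Rightarrow> nat" where
  "shiftp \<pi> k = (case k of 0 \<Rightarrow> 0 | Suc j \<Rightarrow> Suc (\<pi> j))"

lemma shiftp_simps [simp]: "shiftp \<pi> 0 = 0" "shiftp \<pi> (Suc j) = Suc (\<pi> j)"
  by (simp_all add: shiftp_def)

lemma shiftp_comp: "shiftp (\<pi> \<circ> \<sigma>) = shiftp \<pi> \<circ> shiftp \<sigma>"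
  by (auto simp: fun_eq_iff shiftp_def split: nat.splits)

lemma shiftp_id [simp]: "shiftp id = id"
  by (auto simp: fun_eq_iff shiftp_def split: nat.splits)

lemma shiftp_inj [simp]: "shiftp \<pi> = shiftp \<sigma> \<longleftrightarrow> \<pi> = \<sigma>"
  by (metis ext nat.inject shiftp_simps(2))

lemma shiftp_transpose: "shiftp (transpose i j) = transpose (Suc i) (Suc j)"
  by (auto simp: fun_eq_iff shiftp_def transpose_def split: nat.splits)

lemma shiftp_permutes [simp]: "shiftp \<pi> permutes {..<Suc n} \<longleftrightarrow> \<pi> permutes {..<n}"
proof
  assume \<pi>: "\<pi> permutes {..<n}"
  show "shiftp \<pi> permutes {..<Suc n}"
    unfolding permutes_def
  proof (intro conjI allI impI)
    have "shiftp \<pi> \<circ> shiftp (inv \<pi>) = id" "shiftp (inv \<pi>) \<circ> shiftp \<pi> = id"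
      using permutes_inv_o[OF \<pi>] by (simp_all flip: shiftp_comp)
    then have "bij (shiftp \<pi>)" by (rule o_bij[rotated])
    then show "\<exists>!x. shiftp \<pi> x = y" for y by (simp add: bij_iff)
    show "shiftp \<pi> x = x" if "x \<notin> {..<Suc n}" for x
      using that \<pi> by (cases x) (auto simp: permutes_def)
  qed
next
  assume \<pi>: "shiftp \<pi> permutes {..<Suc n}"
  show "\<pi> permutes {..<n}"
    unfolding permutes_def
  proof (intro conjI allI impI)
    show "\<pi> x = x" if "x \<notin> {..<n}" for x
      using that permutes_not_in[OF \<pi>, of "Suc x"] by simp
    fix y
    obtain x where x: "shiftp \<pi> x = Suc y" using permutes_surj[OF \<pi>] by (metis surjD)
    show "\<exists>!x. \<pi> x = y"
    proof
      show "\<pi> (x - 1) = y" using x by (cases x) auto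
      show "z = x - 1" if "\<pi> z = y" for z
        using that x permutes_inj[OF \<pi>] by (metis diff_Suc_1 injD shiftp_simps(2))
    qed
  qed
qed

lemma fix_zero_shiftp:
  assumes "\<pi> permutes {..<Suc n}" "\<pi> 0 = 0"
  obtains \<sigma> where "\<pi> = shiftp \<sigma>" "\<sigma> permutes {..<n}"
proof -
  have "\<pi> = shiftp (\<lambda>j. \<pi> (Suc j) - 1)"
  proof
    fix k show "\<pi> k = shiftp (\<lambda>j. \<pi> (Suc j) - 1) k"
    proof (cases k)
      case (Suc j)
      have "\<pi> k \<noteq> 0" using assms Suc permutes_inj by (metis injD nat.distinct(1))
      then show ?thesis using Suc by simp
    qed (use assms in simp)
  qed
  then show thesis using that assms shiftp_permutes by metis
qed

text \<open>
  The cycle \<open>0 \<mapsto> k \<mapsto> k - 1 \<mapsto> \<dots> \<mapsto> 0\<close>. These cycles represent the cosets of the stabilizer of \<open>0\<close>.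
\<close>

definition cyc_up :: "nat \<Rightarrow> nat \<Rightarrow> nat" where
  "cyc_up k j = (if j = 0 then k else if j \<le> k then j - 1 else j)"

lemma cyc_up_0 [simp]: "cyc_up 0 = id" by (auto simp: cyc_up_def)

lemma cyc_up_at_0 [simp]: "cyc_up k 0 = k" by (simp add: cyc_up_def)

lemma cyc_up_Suc: "cyc_up (Suc k) = transpose k (Suc k) \<circ> cyc_up k"
  by (auto simp: fun_eq_iff cyc_up_def transpose_def)

lemma cyc_up_permutes: "k < n \<Longrightarrow> cyc_up k permutes {..<n}"
proof (induction k)
  case (Suc k)
  then show ?case unfolding cyc_up_Suc
    by (intro permutes_compose permutes_swap_id) auto
qed (simp add: permutes_id)

lemma cyc_up_above: "k < i \<Longrightarrow> transpose i (Suc i) \<circ> cyc_up k = cyc_up k \<circ> transpose i (Suc i)"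
  by (auto simp: fun_eq_iff cyc_up_def transpose_def)

lemma cyc_up_below: "Suc i < k \<Longrightarrow> transpose i (Suc i) \<circ> cyc_up k = cyc_up k \<circ> transpose (Suc i) (Suc (Suc i))"
  by (auto simp: fun_eq_iff cyc_up_def transpose_def)

lemma cyc_up_decomp:
  assumes "\<pi> permutes {..<Suc n}"
  obtains \<sigma> where "\<pi> = cyc_up (\<pi> 0) \<circ> shiftp \<sigma>" "\<sigma> permutes {..<n}"
proof -
  let ?r = "cyc_up (\<pi> 0)"
  have "\<pi> 0 < Suc n" using permutes_in_image[OF assms, of 0] by simp
  then have r: "?r permutes {..<Suc n}" by (rule cyc_up_permutes)
  have "(inv ?r \<circ> \<pi>) permutes {..<Suc n}" "(inv ?r \<circ> \<pi>) 0 = 0"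
    using permutes_compose[OF assms permutes_inv[OF r]] permutes_inv_eq[OF r, of "\<pi> 0" 0] by auto
  then obtain \<sigma> where "inv ?r \<circ> \<pi> = shiftp \<sigma>" "\<sigma> permutes {..<n}" by (rule fix_zero_shiftp)
  moreover have "\<pi> = ?r \<circ> (inv ?r \<circ> \<pi>)" by (simp add: o_assoc permutes_inv_o[OF r])
  ultimately show thesis using that by simp
qed

lemma adjacent_permutes: "Suc i < n \<Longrightarrow> transpose i (Suc i) permutes {..<n}"
  by (rule permutes_swap_id) auto

lemma permutes_adjacent_induct [consumes 1, case_names id swap]:
  assumes "\<pi> permutes {..<n}" "Q id"
    and "\<And>i \<pi>. \<lbrakk>\<pi> permutes {..<n}; Suc i < n; Q \<pi>\<rbrakk> \<Longrightarrow> Q (transpose i (Suc i) \<circ> \<pi>)"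
  shows "Q \<pi>"
  using assms
proof (induction n arbitrary: \<pi> Q)
  case (Suc n)
  note step = Suc.prems(3)
  obtain \<sigma> where \<sigma>: "\<pi> = cyc_up (\<pi> 0) \<circ> shiftp \<sigma>" "\<sigma> permutes {..<n}" using Suc.prems(1) by (rule cyc_up_decomp)
  have "Q (shiftp \<sigma>)"
  proof (rule Suc.IH[OF \<sigma>(2), of "\<lambda>\<sigma>. Q (shiftp \<sigma>)"])
    show "Q (shiftp (transpose i (Suc i) \<circ> \<pi>))" if "\<pi> permutes {..<n}" "Suc i < n" "Q (shiftp \<pi>)" for i \<pi>
      unfolding shiftp_comp shiftp_transpose using that by (intro Suc.prems(3)) auto
  qed (simp only: shiftp_id Suc.prems(2))
  then have "Q (cyc_up k \<circ> shiftp \<sigma>)" if "k < Suc n" for k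
    using that
  proof (induction k)
    case (Suc k)
    have "cyc_up k \<circ> shiftp \<sigma> permutes {..<Suc n}"
      using Suc.prems \<sigma>(2) by (intro permutes_compose cyc_up_permutes) auto
    from step[OF this Suc.prems(2) Suc.IH[OF Suc.prems(1) Suc_lessD[OF Suc.prems(2)]]]
    show ?case by (simp only: cyc_up_Suc o_assoc)
  qed (simp only: cyc_up_0 id_o)
  then show ?case using \<sigma>(1) permutes_in_image[OF Suc.prems(1), of 0] by (metis lessThan_iff zero_less_Suc)
qed simp

section \<open>Traces that only depend on cycles\<close>

lemma transpose_perm: "a < n \<Longrightarrow> b < n \<Longrightarrow> transpose a b permutes {..<n}" for a b n :: nat
  by (rule permutes_swap_id) auto

text \<open>  A permutation that moves \<open>0\<close> arises from a permutation of the other points by inserting \<open>0\<close> into the cycle of a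
  point \<open>l\<close>. Together with \<open>fix_zero_shiftp\<close> this is the case distinction in all inductions over cycles.\<close>

lemma move_zero_decomp:
  assumes "\<pi> permutes {..<Suc n}" "\<pi> 0 \<noteq> 0"
  obtains \<sigma> l where "\<pi> = shiftp \<sigma> \<circ> transpose 0 (Suc l)" "\<sigma> permutes {..<n}" "l < n"
proof -
  define k where "k = inv \<pi> 0"
  have k: "k < Suc n" "\<pi> k = 0" using permutes_in_image[OF permutes_inv[OF assms(1)], of 0] permutes_inverses(1)[OF assms(1)]
    by (simp_all add: k_def)
  obtain l where l: "k = Suc l" "l < n" using k assms(2) by (cases k) auto
  have "\<pi> \<circ> transpose 0 k permutes {..<Suc n}" using assms(1) k by (intro permutes_compose transpose_perm) auto
  moreover have "(\<pi> \<circ> transpose 0 k) 0 = 0" using k by simp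
  ultimately obtain \<sigma> where \<sigma>: "\<pi> \<circ> transpose 0 k = shiftp \<sigma>" "\<sigma> permutes {..<n}" by (rule fix_zero_shiftp)
  have "\<pi> = \<pi> \<circ> transpose 0 k \<circ> transpose 0 k" by (simp add: o_assoc[symmetric])
  then show thesis using that[of \<sigma> l] \<sigma> l by simp
qed

text \<open>
  \<open>\<psi> m ks \<pi>\<close> behaves like the trace of \<open>f ^ ks 0 \<otimes> \<dots> \<otimes> f ^ ks (m - 1)\<close> composed with \<open>\<pi>\<close>, if \<open>\<tau> k\<close> is the trace of
  \<open>f ^ k\<close>: a fixed point \<open>0\<close> splits off a factor, and a point \<open>0\<close> that follows \<open>l\<close> in a cycle merges with its
  successor \<open>\<pi> l\<close>. The rules determine \<open>\<psi>\<close> as the product over the cycles of \<open>\<tau>\<close> at the sum of \<open>ks\<close> over the cycle.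
\<close>

definition cycle_trace :: "(nat \<Rightarrow> complex) \<Rightarrow> (nat \<Rightarrow> (nat \<Rightarrow> nat) \<Rightarrow> (nat \<Rightarrow> nat) \<Rightarrow> complex) \<Rightarrow> bool" where
  "cycle_trace \<tau> \<psi> \<longleftrightarrow> (\<forall>ks \<pi>. \<psi> 0 ks \<pi> = 1) \<and>
    (\<forall>m ks \<pi>. \<pi> permutes {..<m} \<longrightarrow> \<psi> (Suc m) ks (shiftp \<pi>) = \<tau> (ks 0) * \<psi> m (\<lambda>i. ks (Suc i)) \<pi>) \<and>
    (\<forall>m ks \<pi> l. \<pi> permutes {..<m} \<longrightarrow> l < m \<longrightarrow> \<psi> (Suc m) ks (shiftp \<pi> \<circ> transpose 0 (Suc l))
       = \<psi> m (\<lambda>i. if i = \<pi> l then ks (Suc i) + ks 0 else ks (Suc i)) \<pi>)"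

lemma cycle_traceD:
  assumes "cycle_trace \<tau> \<psi>"
  shows "\<psi> 0 ks \<pi> = 1"
    "\<pi> permutes {..<m} \<Longrightarrow> \<psi> (Suc m) ks (shiftp \<pi>) = \<tau> (ks 0) * \<psi> m (\<lambda>i. ks (Suc i)) \<pi>"
    "\<lbrakk>\<pi> permutes {..<m}; l < m\<rbrakk> \<Longrightarrow> \<psi> (Suc m) ks (shiftp \<pi> \<circ> transpose 0 (Suc l))
       = \<psi> m (\<lambda>i. if i = \<pi> l then ks (Suc i) + ks 0 else ks (Suc i)) \<pi>"
  using assms unfolding cycle_trace_def by blast+

text \<open>  Every merging of two points creates an exponent of at least \<open>2\<close>, where \<open>\<tau>\<close> vanishes.\<close>

lemma cycle_trace_nilpotent:
  assumes \<psi>: "cycle_trace \<tau> \<psi>" and \<tau>: "\<And>k. k \<ge> 2 \<Longrightarrow> \<tau> k = 0"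
    and "\<pi> permutes {..<m}" "\<And>i. ks i \<ge> 1"
  shows "\<psi> m ks \<pi> = (if \<pi> = id \<and> (\<forall>i<m. ks i = 1) then \<tau> 1 ^ m else 0)"
  using assms(3,4)
proof (induction m arbitrary: ks \<pi>)
  case 0
  then show ?case by (simp add: cycle_traceD(1)[OF \<psi>])
next
  case (Suc m)
  show ?case
  proof (cases "\<pi> 0 = 0")
    case True
    obtain \<sigma> where \<sigma>: "\<pi> = shiftp \<sigma>" "\<sigma> permutes {..<m}" using Suc.prems(1) True by (rule fix_zero_shiftp)
    have "\<psi> m (\<lambda>i. ks (Suc i)) \<sigma> = (if \<sigma> = id \<and> (\<forall>i<m. ks (Suc i) = 1) then \<tau> 1 ^ m else 0)"
      using Suc.prems \<sigma> by (intro Suc.IH) auto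
    moreover have "\<tau> (ks 0) = (if ks 0 = 1 then \<tau> 1 else 0)" using \<tau>[of "ks 0"] Suc.prems(2)[of 0] by (cases "ks 0 = 1") auto
    moreover have "\<pi> = id \<longleftrightarrow> \<sigma> = id" unfolding \<sigma>(1) by (metis shiftp_id shiftp_inj)
    moreover have "\<psi> (Suc m) ks \<pi> = \<tau> (ks 0) * \<psi> m (\<lambda>i. ks (Suc i)) \<sigma>"
      unfolding \<sigma>(1) by (rule cycle_traceD(2)[OF \<psi> \<sigma>(2)])
    ultimately have "\<psi> (Suc m) ks \<pi> = (if \<pi> = id \<and> (\<forall>i<Suc m. ks i = 1) then \<tau> 1 ^ Suc m else 0)"
      by (auto simp: All_less_Suc2)
    then show ?thesis .
  next
    case False
    obtain \<sigma> l where \<sigma>: "\<pi> = shiftp \<sigma> \<circ> transpose 0 (Suc l)" "\<sigma> permutes {..<m}" "l < m"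
      using Suc.prems(1) False by (rule move_zero_decomp)
    let ?ks = "\<lambda>i. if i = \<sigma> l then ks (Suc i) + ks 0 else ks (Suc i)"
    have "\<sigma> l < m" using permutes_in_image[OF \<sigma>(2), of l] \<sigma>(3) by simp
    moreover have "?ks (\<sigma> l) \<noteq> 1" using Suc.prems(2)[of 0] Suc.prems(2)[of "Suc (\<sigma> l)"] by simp
    ultimately have "\<not> (\<forall>i<m. ?ks i = 1)" by blast
    moreover have "\<psi> m ?ks \<sigma> = (if \<sigma> = id \<and> (\<forall>i<m. ?ks i = 1) then \<tau> 1 ^ m else 0)"
      using Suc.prems(2) by (intro Suc.IH \<sigma>) (auto simp: add_increasing)
    moreover have "\<psi> (Suc m) ks \<pi> = \<psi> m ?ks \<sigma>" unfolding \<sigma>(1) by (rule cycle_traceD(3)[OF \<psi> \<sigma>(2,3)])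
    moreover have "\<pi> \<noteq> id" using False by auto
    ultimately have "\<psi> (Suc m) ks \<pi> = (if \<pi> = id \<and> (\<forall>i<Suc m. ks i = 1) then \<tau> 1 ^ Suc m else 0)"
      by (simp only: if_False simp_thms)
    then show ?thesis .
  qed
qed

text \<open>  If \<open>\<tau>\<close> is constant, the exponents do not matter: \<open>\<psi>\<close> is \<open>t\<close> to the number of cycles.\<close>

lemma cycle_trace_idempotent:
  assumes \<psi>: "cycle_trace \<tau> \<psi>" and \<tau>: "\<And>k. k \<ge> 1 \<Longrightarrow> \<tau> k = t"
    and "\<pi> permutes {..<m}" "\<And>i. ks i \<ge> 1"
  shows "\<psi> m ks \<pi> = \<psi> m (\<lambda>_. 1) \<pi>"
  using assms(3,4)
proof (induction m arbitrary: ks \<pi>)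
  case 0
  then show ?case by (simp add: cycle_traceD(1)[OF \<psi>])
next
  case (Suc m)
  show ?case
  proof (cases "\<pi> 0 = 0")
    case True
    obtain \<sigma> where \<sigma>: "\<pi> = shiftp \<sigma>" "\<sigma> permutes {..<m}" using Suc.prems(1) True by (rule fix_zero_shiftp)
    have "\<psi> m (\<lambda>i. ks (Suc i)) \<sigma> = \<psi> m (\<lambda>_. 1) \<sigma>" using Suc.prems \<sigma> by (intro Suc.IH) auto
    then show ?thesis unfolding \<sigma>(1) cycle_traceD(2)[OF \<psi> \<sigma>(2)] using \<tau> Suc.prems(2)[of 0] by simp
  next
    case False
    obtain \<sigma> l where \<sigma>: "\<pi> = shiftp \<sigma> \<circ> transpose 0 (Suc l)" "\<sigma> permutes {..<m}" "l < m"
      using Suc.prems(1) False by (rule move_zero_decomp)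
    have "\<psi> (Suc m) ls \<pi> = \<psi> m (\<lambda>_. 1) \<sigma>" if "\<And>i. ls i \<ge> 1" for ls
      unfolding \<sigma>(1) cycle_traceD(3)[OF \<psi> \<sigma>(2,3)] using that by (intro Suc.IH \<sigma>) (auto simp: add_increasing)
    from this[of ks] this[of "\<lambda>_. 1"] show ?thesis using Suc.prems(2) by simp
  qed
qed

section \<open>The content formula\<close>

lemma permutes_finite: "\<pi> permutes {..<n} \<Longrightarrow> permutation \<pi>" for n :: nat
  using permutation_permutes by blast

lemma sign_comp: "\<pi> permutes {..<n} \<Longrightarrow> \<sigma> permutes {..<n} \<Longrightarrow> sign (\<pi> \<circ> \<sigma>) = sign \<pi> * sign \<sigma>" for n :: nat
  by (intro sign_compose permutes_finite)

lemma sign_shiftp: "\<pi> permutes {..<n} \<Longrightarrow> sign (shiftp \<pi>) = sign \<pi>"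
proof (induction rule: permutes_adjacent_induct)
  case id
  show ?case by (simp only: shiftp_id)
next
  case (swap i \<pi>)
  have "sign (shiftp (transpose i (Suc i) \<circ> \<pi>)) = sign (transpose (Suc i) (Suc (Suc i))) * sign (shiftp \<pi>)"
    unfolding shiftp_comp shiftp_transpose using swap by (intro sign_comp[of _ "Suc n"] transpose_perm) auto
  moreover have "sign (transpose i (Suc i) \<circ> \<pi>) = sign (transpose i (Suc i)) * sign \<pi>"
    using swap by (intro sign_comp[of _ n] transpose_perm) auto
  ultimately have "sign (shiftp (transpose i (Suc i) \<circ> \<pi>)) = sign (transpose i (Suc i) \<circ> \<pi>)"
    using swap.IH by (simp add: sign_swap_id)
  then show ?case .
qed

text \<open>
  A Young subgroup. With \<open>f\<close> the row or the column of a box, it is the row or the column group of a tableau.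
\<close>

definition fib_grp :: "nat \<Rightarrow> (nat \<Rightarrow> nat) \<Rightarrow> (nat \<Rightarrow> nat) set" where
  "fib_grp n f = {\<pi>. \<pi> permutes {..<n} \<and> (\<forall>k. f (\<pi> k) = f k)}"

lemma fib_grpD: "\<pi> \<in> fib_grp n f \<Longrightarrow> \<pi> permutes {..<n}" "\<pi> \<in> fib_grp n f \<Longrightarrow> f (\<pi> k) = f k"
  by (auto simp: fib_grp_def)

lemma finite_fib_grp [simp]: "finite (fib_grp n f)"
  by (rule finite_subset[OF _ finite_permutations[of "{..<n}"]]) (auto simp: fib_grp_def)

lemma fib_grp_comp: "\<pi> \<in> fib_grp n f \<Longrightarrow> \<sigma> \<in> fib_grp n f \<Longrightarrow> \<pi> \<circ> \<sigma> \<in> fib_grp n f"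
  by (auto simp: fib_grp_def intro: permutes_compose)

lemma fib_grp_inv: "\<pi> \<in> fib_grp n f \<Longrightarrow> inv \<pi> \<in> fib_grp n f"
proof -
  assume \<pi>: "\<pi> \<in> fib_grp n f"
  have "f (inv \<pi> k) = f k" for k
    using fib_grpD(2)[OF \<pi>, of "inv \<pi> k"] permutes_inverses(1)[OF fib_grpD(1)[OF \<pi>]] by simp
  then show ?thesis using permutes_inv[OF fib_grpD(1)[OF \<pi>]] by (simp add: fib_grp_def)
qed

lemma fib_grp_transpose: "a < n \<Longrightarrow> b < n \<Longrightarrow> f a = f b \<Longrightarrow> transpose a b \<in> fib_grp n f"
  by (auto simp: fib_grp_def transpose_perm transpose_def)

definition young_sum :: "nat \<Rightarrow> (nat \<Rightarrow> nat) \<Rightarrow> (nat \<Rightarrow> nat) \<Rightarrow> ((nat \<Rightarrow> nat) \<Rightarrow> complex) \<Rightarrow> complex" where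
  "young_sum n row col h = (\<Sum>p\<in>fib_grp n row. \<Sum>q\<in>fib_grp n col. of_int (sign q) * h (p \<circ> q))"

definition fib_fix :: "nat \<Rightarrow> (nat \<Rightarrow> nat) \<Rightarrow> (nat \<Rightarrow> nat) set" where
  "fib_fix n f = {\<pi> \<in> fib_grp (Suc n) f. \<pi> 0 = 0}"

lemma fib_fix_eq: "fib_fix n f = shiftp ` fib_grp n (\<lambda>k. f (Suc k))"
proof (intro equalityI subsetI)
  fix \<pi> assume \<pi>: "\<pi> \<in> fib_fix n f"
  then obtain \<sigma> where "\<pi> = shiftp \<sigma>" "\<sigma> permutes {..<n}"
    using fix_zero_shiftp[of \<pi> n] by (auto simp: fib_fix_def fib_grp_def)
  moreover have "f (shiftp \<sigma> (Suc k)) = f (Suc k)" for k using \<pi> unfolding calculation(1) fib_fix_def fib_grp_def by blast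
  ultimately show "\<pi> \<in> shiftp ` fib_grp n (\<lambda>k. f (Suc k))" by (auto simp: fib_grp_def)
next
  fix \<pi> assume "\<pi> \<in> shiftp ` fib_grp n (\<lambda>k. f (Suc k))"
  then show "\<pi> \<in> fib_fix n f" by (auto simp: fib_fix_def fib_grp_def shiftp_def split: nat.splits)
qed

text \<open>  The transpositions \<open>(0 v)\<close> with \<open>v\<close> in the fibre of \<open>0\<close> represent the nontrivial cosets of the stabilizer of \<open>0\<close>.\<close>

lemma fib_grp_split_left:
  "(\<Sum>\<pi>\<in>fib_grp (Suc n) f. g \<pi>) = (\<Sum>\<pi>\<in>fib_fix n f. g \<pi>)
     + (\<Sum>v\<in>{v. 0 < v \<and> v < Suc n \<and> f v = f 0}. \<Sum>\<pi>\<in>fib_fix n f. g (transpose 0 v \<circ> \<pi>))"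
    (is "_ = _ + (\<Sum>v\<in>?V. _)") for g :: "_ \<Rightarrow> 'a::comm_monoid_add"
proof -
  have "(\<Sum>\<pi>\<in>fib_grp (Suc n) f. g \<pi>) = (\<Sum>(v, \<pi>)\<in>insert 0 ?V \<times> fib_fix n f. g (transpose 0 v \<circ> \<pi>))"
  proof (rule sum.reindex_bij_witness[where j = "\<lambda>\<pi>. (\<pi> 0, transpose 0 (\<pi> 0) \<circ> \<pi>)" and i = "\<lambda>(v, \<pi>). transpose 0 v \<circ> \<pi>"])
    fix \<pi> assume \<pi>: "\<pi> \<in> fib_grp (Suc n) f"
    have "\<pi> 0 < Suc n" using permutes_in_image[OF fib_grpD(1)[OF \<pi>], of 0] by simp
    then show "(\<pi> 0, transpose 0 (\<pi> 0) \<circ> \<pi>) \<in> insert 0 ?V \<times> fib_fix n f"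
      using fib_grpD(2)[OF \<pi>, of 0] by (auto simp: fib_fix_def intro!: fib_grp_comp fib_grp_transpose \<pi>)
  next
    fix b assume "b \<in> insert 0 ?V \<times> fib_fix n f"
    then show "(case b of (v, \<pi>) \<Rightarrow> transpose 0 v \<circ> \<pi>) \<in> fib_grp (Suc n) f"
      by (auto simp: fib_fix_def intro!: fib_grp_comp fib_grp_transpose)
  qed (auto simp: fib_fix_def o_assoc)
  also have "\<dots> = (\<Sum>v\<in>insert 0 ?V. \<Sum>\<pi>\<in>fib_fix n f. g (transpose 0 v \<circ> \<pi>))"
    by (rule sum.cartesian_product[symmetric])
  finally show ?thesis by simp
qed

lemma fib_grp_split_right:
  "(\<Sum>\<pi>\<in>fib_grp (Suc n) f. g \<pi>) = (\<Sum>\<pi>\<in>fib_fix n f. g \<pi>)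
     + (\<Sum>v\<in>{v. 0 < v \<and> v < Suc n \<and> f v = f 0}. \<Sum>\<pi>\<in>fib_fix n f. g (\<pi> \<circ> transpose 0 v))"
    for g :: "_ \<Rightarrow> 'a::comm_monoid_add"
proof -
  have bij: "bij_betw inv (fib_grp (Suc n) f) (fib_grp (Suc n) f)"
    by (rule bij_betwI[where g = inv]) (auto intro: fib_grp_inv inv_inv_eq permutes_bij[OF fib_grpD(1)])
  have bij0: "bij_betw inv (fib_fix n f) (fib_fix n f)"
    by (rule bij_betwI[where g = inv])
      (auto simp: fib_fix_def permutes_inv_eq[OF fib_grpD(1)] intro: fib_grp_inv inv_inv_eq permutes_bij[OF fib_grpD(1)])
  have inv: "inv (transpose 0 v \<circ> \<pi>) = inv \<pi> \<circ> transpose 0 v" if "\<pi> \<in> fib_fix n f" for v \<pi>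
    using that by (subst o_inv_distrib) (auto simp: fib_fix_def intro: permutes_bij[OF fib_grpD(1)])
  show ?thesis
    using fib_grp_split_left[of "\<lambda>\<pi>. g (inv \<pi>)" n f]
    unfolding sum.reindex_bij_betw[OF bij] sum.reindex_bij_betw[OF bij0]
    by (simp add: inv sum.reindex_bij_betw[OF bij0, of "\<lambda>\<pi>. g (\<pi> \<circ> transpose 0 _)"] cong: sum.cong)
qed

text \<open>
  Removing the points \<open>0, 1, 2, \<dots>\<close> one after the other, each removed point \<open>d\<close> is a corner of what is left: for a
  point \<open>u\<close> in its row and a point \<open>v\<close> in its column, the fourth corner \<open>w\<close> of the rectangle is still present.
\<close>

definition peelable :: "nat \<Rightarrow> (nat \<Rightarrow> nat) \<Rightarrow> (nat \<Rightarrow> nat) \<Rightarrow> bool" where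
  "peelable n row col \<longleftrightarrow>
    (\<forall>i<n. \<forall>j<n. row i = row j \<longrightarrow> col i = col j \<longrightarrow> i = j) \<and>
    (\<forall>d u v. d < u \<longrightarrow> u < n \<longrightarrow> d < v \<longrightarrow> v < n \<longrightarrow> row u = row d \<longrightarrow> col v = col d \<longrightarrow>
       (\<exists>w>d. w < n \<and> row w = row v \<and> col w = col u))"

lemma peelable_Suc: "peelable (Suc n) row col \<Longrightarrow> peelable n (\<lambda>k. row (Suc k)) (\<lambda>k. col (Suc k))"
proof -
  assume p: "peelable (Suc n) row col"
  have "\<exists>w>d. w < n \<and> row (Suc w) = row (Suc v) \<and> col (Suc w) = col (Suc u)"
    if "d < u" "u < n" "d < v" "v < n" "row (Suc u) = row (Suc d)" "col (Suc v) = col (Suc d)" for d u v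
  proof -
    have "\<exists>w>Suc d. w < Suc n \<and> row w = row (Suc v) \<and> col w = col (Suc u)"
      using p[unfolded peelable_def, THEN conjunct2, rule_format, of "Suc d" "Suc u" "Suc v"] that by auto
    then obtain w where "w > Suc d" "w < Suc n" "row w = row (Suc v)" "col w = col (Suc u)" by blast
    then show ?thesis by (cases w) auto
  qed
  moreover have "i = j" if "i < n" "j < n" "row (Suc i) = row (Suc j)" "col (Suc i) = col (Suc j)" for i j
    using p[unfolded peelable_def, THEN conjunct1, rule_format, of "Suc i" "Suc j"] that by simp
  ultimately show ?thesis unfolding peelable_def by blast
qed

text \<open>  With the fourth corner \<open>w\<close> of the rectangle on \<open>m\<close>, \<open>0\<close> and \<open>v\<close>, the row transposition \<open>(w v)\<close> moves through
  \<open>(m v)\<close> and becomes the column transposition \<open>(w m)\<close>. So the sum equals its own negative.\<close>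

lemma cross_sum_zero:
  fixes \<omega> :: "(nat \<Rightarrow> nat) \<Rightarrow> complex"
  assumes p: "peelable (Suc n) row col"
    and m: "0 < m" "m < Suc n" "row m = row 0" and v: "0 < v" "v < Suc n" "col v = col 0"
  shows "(\<Sum>p\<in>fib_fix n row. \<Sum>q\<in>fib_fix n col. of_int (sign q) * \<omega> (p \<circ> (transpose m v \<circ> q))) = 0" (is "?S = 0")
proof -
  obtain w where w: "w > 0" "w < Suc n" "row w = row v" "col w = col m"
    using p[unfolded peelable_def, THEN conjunct2, rule_format, of 0 m v] m v by auto
  have inj: "i = j" if "i < Suc n" "j < Suc n" "row i = row j" "col i = col j" for i j
    using p that unfolding peelable_def by blast
  have "m \<noteq> v" using inj[of m 0] m v by auto
  have "w \<noteq> m" using inj[of v 0] w m v by auto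
  have "w \<noteq> v" using inj[of m 0] w m v by auto
  have bp: "bij_betw (\<lambda>p. p \<circ> transpose w v) (fib_fix n row) (fib_fix n row)"
    by (rule bij_betwI[where g = "\<lambda>p. p \<circ> transpose w v"])
      (use w v in \<open>auto simp: fib_fix_def o_assoc[symmetric] intro!: fib_grp_comp fib_grp_transpose\<close>)
  have bq: "bij_betw (\<lambda>q. transpose w m \<circ> q) (fib_fix n col) (fib_fix n col)"
    by (rule bij_betwI[where g = "\<lambda>q. transpose w m \<circ> q"])
      (use w m in \<open>auto simp: fib_fix_def o_assoc intro!: fib_grp_comp fib_grp_transpose\<close>)
  have t: "transpose w v \<circ> transpose m v = transpose m v \<circ> transpose w m"
    using \<open>m \<noteq> v\<close> \<open>w \<noteq> m\<close> \<open>w \<noteq> v\<close> by (auto simp: fun_eq_iff transpose_def)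
  have "?S = (\<Sum>p\<in>fib_fix n row. \<Sum>q\<in>fib_fix n col. of_int (sign q) * \<omega> (p \<circ> transpose w v \<circ> (transpose m v \<circ> q)))"
    by (rule sum.reindex_bij_betw[OF bp, symmetric])
  also have "\<dots> = (\<Sum>p\<in>fib_fix n row. \<Sum>q\<in>fib_fix n col. - (of_int (sign (transpose w m \<circ> q)) * \<omega> (p \<circ> (transpose m v \<circ> (transpose w m \<circ> q)))))"
  proof (intro sum.cong refl)
    fix p q :: "nat \<Rightarrow> nat" assume "q \<in> fib_fix n col"
    then have "sign (transpose w m \<circ> q) = - sign q"
      using w m \<open>w \<noteq> m\<close> sign_comp[of "transpose w m" "Suc n" q]
      by (auto simp: fib_fix_def fib_grp_def transpose_perm sign_swap_id)
    moreover have "p \<circ> transpose w v \<circ> (transpose m v \<circ> q) = p \<circ> (transpose m v \<circ> (transpose w m \<circ> q))"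
      using arg_cong[OF t, of "\<lambda>h. p \<circ> h \<circ> q"] by (simp only: o_assoc)
    ultimately show "of_int (sign q) * \<omega> (p \<circ> transpose w v \<circ> (transpose m v \<circ> q))
      = - (of_int (sign (transpose w m \<circ> q)) * \<omega> (p \<circ> (transpose m v \<circ> (transpose w m \<circ> q))))"
      by (simp only:) simp
  qed
  also have "\<dots> = (\<Sum>p\<in>fib_fix n row. \<Sum>q\<in>fib_fix n col. - (of_int (sign q) * \<omega> (p \<circ> (transpose m v \<circ> q))))"
    by (intro sum.cong refl sum.reindex_bij_betw[OF bq])
  also have "\<dots> = - ?S" by (simp add: sum_negf)
  finally show ?thesis by simp
qed

text \<open>  The exponent of \<open>t\<close> on the left counts the cycles of \<open>p q\<close>. The difference of the two cardinalities is
  the number of later boxes in the row of \<open>d\<close> minus the number of later boxes in its column. For the square, this is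
  minus the content of \<open>d\<close>, and the contents are symmetric about \<open>0\<close>, so that the right-hand side is the
  product of the \<open>t + content\<close>.

  The induction removes the box \<open>0\<close>. If neither \<open>p\<close> nor \<open>q\<close> moves it, it is a cycle and contributes \<open>t\<close>. If only
  \<open>q\<close> moves it, to one of the boxes of its column, it can be cut out of its cycle at the cost of the sign of a
  transposition; if only \<open>p\<close> moves it, it can be cut out without a sign. If both move it, the terms cancel by
  \<open>cross_sum_zero\<close>.\<close>

lemma content_formula:
  assumes \<psi>: "cycle_trace \<tau> \<psi>" and \<tau>: "\<And>k. k \<ge> 1 \<Longrightarrow> \<tau> k = t" and "peelable n row col"
  shows "young_sum n row col (\<psi> n (\<lambda>_. 1))
    = (\<Prod>d<n. t + of_nat (card {u. d < u \<and> u < n \<and> row u = row d}) - of_nat (card {v. d < v \<and> v < n \<and> col v = col d}))"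
proof -
  define \<chi> where "\<chi> = (\<lambda>m. \<psi> m (\<lambda>_. 1))"
  have \<chi>0: "\<chi> 0 \<pi> = 1" for \<pi> unfolding \<chi>_def by (rule cycle_traceD(1)[OF \<psi>])
  have fixed: "\<chi> (Suc n) (shiftp \<pi>) = t * \<chi> n \<pi>" if "\<pi> permutes {..<n}" for n \<pi>
    using cycle_traceD(2)[OF \<psi> that, of "\<lambda>_. 1"] \<tau>[of 1] by (simp add: \<chi>_def)
  have merge: "\<chi> (Suc n) (shiftp \<pi> \<circ> transpose 0 (Suc l)) = \<chi> n \<pi>" if "\<pi> permutes {..<n}" "l < n" for n \<pi> l
    unfolding \<chi>_def cycle_traceD(3)[OF \<psi> that]
    by (rule cycle_trace_idempotent[OF \<psi> \<tau> that(1)]) auto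
  have "(\<Sum>p\<in>fib_grp n row. \<Sum>q\<in>fib_grp n col. of_int (sign q) * \<chi> n (p \<circ> q))
    = (\<Prod>d<n. t + of_nat (card {u. d < u \<and> u < n \<and> row u = row d}) - of_nat (card {v. d < v \<and> v < n \<and> col v = col d}))"
    using assms(3)
  proof (induction n arbitrary: row col)
    case 0
    have "fib_grp 0 f = {id}" for f by (auto simp: fib_grp_def)
    then show ?case using \<chi>0 by simp
  next
    case (Suc n)
    define \<omega> where "\<omega> = (\<lambda>\<pi>. \<chi> n (\<lambda>j. \<pi> (Suc j) - 1))"
    have \<omega>_shiftp: "\<omega> (shiftp \<sigma>) = \<chi> n \<sigma>" for \<sigma> by (simp add: \<omega>_def)
    have fixed': "\<chi> (Suc n) \<pi> = t * \<omega> \<pi>" if "\<pi> permutes {..<Suc n}" "\<pi> 0 = 0" for \<pi>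
      using that by (elim fix_zero_shiftp) (simp_all add: \<omega>_shiftp fixed)
    have merge': "\<chi> (Suc n) (\<pi> \<circ> transpose 0 l) = \<omega> \<pi>" if "\<pi> permutes {..<Suc n}" "\<pi> 0 = 0" "0 < l" "l < Suc n" for \<pi> l
    proof -
      note h = that
      obtain \<sigma> where \<sigma>: "\<pi> = shiftp \<sigma>" "\<sigma> permutes {..<n}" using h(1,2) by (rule fix_zero_shiftp)
      obtain j where "l = Suc j" "j < n" using h(3,4) by (cases l) auto
      then show ?thesis using merge[OF \<sigma>(2), of j] by (simp add: \<sigma>(1) \<omega>_shiftp)
    qed
    let ?R = "fib_fix n row" and ?C = "fib_fix n col"
    let ?U = "{u. 0 < u \<and> u < Suc n \<and> row u = row 0}" and ?V = "{v. 0 < v \<and> v < Suc n \<and> col v = col 0}"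
    define E where "E = (\<Sum>p\<in>?R. \<Sum>q\<in>?C. of_int (sign q) * \<omega> (p \<circ> q))"
    have memR: "p permutes {..<Suc n}" "p 0 = 0" if "p \<in> ?R" for p using that by (auto simp: fib_fix_def fib_grp_def)
    have memC: "p permutes {..<Suc n}" "p 0 = 0" if "p \<in> ?C" for p using that by (auto simp: fib_fix_def fib_grp_def)
    note inj = Suc.prems[unfolded peelable_def, THEN conjunct1]
    define T where "T = (\<lambda>p q. of_int (sign q) * \<chi> (Suc n) (p \<circ> q))"
    text \<open>\<open>q\<close> moves \<open>0\<close>, \<open>p\<close> does not.\<close>
    have 1: "(\<Sum>q\<in>fib_grp (Suc n) col. T p q) = (\<Sum>q\<in>?C. (t - of_nat (card ?V)) * (of_int (sign q) * \<omega> (p \<circ> q)))"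
      if p: "p \<in> ?R" for p
    proof -
      have "T p q = t * (of_int (sign q) * \<omega> (p \<circ> q))" if "q \<in> ?C" for q
        using memR[OF p] memC[OF that] fixed'[of "p \<circ> q"] by (simp add: T_def permutes_compose)
      moreover have "T p (q \<circ> transpose 0 v) = - (of_int (sign q) * \<omega> (p \<circ> q))" if "q \<in> ?C" "v \<in> ?V" for q v
      proof -
        have "sign (q \<circ> transpose 0 v) = - sign q"
          using memC[OF that(1)] that(2) sign_comp[of q "Suc n" "transpose 0 v"] by (simp add: transpose_perm sign_swap_id)
        moreover have "\<chi> (Suc n) (p \<circ> (q \<circ> transpose 0 v)) = \<omega> (p \<circ> q)"
          unfolding o_assoc using memR[OF p] memC[OF that(1)] that(2) by (intro merge') (auto intro: permutes_compose)
        ultimately show ?thesis by (simp add: T_def)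
      qed
      ultimately show ?thesis
        by (simp add: fib_grp_split_right[of "T p"] sum_negf sum_distrib_left[symmetric] left_diff_distrib sum_subtractf)
    qed
    have conj: "transpose 0 m \<circ> q = q \<circ> transpose 0 (inv q m)" "0 < inv q m" "inv q m < Suc n"
      if q: "q \<in> ?C" and m: "m \<in> ?U" for q m
    proof -
      note perm = memC(1)[OF q]
      have q0: "inv q 0 = 0" using permutes_inv_eq[OF perm] memC(2)[OF q] by simp
      show "transpose 0 m \<circ> q = q \<circ> transpose 0 (inv q m)"
        using transpose_comp_eq[OF permutes_bij[OF perm], of 0 m] by (simp only: q0)
      have "inv q m \<noteq> 0" using permutes_inv_eq[OF perm, of m 0] memC(2)[OF q] m by auto
      then show "0 < inv q m" by simp
      show "inv q m < Suc n" using permutes_in_image[OF permutes_inv[OF perm], of m] m by simp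
    qed
    text \<open>\<open>p\<close> moves \<open>0\<close>, \<open>q\<close> does not.\<close>
    have 2: "T (p \<circ> transpose 0 m) q = of_int (sign q) * \<omega> (p \<circ> q)" if "p \<in> ?R" "m \<in> ?U" "q \<in> ?C" for p m q
    proof -
      have "\<chi> (Suc n) (p \<circ> q \<circ> transpose 0 (inv q m)) = \<omega> (p \<circ> q)"
        using that memR[OF that(1)] memC[OF that(3)] conj[OF that(3,2)] by (intro merge') (auto intro: permutes_compose)
      moreover have "p \<circ> transpose 0 m \<circ> q = p \<circ> q \<circ> transpose 0 (inv q m)"
        using conj(1)[of q m] that by (simp only: o_assoc[symmetric])
      ultimately show ?thesis unfolding T_def by (simp only:)
    qed
    text \<open>Both move \<open>0\<close>.\<close>
    have 3: "T (p \<circ> transpose 0 m) (transpose 0 v \<circ> q) = - (of_int (sign q) * \<omega> (p \<circ> (transpose m v \<circ> q)))"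
      if p: "p \<in> ?R" and m: "m \<in> ?U" and q: "q \<in> ?C" and v: "v \<in> ?V" for p m q v
    proof -
      have "m \<noteq> v" using inj[rule_format, of m 0] m v by auto
      then have "transpose 0 m \<circ> transpose 0 v = transpose m v \<circ> transpose 0 m"
        using m v by (auto simp: fun_eq_iff transpose_def)
      then have "p \<circ> transpose 0 m \<circ> (transpose 0 v \<circ> q) = p \<circ> transpose m v \<circ> (transpose 0 m \<circ> q)"
        by (metis o_assoc)
      also have "\<dots> = p \<circ> (transpose m v \<circ> q) \<circ> transpose 0 (inv q m)"
        unfolding conj(1)[OF q m] by (simp only: o_assoc)
      finally have e: "p \<circ> transpose 0 m \<circ> (transpose 0 v \<circ> q) = \<dots>" .
      have "\<chi> (Suc n) (p \<circ> (transpose m v \<circ> q) \<circ> transpose 0 (inv q m)) = \<omega> (p \<circ> (transpose m v \<circ> q))"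
        using m v memR[OF p] memC[OF q] conj[OF q m] by (intro merge') (auto intro!: permutes_compose transpose_perm)
      moreover have "sign (transpose 0 v \<circ> q) = - sign q"
        using memC[OF q] v sign_comp[of "transpose 0 v" "Suc n" q] by (simp add: transpose_perm sign_swap_id)
      ultimately show ?thesis unfolding T_def e by simp
    qed
    have "(\<Sum>p\<in>fib_grp (Suc n) row. \<Sum>q\<in>fib_grp (Suc n) col. T p q)
       = (t - of_nat (card ?V)) * E + (\<Sum>m\<in>?U. \<Sum>p\<in>?R. \<Sum>q\<in>fib_grp (Suc n) col. T (p \<circ> transpose 0 m) q)"
      unfolding fib_grp_split_right[of _ n row] by (simp add: 1 E_def sum_distrib_left)
    also have "(\<Sum>m\<in>?U. \<Sum>p\<in>?R. \<Sum>q\<in>fib_grp (Suc n) col. T (p \<circ> transpose 0 m) q) = (\<Sum>m\<in>?U. E)"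
    proof (rule sum.cong[OF refl])
      fix m assume m: "m \<in> ?U"
      have "(\<Sum>p\<in>?R. \<Sum>q\<in>fib_grp (Suc n) col. T (p \<circ> transpose 0 m) q)
         = E + (\<Sum>p\<in>?R. \<Sum>v\<in>?V. \<Sum>q\<in>?C. - (of_int (sign q) * \<omega> (p \<circ> (transpose m v \<circ> q))))"
        unfolding fib_grp_split_left[of _ n col] sum.distrib E_def
        using m by (intro arg_cong2[of _ _ _ _ "(+)"] sum.cong refl 2 3) auto
      also have "(\<Sum>p\<in>?R. \<Sum>v\<in>?V. \<Sum>q\<in>?C. - (of_int (sign q) * \<omega> (p \<circ> (transpose m v \<circ> q)))) = 0"
        unfolding sum_negf using cross_sum_zero[OF Suc.prems, of m _ \<omega>] m
        by (subst sum.swap) auto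
      finally show "(\<Sum>p\<in>?R. \<Sum>q\<in>fib_grp (Suc n) col. T (p \<circ> transpose 0 m) q) = E" by (simp only: add_0_right)
    qed
    finally have *: "(\<Sum>p\<in>fib_grp (Suc n) row. \<Sum>q\<in>fib_grp (Suc n) col. T p q)
       = (t + of_nat (card ?U) - of_nat (card ?V)) * E" by (simp add: algebra_simps)
    have inj_sh: "inj_on shiftp X" for X by (auto simp: inj_on_def)
    have "E = (\<Sum>p\<in>fib_grp n (\<lambda>k. row (Suc k)). \<Sum>q\<in>fib_grp n (\<lambda>k. col (Suc k)). of_int (sign q) * \<chi> n (p \<circ> q))"
      unfolding E_def fib_fix_eq sum.reindex[OF inj_sh, unfolded o_def]
      by (intro sum.cong refl) (simp only: sign_shiftp[OF fib_grpD(1)] shiftp_comp[symmetric] \<omega>_shiftp)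
    also have "\<dots> = (\<Prod>d<n. t + of_nat (card {u. d < u \<and> u < n \<and> row (Suc u) = row (Suc d)})
        - of_nat (card {v. d < v \<and> v < n \<and> col (Suc v) = col (Suc d)}))"
      by (rule Suc.IH[OF peelable_Suc[OF Suc.prems]])
    also have "\<dots> = (\<Prod>d<n. t + of_nat (card {u. Suc d < u \<and> u < Suc n \<and> row u = row (Suc d)})
        - of_nat (card {v. Suc d < v \<and> v < Suc n \<and> col v = col (Suc d)}))"
    proof -
      have "card {u. d < u \<and> u < n \<and> f (Suc u) = c} = card {u. Suc d < u \<and> u < Suc n \<and> f u = c}" for d c and f :: "nat \<Rightarrow> nat"
      proof -
        have "{u. Suc d < u \<and> u < Suc n \<and> f u = c} = Suc ` {u. d < u \<and> u < n \<and> f (Suc u) = c}"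
          by (auto simp: image_iff) (metis Suc_less_eq Suc_pred' gr_implies_not0 less_Suc_eq_0_disj)
        then show ?thesis by (simp add: card_image)
      qed
      then show ?thesis by simp
    qed
    finally show ?case using * unfolding T_def prod.lessThan_Suc_shift by (simp only:)
  qed
  then show ?thesis by (simp only: young_sum_def \<chi>_def)
qed

section \<open>Traces on group algebras\<close>

lemma fun_sum_apply: "(\<Sum>i\<in>I. g i) x = (\<Sum>i\<in>I. g i x)" for g :: "'i \<Rightarrow> 'a \<Rightarrow> 'b::comm_monoid_add"
  by (induction I rule: infinite_finite_induct) (auto simp: zero_fun_def plus_fun_def)

text \<open>
  If \<open>V\<close> is the image of a projection of the space of functions on \<open>I\<close>, the trace of \<open>f\<close> on \<open>V\<close> is the trace of \<open>f\<close>
  after the projection on the whole space, where the unit vectors are a basis; \<open>e \<tau>\<close> is the projection of the unit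
  vector at \<open>\<tau>\<close>. For \<open>f\<close> the identity this computes the dimension of \<open>V\<close>.
\<close>

lemma trace_on_projection:
  fixes V :: "('a \<Rightarrow> complex) set"
  assumes I: "finite I" and V: "fun_vs.subspace V" and e: "\<And>\<tau>. \<tau> \<in> I \<Longrightarrow> e \<tau> \<in> V"
    and proj: "\<And>x. x \<in> V \<Longrightarrow> x = (\<Sum>\<tau>\<in>I. fun_scale (x \<tau>) (e \<tau>))"
    and f: "\<And>x. x \<in> V \<Longrightarrow> f x \<in> V" "\<And>x. x \<in> V \<Longrightarrow> f x = (\<Sum>\<tau>\<in>I. fun_scale (x \<tau>) (f (e \<tau>)))"
  shows "fun_vs.trace_on V f = (\<Sum>\<tau>\<in>I. f (e \<tau>) \<tau>)"
    and "of_nat (fun_vs.dim V) = (\<Sum>\<tau>\<in>I. e \<tau> \<tau>)"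
proof -
  have basis: "\<exists>B. fun_vs.independent B \<and> fun_vs.span B = V"
    using fun_vs.maximal_independent_subset[of V] V by (metis fun_vs.span_subspace)
  have VI: "V \<subseteq> fun_vs.span (e ` I)"
  proof
    fix x assume "x \<in> V"
    then have "x = (\<Sum>\<tau>\<in>I. fun_scale (x \<tau>) (e \<tau>))" by (rule proj)
    also have "\<dots> \<in> fun_vs.span (e ` I)"
      by (intro fun_vs.span_sum fun_vs.span_scale fun_vs.span_base) auto
    finally show "x \<in> fun_vs.span (e ` I)" .
  qed
  have tr: "(\<Sum>b\<in>B. fun_vs.representation B (h b) b) = (\<Sum>\<tau>\<in>I. h (e \<tau>) \<tau>)"
    if B: "fun_vs.independent B" "fun_vs.span B = V"
      and h: "\<And>x. x \<in> V \<Longrightarrow> h x \<in> V" "\<And>x. x \<in> V \<Longrightarrow> h x = (\<Sum>\<tau>\<in>I. fun_scale (x \<tau>) (h (e \<tau>)))" for B h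
  proof -
    have fin: "finite B" using fun_vs.independent_span_bound[of "e ` I" B] I B VI fun_vs.span_superset by blast
    have hspan: "h (e \<tau>) \<in> fun_vs.span B" if "\<tau> \<in> I" for \<tau>
      using h(1)[OF e[OF that]] B(2) by simp
    have rep: "fun_vs.representation B (h b) b = (\<Sum>\<tau>\<in>I. b \<tau> * fun_vs.representation B (h (e \<tau>)) b)" if "b \<in> B" for b
    proof -
      have b: "b \<in> V" using that B fun_vs.span_base by blast
      have "fun_vs.representation B (h b) = fun_vs.representation B (\<Sum>\<tau>\<in>I. fun_scale (b \<tau>) (h (e \<tau>)))"
        by (rule arg_cong[OF h(2)[OF b]])
      also have "\<dots> = (\<lambda>c. \<Sum>\<tau>\<in>I. fun_vs.representation B (fun_scale (b \<tau>) (h (e \<tau>))) c)"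
        by (intro fun_vs.representation_sum B fun_vs.span_scale hspan)
      finally show ?thesis by (simp add: fun_vs.representation_scale[OF B(1) hspan])
    qed
    have "(\<Sum>b\<in>B. fun_vs.representation B (h b) b) = (\<Sum>b\<in>B. \<Sum>\<tau>\<in>I. b \<tau> * fun_vs.representation B (h (e \<tau>)) b)"
      by (rule sum.cong) (auto simp: rep)
    also have "\<dots> = (\<Sum>\<tau>\<in>I. \<Sum>b\<in>B. fun_scale (fun_vs.representation B (h (e \<tau>)) b) b \<tau>)"
      by (subst sum.swap) (simp add: fun_scale_def mult.commute)
    also have "\<dots> = (\<Sum>\<tau>\<in>I. h (e \<tau>) \<tau>)"
    proof (intro sum.cong refl)
      fix \<tau> assume \<tau>: "\<tau> \<in> I"
      have "(\<Sum>b\<in>B. fun_scale (fun_vs.representation B (h (e \<tau>)) b) b) = h (e \<tau>)"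
        using fin by (intro fun_vs.sum_representation_eq B hspan \<tau>) auto
      from fun_cong[OF this, of \<tau>]
      show "(\<Sum>b\<in>B. fun_scale (fun_vs.representation B (h (e \<tau>)) b) b \<tau>) = h (e \<tau>) \<tau>"
        by (simp only: fun_sum_apply)
    qed
    finally show ?thesis .
  qed
  define B where "B = (SOME B. fun_vs.independent B \<and> fun_vs.span B = V)"
  have B: "fun_vs.independent B \<and> fun_vs.span B = V" unfolding B_def by (rule someI_ex[OF basis])
  show "fun_vs.trace_on V f = (\<Sum>\<tau>\<in>I. f (e \<tau>) \<tau>)"
    unfolding fun_vs.trace_on_def B_def[symmetric] Let_def using B f by (intro tr) auto
  have "of_nat (fun_vs.dim V) = (of_nat (card B) :: complex)"
    using B fun_vs.dim_eq_card[of B V] by (metis fun_vs.span_span)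
  also have "\<dots> = (\<Sum>b\<in>B. fun_vs.representation B b b)"
    using B by (simp add: fun_vs.representation_basis)
  also have "\<dots> = (\<Sum>\<tau>\<in>I. e \<tau> \<tau>)" using B proj by (intro tr[where h = "\<lambda>x. x"]) auto
  finally show "of_nat (fun_vs.dim V) = (\<Sum>\<tau>\<in>I. e \<tau> \<tau>)" .
qed

lemma sym_grp_iff: "\<pi> \<in> sym_grp n \<longleftrightarrow> \<pi> permutes {..<n}" by (simp add: sym_grp_def)

lemma sym_grp_simps [simp]: "id \<in> sym_grp n" "finite (sym_grp n)"
  "\<pi> \<in> sym_grp n \<Longrightarrow> inv \<pi> \<in> sym_grp n"
  "\<lbrakk>\<pi> \<in> sym_grp n; \<sigma> \<in> sym_grp n\<rbrakk> \<Longrightarrow> \<pi> \<circ> \<sigma> \<in> sym_grp n"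
  by (auto simp: sym_grp_def permutes_id finite_permutations permutes_inv permutes_compose)

lemma sym_grp_inverse [simp]:
  assumes "\<pi> \<in> sym_grp n" shows "\<pi> \<circ> inv \<pi> = id" "inv \<pi> \<circ> \<pi> = id" "inv (inv \<pi>) = \<pi>"
   "\<pi> \<circ> (inv \<pi> \<circ> h) = h" "inv \<pi> \<circ> (\<pi> \<circ> h) = h"
proof -
  have p: "\<pi> permutes {..<n}" using assms by (simp add: sym_grp_iff)
  show i: "\<pi> \<circ> inv \<pi> = id" "inv \<pi> \<circ> \<pi> = id" using permutes_inv_o[OF p] by auto
  show "inv (inv \<pi>) = \<pi>" using permutes_inv_inv[OF p] .
  show "\<pi> \<circ> (inv \<pi> \<circ> h) = h" "inv \<pi> \<circ> (\<pi> \<circ> h) = h" unfolding o_assoc i by simp_all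
qed

lemma sym_grp_inv_comp: "\<lbrakk>\<pi> \<in> sym_grp n; \<sigma> \<in> sym_grp n\<rbrakk> \<Longrightarrow> inv (\<pi> \<circ> \<sigma>) = inv \<sigma> \<circ> inv \<pi>"
  by (intro o_inv_distrib) (auto simp: sym_grp_iff permutes_bij)

lemma sum_sym_grp_left: "\<pi> \<in> sym_grp n \<Longrightarrow> (\<Sum>\<sigma>\<in>sym_grp n. g (\<pi> \<circ> \<sigma>)) = (\<Sum>\<sigma>\<in>sym_grp n. g \<sigma>)"
  by (rule sum.reindex_bij_witness[where i = "\<lambda>\<sigma>. inv \<pi> \<circ> \<sigma>" and j = "\<lambda>\<sigma>. \<pi> \<circ> \<sigma>"]) auto

lemma sum_sym_grp_inv: "(\<Sum>\<sigma>\<in>sym_grp n. g (inv \<sigma>)) = (\<Sum>\<sigma>\<in>sym_grp n. g \<sigma>)"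
  by (rule sum.reindex_bij_witness[where i = inv and j = inv]) auto

lemma ga_mult_assoc: "ga_mult n (ga_mult n x y) z = ga_mult n x (ga_mult n y z)"
proof
  fix \<pi>
  show "ga_mult n (ga_mult n x y) z \<pi> = ga_mult n x (ga_mult n y z) \<pi>"
  proof (cases "\<pi> \<in> sym_grp n")
    case True
    have "ga_mult n (ga_mult n x y) z \<pi>
        = (\<Sum>\<sigma>\<in>sym_grp n. \<Sum>\<tau>\<in>sym_grp n. x \<tau> * y (inv \<tau> \<circ> \<sigma>) * z (inv \<sigma> \<circ> \<pi>))"
      using True by (simp add: ga_mult_def sum_distrib_right)
    also have "\<dots> = (\<Sum>\<tau>\<in>sym_grp n. \<Sum>\<sigma>\<in>sym_grp n. x \<tau> * y (inv \<tau> \<circ> \<sigma>) * z (inv \<sigma> \<circ> \<pi>))"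
      by (rule sum.swap)
    also have "\<dots> = (\<Sum>\<tau>\<in>sym_grp n. \<Sum>\<sigma>\<in>sym_grp n. x \<tau> * y (inv \<tau> \<circ> (\<tau> \<circ> \<sigma>)) * z (inv (\<tau> \<circ> \<sigma>) \<circ> \<pi>))"
      by (intro sum.cong refl sum_sym_grp_left[symmetric])
    also have "\<dots> = (\<Sum>\<tau>\<in>sym_grp n. x \<tau> * (\<Sum>\<sigma>\<in>sym_grp n. y \<sigma> * z (inv \<sigma> \<circ> (inv \<tau> \<circ> \<pi>))))"
      unfolding sum_distrib_left by (intro sum.cong refl) (simp add: sym_grp_inv_comp o_assoc mult.assoc)
    also have "\<dots> = ga_mult n x (ga_mult n y z) \<pi>" using True by (simp add: ga_mult_def)
    finally show ?thesis .
  qed (simp add: ga_mult_def)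
qed

lemma ga_mult_in [simp]: "ga_mult n x y \<in> grp_alg n" by (auto simp: grp_alg_def ga_mult_def)

lemma ga_mult_scale: "ga_mult n (fun_scale k x) y = fun_scale k (ga_mult n x y)"
  "ga_mult n x (fun_scale k y) = fun_scale k (ga_mult n x y)"
  by (auto simp: ga_mult_def fun_scale_def fun_eq_iff sum_distrib_left mult_ac)

lemma ga_mult_add: "ga_mult n (x + y) z = ga_mult n x z + ga_mult n y z"
  "ga_mult n z (x + y) = ga_mult n z x + ga_mult n z y"
  by (auto simp: ga_mult_def plus_fun_def fun_eq_iff sum.distrib algebra_simps)

lemma ga_mult_zero [simp]: "ga_mult n 0 z = 0" "ga_mult n z 0 = 0"
  by (auto simp: ga_mult_def zero_fun_def fun_eq_iff)

lemma ga_mult_sum: "ga_mult n (\<Sum>i\<in>I. x i) z = (\<Sum>i\<in>I. ga_mult n (x i) z)"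
  "ga_mult n z (\<Sum>i\<in>I. x i) = (\<Sum>i\<in>I. ga_mult n z (x i))"
  by (induction I rule: infinite_finite_induct) (auto simp: ga_mult_add)

lemma ga_mult_single_left: "\<sigma> \<in> sym_grp n \<Longrightarrow> \<pi> \<in> sym_grp n \<Longrightarrow> ga_mult n (ga_single \<sigma>) x \<pi> = x (inv \<sigma> \<circ> \<pi>)"
  by (simp add: ga_mult_def ga_single_def if_distrib[where f = "\<lambda>c. c * _"] cong: if_cong)

lemma ga_mult_single_right:
  assumes "\<sigma> \<in> sym_grp n" "\<pi> \<in> sym_grp n" shows "ga_mult n x (ga_single \<sigma>) \<pi> = x (\<pi> \<circ> inv \<sigma>)"
proof -
  have *: "inv \<tau> \<circ> \<pi> = \<sigma> \<longleftrightarrow> \<tau> = \<pi> \<circ> inv \<sigma>" if "\<tau> \<in> sym_grp n" for \<tau>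
    using assms that by (metis comp_id o_assoc sym_grp_inverse(1) sym_grp_inverse(2) sym_grp_inverse(4) sym_grp_inverse(5))
  show ?thesis using assms
    by (simp add: * ga_mult_def ga_single_def if_distrib[where f = "\<lambda>c. _ * c"] cong: if_cong sum.cong)
qed

lemma grp_alg_expand: "x \<in> grp_alg n \<Longrightarrow> x = (\<Sum>\<tau>\<in>sym_grp n. fun_scale (x \<tau>) (ga_single \<tau>))"
  by (rule ext) (simp add: fun_sum_apply fun_scale_def ga_single_def grp_alg_def
      if_distrib[where f = "\<lambda>c. _ * c"] cong: if_cong)

lemma ga_single_in [simp]: "\<pi> \<in> sym_grp n \<Longrightarrow> ga_single \<pi> \<in> grp_alg n"
  by (auto simp: grp_alg_def ga_single_def)

lemma ga_trace: "ga_mult n x y id = ga_mult n y x id"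
  using sum_sym_grp_inv[of "\<lambda>\<sigma>. x \<sigma> * y (inv \<sigma>)" n] by (simp add: ga_mult_def mult.commute)

text \<open>  The adjoint for the scalar product in which the permutations are an orthonormal basis.\<close>

definition ga_star :: "nat \<Rightarrow> ((nat \<Rightarrow> nat) \<Rightarrow> complex) \<Rightarrow> (nat \<Rightarrow> nat) \<Rightarrow> complex" where
  "ga_star n x = (\<lambda>\<pi>. if \<pi> \<in> sym_grp n then cnj (x (inv \<pi>)) else 0)"

lemma ga_star_mult: "ga_star n (ga_mult n x y) = ga_mult n (ga_star n y) (ga_star n x)"
proof
  fix \<pi>
  show "ga_star n (ga_mult n x y) \<pi> = ga_mult n (ga_star n y) (ga_star n x) \<pi>"
  proof (cases "\<pi> \<in> sym_grp n")
    case True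
    have "ga_mult n (ga_star n y) (ga_star n x) \<pi> = (\<Sum>\<sigma>\<in>sym_grp n. cnj (y (inv \<sigma>)) * cnj (x (inv (inv \<sigma> \<circ> \<pi>))))"
      using True by (simp add: ga_mult_def ga_star_def)
    also have "\<dots> = (\<Sum>\<sigma>\<in>sym_grp n. cnj (y (inv (\<pi> \<circ> \<sigma>))) * cnj (x (inv (inv (\<pi> \<circ> \<sigma>) \<circ> \<pi>))))"
      by (rule sum_sym_grp_left[OF True, symmetric])
    also have "\<dots> = (\<Sum>\<sigma>\<in>sym_grp n. cnj (x \<sigma>) * cnj (y (inv \<sigma> \<circ> inv \<pi>)))"
      using True by (intro sum.cong refl) (simp add: sym_grp_inv_comp o_assoc[symmetric])
    also have "\<dots> = ga_star n (ga_mult n x y) \<pi>" using True by (simp add: ga_mult_def ga_star_def)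
    finally show ?thesis by simp
  qed (simp add: ga_mult_def ga_star_def)
qed

text \<open>  The coefficient of \<open>x\<^sup>* x\<close> at the identity is the squared norm of \<open>x\<close>.\<close>

lemma ga_star_positive:
  assumes "x \<in> grp_alg n" "ga_mult n (ga_star n x) x = 0" shows "x = 0"
proof -
  have "0 = ga_mult n (ga_star n x) x id" using assms(2) by (simp add: zero_fun_def)
  also have "\<dots> = (\<Sum>\<sigma>\<in>sym_grp n. cnj (x (inv \<sigma>)) * x (inv \<sigma>))" by (simp add: ga_mult_def ga_star_def)
  also have "\<dots> = (\<Sum>\<sigma>\<in>sym_grp n. cnj (x \<sigma>) * x \<sigma>)" by (rule sum_sym_grp_inv)
  also have "\<dots> = of_real (\<Sum>\<sigma>\<in>sym_grp n. (cmod (x \<sigma>))\<^sup>2)"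
    unfolding of_real_sum by (intro sum.cong refl) (metis complex_norm_square mult.commute)
  finally have "(\<Sum>\<sigma>\<in>sym_grp n. (cmod (x \<sigma>))\<^sup>2) = 0" by (metis of_real_eq_0_iff)
  then have "x \<sigma> = 0" if "\<sigma> \<in> sym_grp n" for \<sigma>
    using that by (subst (asm) sum_nonneg_eq_0_iff) auto
  then show ?thesis using assms(1) by (auto simp: grp_alg_def fun_eq_iff zero_fun_def)
qed

section \<open>Young symmetrizers\<close>

text \<open>
  The two facts about a tableau from which the properties of its Young symmetrizer follow. A permutation \<open>g\<close> that is
  not the product of a row and a column permutation takes two boxes of some column to one row; for the
  corresponding row transposition \<open>r\<close>, \<open>g\<^sup>-\<^sup>1 r g\<close> is a column transposition.
\<close>

locale young_pair =
  fixes n :: nat and row col :: "nat \<Rightarrow> nat"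
  assumes joint_inj: "\<lbrakk>i < n; j < n; row i = row j; col i = col j\<rbrakk> \<Longrightarrow> i = j"
    and dichotomy: "g \<in> sym_grp n \<Longrightarrow> (\<exists>p\<in>fib_grp n row. \<exists>q\<in>fib_grp n col. g = p \<circ> q) \<or>
      (\<exists>u v. u < n \<and> v < n \<and> u \<noteq> v \<and> row u = row v \<and> col (inv g u) = col (inv g v))"
begin

abbreviation "R \<equiv> fib_grp n row"
abbreviation "L \<equiv> fib_grp n col"
abbreviation mult (infixl "\<odot>" 70) where "x \<odot> y \<equiv> ga_mult n x y"

definition row_sum :: "(nat \<Rightarrow> nat) \<Rightarrow> complex" where "row_sum = (\<Sum>\<pi>\<in>R. ga_single \<pi>)"
definition col_sum :: "(nat \<Rightarrow> nat) \<Rightarrow> complex" where "col_sum = (\<Sum>\<pi>\<in>L. fun_scale (of_int (sign \<pi>)) (ga_single \<pi>))"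
definition yc :: "(nat \<Rightarrow> nat) \<Rightarrow> complex" where "yc = row_sum \<odot> col_sum"

lemma row_sum_apply: "row_sum g = (if g \<in> R then 1 else 0)"
  by (simp add: row_sum_def fun_sum_apply ga_single_def)

lemma col_sum_apply: "col_sum g = (if g \<in> L then of_int (sign g) else 0)"
  by (simp add: col_sum_def fun_sum_apply fun_scale_def ga_single_def if_distrib[where f = "\<lambda>c. _ * c"] cong: if_cong)

lemma R_sub [simp]: "g \<in> R \<Longrightarrow> g \<in> sym_grp n" and L_sub [simp]: "g \<in> L \<Longrightarrow> g \<in> sym_grp n"
  by (auto simp: fib_grp_def sym_grp_iff)

lemma id_fib_grp [simp]: "id \<in> fib_grp n f"
  unfolding fib_grp_def using permutes_id by auto

lemma inv_fib_grp [simp]: "g \<in> sym_grp n \<Longrightarrow> inv g \<in> fib_grp n f \<longleftrightarrow> g \<in> fib_grp n f"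
  using fib_grp_inv[of g n f] fib_grp_inv[of "inv g" n f] by auto

lemma comp_fib_grp: "\<lbrakk>p \<in> fib_grp n f\<rbrakk> \<Longrightarrow> p \<circ> g \<in> fib_grp n f \<longleftrightarrow> g \<in> fib_grp n f"
   "\<lbrakk>p \<in> fib_grp n f\<rbrakk> \<Longrightarrow> g \<circ> p \<in> fib_grp n f \<longleftrightarrow> g \<in> fib_grp n f"
proof -
  assume p: "p \<in> fib_grp n f"
  then have pn: "p \<in> sym_grp n" by (simp add: sym_grp_iff fib_grp_def)
  have "inv p \<circ> (p \<circ> g) = g" "(g \<circ> p) \<circ> inv p = g"
    using pn by (simp_all add: o_assoc[symmetric])
  then show "p \<circ> g \<in> fib_grp n f \<longleftrightarrow> g \<in> fib_grp n f" "g \<circ> p \<in> fib_grp n f \<longleftrightarrow> g \<in> fib_grp n f"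
    using fib_grp_comp[of p n f g] fib_grp_comp[of "inv p" n f "p \<circ> g"] fib_grp_comp[of g n f p]
      fib_grp_comp[of "g \<circ> p" n f "inv p"] fib_grp_inv[OF p] p by metis+
qed

lemma sign_sym: "\<lbrakk>g \<in> sym_grp n; h \<in> sym_grp n\<rbrakk> \<Longrightarrow> sign (g \<circ> h) = sign g * sign h"
  by (rule sign_comp[of _ n]) (auto simp: sym_grp_iff)

lemma sign_inv_sym: "g \<in> sym_grp n \<Longrightarrow> sign (inv g) = sign g"
  by (rule sign_inverse) (auto simp: sym_grp_iff intro: permutes_finite)

lemma R_L_id: "g \<in> R \<Longrightarrow> g \<in> L \<Longrightarrow> g = id"
proof
  fix k assume g: "g \<in> R" "g \<in> L"
  show "g k = id k"
  proof (cases "k < n")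
    case True
    then have "g k < n" using permutes_in_image[OF fib_grpD(1)[OF g(1)], of k] by simp
    then show ?thesis using joint_inj[of "g k" k] True g by (simp add: fib_grpD(2))
  qed (use permutes_not_in[OF fib_grpD(1)[OF g(1)]] in simp)
qed

lemma in_alg [simp]: "row_sum \<in> grp_alg n" "col_sum \<in> grp_alg n" "yc \<in> grp_alg n"
  by (auto simp: grp_alg_def row_sum_apply col_sum_apply yc_def ga_mult_def)

lemma yc_apply: "g \<in> sym_grp n \<Longrightarrow> yc g = (\<Sum>p\<in>R. col_sum (inv p \<circ> g))"
proof -
  assume g: "g \<in> sym_grp n"
  have "yc g = (\<Sum>p\<in>sym_grp n. if p \<in> R then col_sum (inv p \<circ> g) else 0)"
    using g by (auto simp: yc_def ga_mult_def row_sum_apply intro!: sum.cong)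
  also have "\<dots> = (\<Sum>p\<in>R. col_sum (inv p \<circ> g))"
    by (rule sum.mono_neutral_cong_right) auto
  finally show ?thesis .
qed

lemma yc_sum: "(\<Sum>\<pi>\<in>sym_grp n. yc \<pi> * h \<pi>) = young_sum n row col h"
proof -
  have "(\<Sum>\<pi>\<in>sym_grp n. yc \<pi> * h \<pi>) = (\<Sum>\<pi>\<in>sym_grp n. \<Sum>p\<in>R. col_sum (inv p \<circ> \<pi>) * h \<pi>)"
    by (simp add: yc_apply sum_distrib_right)
  also have "\<dots> = (\<Sum>p\<in>R. \<Sum>\<pi>\<in>sym_grp n. col_sum (inv p \<circ> \<pi>) * h \<pi>)" by (rule sum.swap)
  also have "\<dots> = (\<Sum>p\<in>R. \<Sum>\<pi>\<in>sym_grp n. col_sum (inv p \<circ> (p \<circ> \<pi>)) * h (p \<circ> \<pi>))"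
    by (intro sum.cong refl sum_sym_grp_left[symmetric]) simp
  also have "\<dots> = (\<Sum>p\<in>R. \<Sum>q\<in>L. of_int (sign q) * h (p \<circ> q))"
  proof (rule sum.cong[OF refl])
    fix p assume p: "p \<in> R"
    show "(\<Sum>\<pi>\<in>sym_grp n. col_sum (inv p \<circ> (p \<circ> \<pi>)) * h (p \<circ> \<pi>)) = (\<Sum>q\<in>L. of_int (sign q) * h (p \<circ> q))"
      by (rule sum.mono_neutral_cong_right) (auto simp: sym_grp_inverse(5)[OF R_sub[OF p]] col_sum_apply)
  qed
  finally show ?thesis by (simp only: young_sum_def)
qed

lemma yc_left: assumes p: "p \<in> R" and g: "g \<in> sym_grp n" shows "yc (p \<circ> g) = yc g"
proof -
  have "yc (p \<circ> g) = (\<Sum>r\<in>R. col_sum (inv r \<circ> (p \<circ> g)))" using p g by (simp add: yc_apply)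
  also have "\<dots> = (\<Sum>r\<in>R. col_sum (inv r \<circ> g))"
  proof (rule sum.reindex_bij_witness[where i = "\<lambda>r. p \<circ> r" and j = "\<lambda>r. inv p \<circ> r"])
    fix r assume r: "r \<in> R"
    then show "col_sum (inv (inv p \<circ> r) \<circ> g) = col_sum (inv r \<circ> (p \<circ> g))"
      using R_sub[OF p] R_sub[OF r] by (simp add: sym_grp_inv_comp[of "inv p" n r] o_assoc)
  qed (use p in \<open>auto simp: comp_fib_grp fib_grp_inv sym_grp_inverse(4,5)[OF R_sub[OF p]]\<close>)
  also have "\<dots> = yc g" using g by (simp add: yc_apply)
  finally show ?thesis .
qed

lemma yc_right: assumes q: "q \<in> L" and g: "g \<in> sym_grp n" shows "yc (g \<circ> q) = of_int (sign q) * yc g"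
proof -
  have "col_sum (inv r \<circ> (g \<circ> q)) = of_int (sign q) * col_sum (inv r \<circ> g)" if "r \<in> R" for r
    unfolding o_assoc using that q g sign_sym[of "inv r \<circ> g" q] by (simp add: col_sum_apply comp_fib_grp)
  then show ?thesis using q g by (simp add: yc_apply sum_distrib_left)
qed

lemma yc_id: "yc id = 1"
proof -
  have "yc id = (\<Sum>p\<in>R. if p = id then 1 else 0)"
    unfolding yc_apply[OF sym_grp_simps(1)] by (intro sum.cong refl) (auto simp: col_sum_apply dest: R_L_id)
  also have "\<dots> = 1" by simp
  finally show ?thesis .
qed

text \<open>
  The two conditions determine \<open>y\<close> on the products \<open>p q\<close>. At any other \<open>g\<close>, a row transposition on the left is a column
  transposition on the right, so \<open>y g = - y g\<close>.
\<close>

lemma yc_unique: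
  assumes y: "y \<in> grp_alg n" and left: "\<And>p g. p \<in> R \<Longrightarrow> g \<in> sym_grp n \<Longrightarrow> y (p \<circ> g) = y g"
    and right: "\<And>q g. q \<in> L \<Longrightarrow> g \<in> sym_grp n \<Longrightarrow> y (g \<circ> q) = of_int (sign q) * y g"
  shows "y = fun_scale (y id) yc"
proof
  fix g
  show "y g = fun_scale (y id) yc g"
  proof (cases "g \<in> sym_grp n")
    case True
    from dichotomy[OF this] consider (prod) p q where "p \<in> R" "q \<in> L" "g = p \<circ> q"
      | (swap) u v where "u < n" "v < n" "u \<noteq> v" "row u = row v" "col (inv g u) = col (inv g v)" by blast
    then show ?thesis
    proof cases
      case prod
      have "x g = of_int (sign q) * x id" if l: "\<And>p g. p \<in> R \<Longrightarrow> g \<in> sym_grp n \<Longrightarrow> x (p \<circ> g) = x g"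
        and r: "\<And>q g. q \<in> L \<Longrightarrow> g \<in> sym_grp n \<Longrightarrow> x (g \<circ> q) = of_int (sign q) * x g" for x
        using prod l[of p q] r[of q id] by simp
      from this[of y] this[of yc] show ?thesis
        using left right yc_left yc_right yc_id by (simp add: fun_scale_def)
    next
      case swap
      have inv: "bij g" "bij (inv g)" using True by (auto simp: sym_grp_iff intro: permutes_bij permutes_inv)
      have r: "transpose u v \<in> R" using swap by (intro fib_grp_transpose)
      have ivn: "inv g u < n" "inv g v < n" "inv g u \<noteq> inv g v"
        using permutes_in_image[OF permutes_inv[OF True[unfolded sym_grp_iff]]] swap bij_is_inj[OF inv(2)]
        by (auto simp: inj_eq)
      have q: "transpose (inv g u) (inv g v) \<in> L" using swap ivn by (intro fib_grp_transpose)
      have sgn: "sign (transpose (inv g u) (inv g v)) = -1" using ivn by (simp add: sign_swap_id)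
      have e: "transpose u v \<circ> g = g \<circ> transpose (inv g u) (inv g v)" by (rule transpose_comp_eq[OF inv(1)])
      have zero: "x g = 0" if l: "\<And>p g. p \<in> R \<Longrightarrow> g \<in> sym_grp n \<Longrightarrow> x (p \<circ> g) = x g"
        and rr: "\<And>q g. q \<in> L \<Longrightarrow> g \<in> sym_grp n \<Longrightarrow> x (g \<circ> q) = of_int (sign q) * x g" for x :: "_ \<Rightarrow> complex"
      proof -
        have "x g = - x g" using l[OF r True] rr[OF q True] unfolding e sgn by simp
        then show ?thesis by simp
      qed
      show ?thesis using zero[of y] zero[of yc] left right yc_left yc_right by (simp add: fun_scale_def)
    qed
  qed (use y in \<open>auto simp: grp_alg_def fun_scale_def yc_def ga_mult_def\<close>)
qed

lemma yc_mult_left: assumes p: "p \<in> R" and g: "g \<in> sym_grp n" shows "(yc \<odot> z) (p \<circ> g) = (yc \<odot> z) g"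
proof -
  have "(yc \<odot> z) (p \<circ> g) = (\<Sum>\<sigma>\<in>sym_grp n. yc (p \<circ> \<sigma>) * z (inv (p \<circ> \<sigma>) \<circ> (p \<circ> g)))"
    using p g sum_sym_grp_left[OF R_sub[OF p], where g = "\<lambda>\<sigma>. yc \<sigma> * z (inv \<sigma> \<circ> (p \<circ> g))"]
    by (simp add: ga_mult_def)
  also have "\<dots> = (\<Sum>\<sigma>\<in>sym_grp n. yc \<sigma> * z (inv \<sigma> \<circ> g))"
  proof (intro sum.cong refl)
    fix \<sigma> assume \<sigma>: "\<sigma> \<in> sym_grp n"
    have "inv (p \<circ> \<sigma>) \<circ> (p \<circ> g) = inv \<sigma> \<circ> g"
      unfolding sym_grp_inv_comp[OF R_sub[OF p] \<sigma>] by (simp only: o_assoc[symmetric] sym_grp_inverse(5)[OF R_sub[OF p]])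
    then show "yc (p \<circ> \<sigma>) * z (inv (p \<circ> \<sigma>) \<circ> (p \<circ> g)) = yc \<sigma> * z (inv \<sigma> \<circ> g)"
      using yc_left[OF p \<sigma>] by (simp only:)
  qed
  finally show ?thesis using g by (simp add: ga_mult_def)
qed

lemma yc_mult_right: assumes q: "q \<in> L" and g: "g \<in> sym_grp n" shows "(z \<odot> yc) (g \<circ> q) = of_int (sign q) * (z \<odot> yc) g"
proof -
  have "yc (inv \<sigma> \<circ> (g \<circ> q)) = of_int (sign q) * yc (inv \<sigma> \<circ> g)" if "\<sigma> \<in> sym_grp n" for \<sigma>
    unfolding o_assoc using that g by (intro yc_right q) simp
  then show ?thesis using q g by (simp add: ga_mult_def sum_distrib_left mult_ac)
qed

lemma sandwich: "yc \<odot> x \<odot> yc = fun_scale ((yc \<odot> x \<odot> yc) id) yc"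
proof (rule yc_unique)
  show "(yc \<odot> x \<odot> yc) (p \<circ> g) = (yc \<odot> x \<odot> yc) g" if "p \<in> R" "g \<in> sym_grp n" for p g
    unfolding ga_mult_assoc using that by (rule yc_mult_left)
qed (simp_all add: yc_mult_right)

text \<open>  For the tableau of a partition this is the product of the hook lengths.\<close>

definition yc_scalar :: complex where "yc_scalar = (yc \<odot> yc) id"

lemma yc_square: "yc \<odot> yc = fun_scale yc_scalar yc"
  unfolding yc_scalar_def by (rule yc_unique) (simp_all add: yc_mult_left yc_mult_right)

lemma star_row_sum: "ga_star n row_sum = row_sum" and star_col_sum: "ga_star n col_sum = col_sum"
  by (auto simp: ga_star_def row_sum_apply col_sum_apply fun_eq_iff sign_inv_sym)

lemma star_yc: "ga_star n yc = col_sum \<odot> row_sum"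
  by (simp add: yc_def ga_star_mult star_row_sum star_col_sum)

lemma yc_real: "cnj (yc g) = yc g"
proof (cases "g \<in> sym_grp n")
  case True
  then show ?thesis by (simp add: yc_apply col_sum_apply) (simp add: if_distrib cong: if_cong)
qed (simp add: yc_def ga_mult_def)

lemma star_yc_apply: "g \<in> sym_grp n \<Longrightarrow> ga_star n yc g = yc (inv g)"
  by (simp add: ga_star_def yc_real)

lemma yc_scalar_real: "cnj yc_scalar = yc_scalar"
  by (simp add: yc_scalar_def ga_mult_def yc_real)

lemma row_sum_square: "row_sum \<odot> row_sum = fun_scale (of_nat (card R)) row_sum"
proof
  fix g
  show "(row_sum \<odot> row_sum) g = fun_scale (of_nat (card R)) row_sum g"
  proof (cases "g \<in> sym_grp n")
    case True
    then have "(row_sum \<odot> row_sum) g = (\<Sum>p\<in>sym_grp n. if p \<in> R then row_sum (inv p \<circ> g) else 0)"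
      by (auto simp: ga_mult_def row_sum_apply intro!: sum.cong)
    also have "\<dots> = (\<Sum>p\<in>R. row_sum (inv p \<circ> g))" by (rule sum.mono_neutral_cong_right) auto
    also have "\<dots> = (\<Sum>p\<in>R. row_sum g)" by (intro sum.cong refl) (simp add: row_sum_apply comp_fib_grp)
    finally show ?thesis by (simp add: fun_scale_def)
  qed (auto simp: ga_mult_def fun_scale_def row_sum_apply)
qed

lemma col_sum_square: "col_sum \<odot> col_sum = fun_scale (of_nat (card L)) col_sum"
proof
  fix g
  show "(col_sum \<odot> col_sum) g = fun_scale (of_nat (card L)) col_sum g"
  proof (cases "g \<in> sym_grp n")
    case True
    then have "(col_sum \<odot> col_sum) g = (\<Sum>p\<in>sym_grp n. if p \<in> L then of_int (sign p) * col_sum (inv p \<circ> g) else 0)"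
      by (auto simp: ga_mult_def col_sum_apply intro!: sum.cong)
    also have "\<dots> = (\<Sum>p\<in>L. of_int (sign p) * col_sum (inv p \<circ> g))" by (rule sum.mono_neutral_cong_right) auto
    also have "\<dots> = (\<Sum>p\<in>L. col_sum g)"
    proof (intro sum.cong refl)
      fix p assume p: "p \<in> L"
      have "sign (inv p \<circ> g) = sign p * sign g" if "g \<in> L" using p that by (simp add: sign_sym sign_inv_sym)
      moreover have "(of_int (sign p) * of_int (sign p) :: complex) = 1" by (simp add: sign_def)
      ultimately show "of_int (sign p) * col_sum (inv p \<circ> g) = col_sum g"
        using p by (simp add: col_sum_apply comp_fib_grp fib_grp_inv mult.assoc[symmetric])
    qed
    finally show ?thesis by (simp add: fun_scale_def)
  qed (auto simp: ga_mult_def fun_scale_def col_sum_apply)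
qed

text \<open>  If \<open>c c = 0\<close> for \<open>c = a b\<close>, then \<open>b a b\<close> is self-adjoint with square zero, hence zero; but \<open>b a b\<close> is a positive multiple
  of \<open>c\<^sup>* c\<close>, so \<open>c = 0\<close>.\<close>

lemma yc_scalar_nonzero: "yc_scalar \<noteq> 0"
proof
  assume "yc_scalar = 0"
  then have 0: "yc \<odot> yc = 0" by (simp add: yc_square)
  define w where "w = col_sum \<odot> yc"
  have "ga_star n w = w" by (simp add: w_def ga_star_mult star_yc star_col_sum) (simp add: yc_def ga_mult_assoc)
  moreover have "w \<odot> w = fun_scale (of_nat (card L)) (col_sum \<odot> (yc \<odot> yc))"
  proof -
    have "w \<odot> w = col_sum \<odot> row_sum \<odot> (col_sum \<odot> col_sum) \<odot> yc" by (simp add: w_def yc_def ga_mult_assoc)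
    then show ?thesis unfolding col_sum_square by (simp add: ga_mult_scale yc_def ga_mult_assoc)
  qed
  moreover have "w \<in> grp_alg n" by (simp add: w_def)
  ultimately have "w = 0" using ga_star_positive[of w n] 0 by simp
  have "ga_star n yc \<odot> yc = fun_scale (of_nat (card R)) w"
  proof -
    have "ga_star n yc \<odot> yc = col_sum \<odot> (row_sum \<odot> row_sum) \<odot> col_sum" by (simp only: star_yc) (simp add: yc_def ga_mult_assoc)
    then show ?thesis unfolding row_sum_square by (simp add: ga_mult_scale w_def yc_def ga_mult_assoc)
  qed
  then have "yc = 0" using \<open>w = 0\<close> by (intro ga_star_positive[of yc n]) simp_all
  then show False using yc_id by (simp add: zero_fun_def)
qed

text \<open>  The adjoint \<open>b a\<close> of \<open>a b\<close> is in the two-sided ideal generated by \<open>a b\<close>, because \<open>(b a) (b a)\<close> is a nonzero multiple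
  of \<open>b a\<close>.\<close>

lemma star_yc_factor: "ga_star n yc = fun_scale (1 / yc_scalar) (col_sum \<odot> yc \<odot> row_sum)"
proof -
  have "ga_star n (yc \<odot> yc) = ga_star n (fun_scale yc_scalar yc)" by (simp only: yc_square)
  then have "col_sum \<odot> row_sum \<odot> (col_sum \<odot> row_sum) = fun_scale yc_scalar (ga_star n yc)"
    unfolding ga_star_mult star_yc[symmetric] by (auto simp: ga_star_def fun_scale_def yc_scalar_real)
  then show ?thesis using yc_scalar_nonzero
    by (simp add: yc_def ga_mult_assoc fun_scale_def fun_eq_iff)
qed

lemma single_single: assumes "\<sigma> \<in> sym_grp n" "\<tau> \<in> sym_grp n"
  shows "ga_single \<sigma> \<odot> ga_single \<tau> = ga_single (\<sigma> \<circ> \<tau>)"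
proof
  fix \<pi>
  have "inv \<sigma> \<circ> \<pi> = \<tau> \<longleftrightarrow> \<pi> = \<sigma> \<circ> \<tau>" using sym_grp_inverse(4,5)[OF assms(1)] by metis
  then show "(ga_single \<sigma> \<odot> ga_single \<tau>) \<pi> = ga_single (\<sigma> \<circ> \<tau>) \<pi>"
    using assms by (cases "\<pi> \<in> sym_grp n"; simp add: ga_mult_single_left; auto simp: ga_single_def ga_mult_def)
qed

definition conj_sum :: "((nat \<Rightarrow> nat) \<Rightarrow> complex) \<Rightarrow> (nat \<Rightarrow> nat) \<Rightarrow> complex" where
  "conj_sum x = (\<Sum>\<tau>\<in>sym_grp n. ga_single \<tau> \<odot> (x \<odot> ga_single (inv \<tau>)))"

lemma conj_sum_apply:
  assumes "g \<in> sym_grp n" shows "conj_sum x g = (\<Sum>\<tau>\<in>sym_grp n. x (inv \<tau> \<circ> (g \<circ> \<tau>)))"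
proof -
  have "(ga_single \<tau> \<odot> (x \<odot> ga_single (inv \<tau>))) g = x (inv \<tau> \<circ> (g \<circ> \<tau>))" if "\<tau> \<in> sym_grp n" for \<tau>
    using that assms by (simp add: ga_mult_single_left ga_mult_single_right sym_grp_inverse(3)[OF that] o_assoc)
  then show ?thesis by (simp add: conj_sum_def fun_sum_apply)
qed

lemma conj_sum_in [simp]: "conj_sum x \<in> grp_alg n"
  by (auto simp: conj_sum_def grp_alg_def fun_sum_apply ga_mult_def)

lemma conj_sum_central: assumes "y \<in> grp_alg n" shows "conj_sum x \<odot> y = y \<odot> conj_sum x"
proof -
  have *: "conj_sum x \<odot> ga_single \<sigma> = ga_single \<sigma> \<odot> conj_sum x" if \<sigma>: "\<sigma> \<in> sym_grp n" for \<sigma>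
  proof -
    have "ga_single \<sigma> \<odot> conj_sum x = (\<Sum>\<tau>\<in>sym_grp n. ga_single (\<sigma> \<circ> \<tau>) \<odot> (x \<odot> ga_single (inv \<tau>)))"
      using \<sigma> by (simp add: conj_sum_def ga_mult_sum ga_mult_assoc[symmetric] single_single)
    also have "\<dots> = (\<Sum>\<tau>\<in>sym_grp n. ga_single (\<sigma> \<circ> \<tau>) \<odot> (x \<odot> ga_single (inv (\<sigma> \<circ> \<tau>) \<circ> \<sigma>)))"
    proof (rule sum.cong[OF refl])
      fix \<tau> assume \<tau>: "\<tau> \<in> sym_grp n"
      have "inv (\<sigma> \<circ> \<tau>) \<circ> \<sigma> = inv \<tau>"
        unfolding sym_grp_inv_comp[OF \<sigma> \<tau>] by (simp only: o_assoc[symmetric] sym_grp_inverse(2)[OF \<sigma>] o_id)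
      then show "ga_single (\<sigma> \<circ> \<tau>) \<odot> (x \<odot> ga_single (inv \<tau>))
        = ga_single (\<sigma> \<circ> \<tau>) \<odot> (x \<odot> ga_single (inv (\<sigma> \<circ> \<tau>) \<circ> \<sigma>))" by (simp only:)
    qed
    also have "\<dots> = (\<Sum>\<tau>\<in>sym_grp n. ga_single \<tau> \<odot> (x \<odot> ga_single (inv \<tau> \<circ> \<sigma>)))"
      by (rule sum_sym_grp_left[OF \<sigma>])
    also have "\<dots> = conj_sum x \<odot> ga_single \<sigma>"
      using \<sigma> by (simp add: conj_sum_def ga_mult_sum ga_mult_assoc single_single)
    finally show ?thesis by simp
  qed
  have y: "y = (\<Sum>\<tau>\<in>sym_grp n. fun_scale (y \<tau>) (ga_single \<tau>))" by (rule grp_alg_expand[OF assms])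
  show ?thesis by (subst y, subst (2) y) (simp add: ga_mult_sum ga_mult_scale *)
qed

lemma sandwich_single: assumes \<tau>: "\<tau> \<in> sym_grp n" shows "yc \<odot> (ga_single \<tau> \<odot> yc) = fun_scale (yc_scalar * yc (inv \<tau>)) yc"
proof -
  have "(yc \<odot> (ga_single \<tau> \<odot> yc)) id = (ga_single \<tau> \<odot> (yc \<odot> yc)) id"
    using ga_trace[of n yc "ga_single \<tau> \<odot> yc"] by (simp only: ga_mult_assoc)
  also have "\<dots> = yc_scalar * yc (inv \<tau>)"
    unfolding yc_square ga_mult_scale using ga_mult_single_left[OF \<tau> sym_grp_simps(1), of yc] by (simp add: fun_scale_def)
  finally show ?thesis using sandwich[of "ga_single \<tau>"] by (simp only: ga_mult_assoc)
qed

text \<open>  The central element \<open>z = conj_sum c\<close> satisfies \<open>c z c = N z c\<close>. On the other hand \<open>c z c\<close> is the sum of the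
  \<open>(c \<tau> c) (\<tau>\<^sup>-\<^sup>1 c)\<close>, in which \<open>sandwich_single\<close> applies twice, so that the coefficients of \<open>c c\<close> appear.\<close>

lemma conj_sum_yc: "conj_sum yc \<odot> yc = fun_scale (yc_scalar ^ 2) yc"
proof -
  have "yc \<odot> (conj_sum yc \<odot> yc) = (\<Sum>\<tau>\<in>sym_grp n. (yc \<odot> (ga_single \<tau> \<odot> yc)) \<odot> (ga_single (inv \<tau>) \<odot> yc))"
    by (simp add: conj_sum_def ga_mult_sum ga_mult_assoc)
  also have "\<dots> = (\<Sum>\<tau>\<in>sym_grp n. fun_scale (yc_scalar ^ 2 * (yc (inv \<tau>) * yc \<tau>)) yc)"
  proof (rule sum.cong[OF refl])
    fix \<tau> assume \<tau>: "\<tau> \<in> sym_grp n"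
    show "(yc \<odot> (ga_single \<tau> \<odot> yc)) \<odot> (ga_single (inv \<tau>) \<odot> yc) = fun_scale (yc_scalar ^ 2 * (yc (inv \<tau>) * yc \<tau>)) yc"
      unfolding sandwich_single[OF \<tau>] ga_mult_scale sandwich_single[OF sym_grp_simps(3)[OF \<tau>]] sym_grp_inverse(3)[OF \<tau>] fun_vs.scale_scale
      by (simp add: power2_eq_square mult_ac)
  qed
  also have "\<dots> = fun_scale (yc_scalar ^ 2 * (\<Sum>\<tau>\<in>sym_grp n. yc \<tau> * yc (inv \<tau>))) yc"
    by (rule ext) (simp add: fun_sum_apply fun_scale_def sum_distrib_left sum_distrib_right mult_ac)
  also have "(\<Sum>\<tau>\<in>sym_grp n. yc \<tau> * yc (inv \<tau>)) = yc_scalar" by (simp add: yc_scalar_def ga_mult_def)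
  finally have "fun_scale yc_scalar (conj_sum yc \<odot> yc) = fun_scale yc_scalar (fun_scale (yc_scalar ^ 2) yc)"
    unfolding fun_vs.scale_scale ga_mult_assoc[symmetric] conj_sum_central[OF in_alg(3), symmetric]
    by (simp add: ga_mult_assoc yc_square ga_mult_scale mult.commute)
  then show ?thesis using yc_scalar_nonzero by (simp add: fun_scale_def fun_eq_iff)
qed

text \<open>  The unit of the two-sided ideal generated by the Young symmetrizer.\<close>

definition block_unit :: "(nat \<Rightarrow> nat) \<Rightarrow> complex" where "block_unit = fun_scale (1 / yc_scalar ^ 2) (conj_sum yc)"

lemma block_unit_yc: "block_unit \<odot> yc = yc"
  using yc_scalar_nonzero by (simp add: block_unit_def ga_mult_scale conj_sum_yc fun_vs.scale_scale fun_vs.scale_one)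

lemma block_unit_central: "y \<in> grp_alg n \<Longrightarrow> block_unit \<odot> y = y \<odot> block_unit"
  by (simp add: block_unit_def ga_mult_scale conj_sum_central)

lemma block_unit_idem: "block_unit \<odot> block_unit = block_unit"
proof -
  have "block_unit \<odot> (ga_single \<tau> \<odot> (yc \<odot> ga_single (inv \<tau>))) = ga_single \<tau> \<odot> (yc \<odot> ga_single (inv \<tau>))"
    if \<tau>: "\<tau> \<in> sym_grp n" for \<tau>
  proof -
    have "block_unit \<odot> (ga_single \<tau> \<odot> (yc \<odot> ga_single (inv \<tau>))) = ga_single \<tau> \<odot> ((block_unit \<odot> yc) \<odot> ga_single (inv \<tau>))"
      unfolding ga_mult_assoc[symmetric] block_unit_central[OF ga_single_in[OF \<tau>]] ..
    then show ?thesis by (simp only: block_unit_yc)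
  qed
  then have "block_unit \<odot> conj_sum yc = conj_sum yc" by (simp add: conj_sum_def ga_mult_sum)
  then have "block_unit \<odot> fun_scale (1 / yc_scalar ^ 2) (conj_sum yc) = fun_scale (1 / yc_scalar ^ 2) (conj_sum yc)"
    by (simp only: ga_mult_scale)
  then show ?thesis by (simp only: block_unit_def[symmetric])
qed

lemma card_sym_grp: "card (sym_grp n) = fact n"
  unfolding sym_grp_def by (rule card_permutations) auto

lemma block_unit_id: "block_unit id = fact n / yc_scalar ^ 2"
  by (simp add: block_unit_def fun_scale_def conj_sum_apply yc_id card_sym_grp)

text \<open>The two-sided ideal generated by the Young symmetrizer, as the image of multiplication by its unit.\<close>

definition block :: "((nat \<Rightarrow> nat) \<Rightarrow> complex) set" where "block = {x \<in> grp_alg n. x \<odot> block_unit = x}"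

lemma subspace_grp_alg: "fun_vs.subspace (grp_alg n)"
  by (rule fun_vs.subspaceI) (auto simp: grp_alg_def zero_fun_def plus_fun_def fun_scale_def)

lemma subspace_block: "fun_vs.subspace block"
  using subspace_grp_alg by (auto simp: fun_vs.subspace_def block_def ga_mult_add ga_mult_scale)

text \<open>  The dimension is the trace of the projection \<open>x \<mapsto> x e\<close>, which is \<open>n!\<close> times the coefficient of \<open>e\<close> at the identity.\<close>

lemma dim_block: "of_nat (fun_vs.dim block) = (fact n / yc_scalar) ^ 2"
proof -
  have "of_nat (fun_vs.dim block) = (\<Sum>\<tau>\<in>sym_grp n. (ga_single \<tau> \<odot> block_unit) \<tau>)"
  proof (rule trace_on_projection(2)[where f = "\<lambda>x. x" and e = "\<lambda>\<tau>. ga_single \<tau> \<odot> block_unit"])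
    show "ga_single \<tau> \<odot> block_unit \<in> block" for \<tau> by (simp add: block_def ga_mult_assoc block_unit_idem)
    show "x = (\<Sum>\<tau>\<in>sym_grp n. fun_scale (x \<tau>) (ga_single \<tau> \<odot> block_unit))" if "x \<in> block" for x
    proof -
      have "x = x \<odot> block_unit" "x \<in> grp_alg n" using that by (simp_all add: block_def)
      have "x \<odot> block_unit = (\<Sum>\<tau>\<in>sym_grp n. fun_scale (x \<tau>) (ga_single \<tau>)) \<odot> block_unit"
        using grp_alg_expand[OF \<open>x \<in> grp_alg n\<close>] by simp
      then show ?thesis using \<open>x = x \<odot> block_unit\<close> by (simp add: ga_mult_sum ga_mult_scale)
    qed
    then show "x = (\<Sum>\<tau>\<in>sym_grp n. fun_scale (x \<tau>) (ga_single \<tau> \<odot> block_unit))" if "x \<in> block" for x using that .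
  qed (simp_all add: subspace_block)
  also have "\<dots> = (\<Sum>\<tau>\<in>sym_grp n. block_unit id)"
    by (intro sum.cong refl) (simp add: ga_mult_single_left)
  also have "\<dots> = (fact n / yc_scalar) ^ 2"
    by (simp add: card_sym_grp block_unit_id power2_eq_square)
  finally show ?thesis .
qed

text \<open>  A nonzero \<open>u\<close> in the block generates \<open>c\<close>. Some \<open>v = u \<tau> c\<close> is nonzero, since the unit of the block is a sum of
  conjugates of \<open>c\<close>. Then \<open>v\<^sup>* v \<noteq> 0\<close>, and \<open>v\<^sup>* v\<close> begins with \<open>c\<^sup>*\<close>, in which \<open>star_yc_factor\<close> exhibits a factor \<open>c\<close>. So
  \<open>c x u \<tau> c \<noteq> 0\<close> for some \<open>x\<close>, and this is a multiple of \<open>c\<close> by \<open>sandwich\<close>.\<close>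

lemma block_simple:
  assumes "u \<in> block" "u \<noteq> 0"
  obtains w \<tau> k where "\<tau> \<in> sym_grp n" "k \<noteq> 0" "yc \<odot> (w \<odot> (u \<odot> (ga_single \<tau> \<odot> yc))) = fun_scale k yc"
proof -
  have u: "u = u \<odot> block_unit" using assms by (simp add: block_def)
  have "\<exists>\<tau>\<in>sym_grp n. u \<odot> (ga_single \<tau> \<odot> yc) \<noteq> 0"
  proof (rule ccontr)
    assume "\<not> ?thesis"
    then have "u \<odot> (ga_single \<tau> \<odot> (yc \<odot> ga_single (inv \<tau>))) = 0" if "\<tau> \<in> sym_grp n" for \<tau>
      using that by (metis ga_mult_assoc ga_mult_zero(1))
    then have "u \<odot> conj_sum yc = 0" by (simp add: conj_sum_def ga_mult_sum)
    then have "u = fun_scale (1 / yc_scalar ^ 2) 0" using u by (metis block_unit_def ga_mult_scale(2))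
    then show False using assms(2) by (simp add: fun_scale_def zero_fun_def fun_eq_iff)
  qed
  then obtain \<tau> where \<tau>: "\<tau> \<in> sym_grp n" and ne: "u \<odot> (ga_single \<tau> \<odot> yc) \<noteq> 0" by blast
  define v where "v = u \<odot> (ga_single \<tau> \<odot> yc)"
  define w where "w = row_sum \<odot> ga_star n (u \<odot> ga_single \<tau>)"
  define k where "k = (yc \<odot> (w \<odot> (u \<odot> ga_single \<tau>)) \<odot> yc) id"
  have k: "yc \<odot> (w \<odot> v) = fun_scale k yc"
    using sandwich[of "w \<odot> (u \<odot> ga_single \<tau>)"] by (simp only: k_def v_def ga_mult_assoc)
  have "ga_star n v \<odot> v = ga_star n yc \<odot> (ga_star n (u \<odot> ga_single \<tau>) \<odot> v)"
    by (simp only: v_def ga_star_mult ga_mult_assoc)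
  also have "\<dots> = fun_scale (1 / yc_scalar) (col_sum \<odot> (yc \<odot> (w \<odot> v)))"
    by (simp only: star_yc_factor ga_mult_scale ga_mult_assoc w_def)
  also have "\<dots> = fun_scale (k / yc_scalar) (col_sum \<odot> yc)"
    by (simp add: k ga_mult_scale fun_vs.scale_scale)
  finally have "ga_star n v \<odot> v = fun_scale (k / yc_scalar) (col_sum \<odot> yc)" .
  moreover have "ga_star n v \<odot> v \<noteq> 0" using ga_star_positive[of v n] ne by (auto simp: v_def)
  ultimately have "k \<noteq> 0" by (auto simp: fun_scale_def zero_fun_def)
  then show thesis using that[OF \<tau> _ k[unfolded v_def]] by simp
qed

text \<open>  The map \<open>x \<mapsto> x c / N\<close> is a projection onto the left ideal, so \<open>trace_on_projection\<close> gives the character of the left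
  ideal as a sum of coefficients of conjugates of \<open>c\<close>.\<close>

lemma left_ideal_char:
  assumes \<pi>: "\<pi> \<in> sym_grp n"
  shows "fun_vs.trace_on ((\<lambda>x. x \<odot> yc) ` grp_alg n) (ga_mult n (ga_single \<pi>))
    = conj_sum (ga_star n yc) \<pi> / yc_scalar"
proof -
  let ?V = "(\<lambda>x. x \<odot> yc) ` grp_alg n"
  let ?e = "\<lambda>\<tau>. fun_scale (1 / yc_scalar) (ga_single \<tau> \<odot> yc)"
  have V: "fun_vs.subspace ?V"
  proof (rule fun_vs.subspaceI)
    show "0 \<in> ?V" using fun_vs.subspace_0[OF subspace_grp_alg] by (intro image_eqI[of _ _ 0]) auto
    show "x + y \<in> ?V" if "x \<in> ?V" "y \<in> ?V" for x y
      using that fun_vs.subspace_add[OF subspace_grp_alg] by (auto simp flip: ga_mult_add)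
    show "fun_scale c x \<in> ?V" if "x \<in> ?V" for c x
      using that fun_vs.subspace_scale[OF subspace_grp_alg] by (auto simp flip: ga_mult_scale)
  qed
  have proj: "x = (\<Sum>\<tau>\<in>sym_grp n. fun_scale (x \<tau>) (?e \<tau>))" if x: "x \<in> ?V" for x
  proof -
    obtain y where y: "x = y \<odot> yc" using x by auto
    then have "x \<odot> yc = fun_scale yc_scalar x" by (simp add: ga_mult_assoc yc_square ga_mult_scale)
    then have "x = fun_scale (1 / yc_scalar) (x \<odot> yc)" using yc_scalar_nonzero by (simp add: fun_vs.scale_scale fun_vs.scale_one)
    also have "x \<odot> yc = (\<Sum>\<tau>\<in>sym_grp n. fun_scale (x \<tau>) (ga_single \<tau>)) \<odot> yc"
      using grp_alg_expand[of x n] y by simp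
    also have "fun_scale (1 / yc_scalar) \<dots> = (\<Sum>\<tau>\<in>sym_grp n. fun_scale (x \<tau>) (?e \<tau>))"
      by (simp add: ga_mult_sum ga_mult_scale fun_vs.scale_scale fun_vs.scale_sum_right mult.commute)
    finally show ?thesis .
  qed
  have "fun_vs.trace_on ?V (ga_mult n (ga_single \<pi>)) = (\<Sum>\<tau>\<in>sym_grp n. (ga_single \<pi> \<odot> ?e \<tau>) \<tau>)"
  proof (rule trace_on_projection(1)[where e = ?e, OF _ V])
    show "?e \<tau> \<in> ?V" if "\<tau> \<in> sym_grp n" for \<tau>
      using that by (intro fun_vs.subspace_scale[OF V]) simp
    show "ga_single \<pi> \<odot> x \<in> ?V" if "x \<in> ?V" for x
      using that by (auto simp flip: ga_mult_assoc)
    show "ga_single \<pi> \<odot> x = (\<Sum>\<tau>\<in>sym_grp n. fun_scale (x \<tau>) (ga_single \<pi> \<odot> ?e \<tau>))" if "x \<in> ?V" for x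
      using arg_cong[OF proj[OF that], of "ga_mult n (ga_single \<pi>)"] by (simp only: ga_mult_sum ga_mult_scale)
  qed (simp, rule proj)
  also have "\<dots> = (\<Sum>\<tau>\<in>sym_grp n. ga_star n yc (inv \<tau> \<circ> (\<pi> \<circ> \<tau>)) / yc_scalar)"
  proof (rule sum.cong[OF refl])
    fix \<tau> assume \<tau>: "\<tau> \<in> sym_grp n"
    have "(ga_single \<pi> \<odot> ?e \<tau>) \<tau> = yc (inv \<tau> \<circ> (inv \<pi> \<circ> \<tau>)) / yc_scalar"
      using \<pi> \<tau> by (simp only: ga_mult_scale) (simp add: fun_scale_def ga_mult_single_left)
    also have "inv \<tau> \<circ> (inv \<pi> \<circ> \<tau>) = inv (inv \<tau> \<circ> (\<pi> \<circ> \<tau>))"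
      using \<pi> \<tau> by (simp add: sym_grp_inv_comp[of _ n] o_assoc)
    finally show "(ga_single \<pi> \<odot> ?e \<tau>) \<tau> = ga_star n yc (inv \<tau> \<circ> (\<pi> \<circ> \<tau>)) / yc_scalar"
      using \<pi> \<tau> by (simp add: star_yc_apply)
  qed
  also have "\<dots> = conj_sum (ga_star n yc) \<pi> / yc_scalar"
    using \<pi> by (simp add: conj_sum_apply sum_divide_distrib)
  finally show ?thesis .
qed

end

section \<open>The square tableau\<close>

text \<open>  The words of length \<open>m\<close> in an alphabet of \<open>s\<close> letters are the standard basis of the \<open>m\<close>-th tensor power of \<open>\<complex>\<^sup>s\<close>. Words
  are extended by \<open>0\<close> so that equal words are equal functions.\<close>

definition words :: "nat \<Rightarrow> nat \<Rightarrow> (nat \<Rightarrow> nat) set" where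
  "words s m = {w. (\<forall>i<m. w i < s) \<and> (\<forall>i\<ge>m. w i = 0)}"

definition fix_words :: "nat \<Rightarrow> nat \<Rightarrow> (nat \<Rightarrow> nat) \<Rightarrow> (nat \<Rightarrow> nat) set" where
  "fix_words s m \<pi> = {w \<in> words s m. w \<circ> \<pi> = w}"

lemma fix_words_0: "fix_words s 0 \<pi> = {\<lambda>_. 0}"
  by (auto simp: fix_words_def words_def)

lemma words_Suc: "w \<in> words s (Suc m) \<longleftrightarrow> w 0 < s \<and> (\<lambda>i. w (Suc i)) \<in> words s m"
proof -
  have "(\<forall>i\<ge>Suc m. w i = 0) \<longleftrightarrow> (\<forall>i\<ge>m. w (Suc i) = 0)" by (metis Suc_le_D Suc_le_mono)
  then show ?thesis by (auto simp: words_def All_less_Suc2)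
qed

lemma words_finite: "finite (words s m)"
proof (induction m)
  case (Suc m)
  have "words s (Suc m) \<subseteq> (\<lambda>(a, w). case_nat a w) ` ({..<s} \<times> words s m)"
  proof
    fix w assume "w \<in> words s (Suc m)"
    then have "w = case_nat (w 0) (\<lambda>i. w (Suc i))" "(w 0, \<lambda>i. w (Suc i)) \<in> {..<s} \<times> words s m"
      by (auto simp: words_Suc fun_eq_iff split: nat.splits)
    then show "w \<in> (\<lambda>(a, w). case_nat a w) ` ({..<s} \<times> words s m)" by (metis (no_types, lifting) case_prod_conv image_eqI)
  qed
  then show ?case using Suc by (meson finite_SigmaI finite_imageI finite_lessThan finite_subset)
next
  case 0
  have "words s 0 \<subseteq> {\<lambda>_. 0}" by (auto simp: words_def)
  then show ?case by (rule finite_subset) simp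
qed

lemma fix_words_shiftp: "card (fix_words s (Suc m) (shiftp \<pi>)) = s * card (fix_words s m \<pi>)"
proof -
  have "bij_betw (\<lambda>w. (w 0, \<lambda>i. w (Suc i))) (fix_words s (Suc m) (shiftp \<pi>)) ({..<s} \<times> fix_words s m \<pi>)"
  proof (rule bij_betw_byWitness[where f' = "\<lambda>(a, w). case_nat a w"])
    show "\<forall>w\<in>fix_words s (Suc m) (shiftp \<pi>). (case (w 0, \<lambda>i. w (Suc i)) of (a, w) \<Rightarrow> case_nat a w) = w"
      by (auto simp: fun_eq_iff split: nat.splits)
    show "(\<lambda>w. (w 0, \<lambda>i. w (Suc i))) ` fix_words s (Suc m) (shiftp \<pi>) \<subseteq> {..<s} \<times> fix_words s m \<pi>"
      by (auto simp: fix_words_def words_Suc fun_eq_iff) (metis shiftp_simps(2))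
    show "(\<lambda>(a, w). case_nat a w) ` ({..<s} \<times> fix_words s m \<pi>) \<subseteq> fix_words s (Suc m) (shiftp \<pi>)"
      by (auto simp: fix_words_def words_Suc fun_eq_iff shiftp_def split: nat.splits)
  qed auto
  then show ?thesis by (auto dest: bij_betw_same_card simp: card_cartesian_product)
qed

lemma fix_words_merge:
  assumes \<pi>: "\<pi> permutes {..<m}" and l: "l < m"
  shows "card (fix_words s (Suc m) (shiftp \<pi> \<circ> transpose 0 (Suc l))) = card (fix_words s m \<pi>)"
proof -
  let ?P = "shiftp \<pi> \<circ> transpose 0 (Suc l)"
  have P: "?P 0 = Suc (\<pi> l)" "?P (Suc l) = 0" "\<And>j. j \<noteq> l \<Longrightarrow> ?P (Suc j) = Suc (\<pi> j)"
    by (auto simp: transpose_def)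
  have fixP: "w \<circ> ?P = w \<longleftrightarrow> w 0 = w (Suc (\<pi> l)) \<and> (\<lambda>i. w (Suc i)) \<circ> \<pi> = (\<lambda>i. w (Suc i))" for w :: "nat \<Rightarrow> nat"
  proof
    assume "w \<circ> ?P = w"
    then have e: "w (?P k) = w k" for k by (metis comp_apply)
    have "w (Suc (\<pi> j)) = w (Suc j)" for j using e[of 0] e[of "Suc l"] e[of "Suc j"] P by (cases "j = l") auto
    then show "w 0 = w (Suc (\<pi> l)) \<and> (\<lambda>i. w (Suc i)) \<circ> \<pi> = (\<lambda>i. w (Suc i))" using e[of 0] P by auto
  next
    assume a: "w 0 = w (Suc (\<pi> l)) \<and> (\<lambda>i. w (Suc i)) \<circ> \<pi> = (\<lambda>i. w (Suc i))"
    then have e: "w (Suc (\<pi> j)) = w (Suc j)" for j by (metis comp_apply)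
    have "w (?P k) = w k" for k
    proof (cases k)
      case (Suc j)
      then show ?thesis using P e[of j] a by (cases "j = l") auto
    qed (use P a in simp)
    then show "w \<circ> ?P = w" by (auto simp: fun_eq_iff)
  qed
  have \<pi>l: "\<pi> l < m" using permutes_in_image[OF \<pi>, of l] l by simp
  have "bij_betw (\<lambda>w i. w (Suc i)) (fix_words s (Suc m) ?P) (fix_words s m \<pi>)"
  proof (rule bij_betw_byWitness[where f' = "\<lambda>w. case_nat (w (\<pi> l)) w"])
    show "\<forall>w\<in>fix_words s (Suc m) ?P. case_nat (w (Suc (\<pi> l))) (\<lambda>i. w (Suc i)) = w"
      unfolding fix_words_def fixP by (auto simp: fun_eq_iff split: nat.splits)
    show "(\<lambda>w i. w (Suc i)) ` fix_words s (Suc m) ?P \<subseteq> fix_words s m \<pi>"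
      unfolding fix_words_def fixP by (auto simp: words_Suc)
    show "(\<lambda>w. case_nat (w (\<pi> l)) w) ` fix_words s m \<pi> \<subseteq> fix_words s (Suc m) ?P"
      unfolding fix_words_def fixP using \<pi>l by (auto simp: words_Suc) (auto simp: words_def)
  qed auto
  then show ?thesis by (rule bij_betw_same_card)
qed

lemma words_comp: "w \<in> words s n \<Longrightarrow> \<pi> \<in> sym_grp n \<Longrightarrow> w \<circ> \<pi> \<in> words s n"
proof -
  assume w: "w \<in> words s n" and \<pi>: "\<pi> \<in> sym_grp n"
  have "\<pi> i < n" if "i < n" for i using permutes_in_image[OF \<pi>[unfolded sym_grp_iff], of i] that by simp
  moreover have "\<pi> i = i" if "i \<ge> n" for i using permutes_not_in[OF \<pi>[unfolded sym_grp_iff], of i] that by simp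
  ultimately show ?thesis using w by (auto simp: words_def)
qed

context young_pair
begin

text \<open>  The action of the group algebra on the functions on words, that is, on the tensor power of \<open>\<complex>\<^sup>s\<close>.\<close>

definition wact :: "nat \<Rightarrow> ((nat \<Rightarrow> nat) \<Rightarrow> complex) \<Rightarrow> ((nat \<Rightarrow> nat) \<Rightarrow> complex) \<Rightarrow> (nat \<Rightarrow> nat) \<Rightarrow> complex" where
  "wact s y x = (\<lambda>w. if w \<in> words s n then \<Sum>\<pi>\<in>sym_grp n. y \<pi> * x (w \<circ> \<pi>) else 0)"

lemma wact_mult: "wact s (y \<odot> z) x = wact s y (wact s z x)"
proof
  fix w
  show "wact s (y \<odot> z) x w = wact s y (wact s z x) w"
  proof (cases "w \<in> words s n")
    case True
    have "wact s (y \<odot> z) x w = (\<Sum>\<pi>\<in>sym_grp n. \<Sum>\<sigma>\<in>sym_grp n. y \<sigma> * z (inv \<sigma> \<circ> \<pi>) * x (w \<circ> \<pi>))"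
      using True by (simp add: wact_def ga_mult_def sum_distrib_right)
    also have "\<dots> = (\<Sum>\<sigma>\<in>sym_grp n. \<Sum>\<pi>\<in>sym_grp n. y \<sigma> * z (inv \<sigma> \<circ> \<pi>) * x (w \<circ> \<pi>))"
      by (rule sum.swap)
    also have "\<dots> = (\<Sum>\<sigma>\<in>sym_grp n. \<Sum>\<pi>\<in>sym_grp n. y \<sigma> * z (inv \<sigma> \<circ> (\<sigma> \<circ> \<pi>)) * x (w \<circ> (\<sigma> \<circ> \<pi>)))"
      by (intro sum.cong[OF refl] sum_sym_grp_left[symmetric])
    also have "\<dots> = wact s y (wact s z x) w"
      using True by (simp add: wact_def words_comp sum_distrib_left o_assoc mult.assoc cong: sum.cong)
    finally show ?thesis .
  qed (simp add: wact_def)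
qed

lemma wact_scale: "wact s (fun_scale k y) x = fun_scale k (wact s y x)" "wact s y (fun_scale k x) = fun_scale k (wact s y x)"
  by (auto simp: wact_def fun_scale_def sum_distrib_left mult_ac fun_eq_iff)

lemma wact_add: "wact s y (x + x') = wact s y x + wact s y x'"
  by (auto simp: wact_def fun_eq_iff plus_fun_def sum.distrib algebra_simps)

lemma wact_0: "wact s y 0 = 0"
  by (auto simp: wact_def fun_eq_iff zero_fun_def)

lemma wact_sum: "wact s y (\<Sum>i\<in>I. x i) = (\<Sum>i\<in>I. wact s y (x i))"
  by (induction I rule: infinite_finite_induct)
    (simp_all only: sum.infinite sum.empty sum.insert wact_0 wact_add not_False_eq_True)

text \<open>
  On the functions on words, \<open>c / N\<close> is a projection; \<open>r\<close> is the dimension of its image. The trace of a permutation is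
  the number of words that it fixes.
\<close>

lemma yc_scalar_word_trace:
  obtains r :: nat where
    "yc_scalar * of_nat r = young_sum n row col (\<lambda>\<pi>. of_nat (card (fix_words s n \<pi>)))"
proof -
  define V where "V = {x. (\<forall>w. w \<notin> words s n \<longrightarrow> x w = 0) \<and> wact s yc x = fun_scale yc_scalar x}"
  let ?d = "\<lambda>w u. if u = w then 1 else 0 :: complex"
  let ?e = "\<lambda>w. fun_scale (1 / yc_scalar) (wact s yc (?d w))"
  have V: "fun_vs.subspace V"
    by (rule fun_vs.subspaceI)
      (auto simp: V_def wact_0 wact_add wact_scale fun_vs.scale_right_distrib fun_vs.scale_left_commute, auto simp: zero_fun_def plus_fun_def fun_scale_def)
  have eV: "?e w \<in> V" for w
    by (auto simp: V_def wact_scale wact_mult[symmetric] yc_square fun_vs.scale_scale mult.commute) (auto simp: wact_def fun_scale_def)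
  have proj: "x = (\<Sum>w\<in>words s n. fun_scale (x w) (?e w))" if "x \<in> V" for x
  proof -
    have x: "x = (\<Sum>w\<in>words s n. fun_scale (x w) (?d w))"
      using that by (intro ext) (auto simp: V_def fun_sum_apply fun_scale_def words_finite if_distrib[where f = "\<lambda>c. _ * c"] cong: if_cong)
    have "x = fun_scale (1 / yc_scalar) (wact s yc x)" using that yc_scalar_nonzero by (simp add: V_def fun_vs.scale_scale fun_vs.scale_one)
    also have "wact s yc x = (\<Sum>w\<in>words s n. fun_scale (x w) (wact s yc (?d w)))"
      by (subst x) (simp only: wact_sum wact_scale)
    also have "fun_scale (1 / yc_scalar) \<dots> = (\<Sum>w\<in>words s n. fun_scale (x w) (?e w))"
      by (simp add: fun_vs.scale_sum_right fun_vs.scale_scale mult.commute)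
    finally show ?thesis .
  qed
  have "of_nat (fun_vs.dim V) = (\<Sum>w\<in>words s n. ?e w w)"
    by (rule trace_on_projection(2)[where f = "\<lambda>x. x" and e = ?e, OF words_finite V eV proj _ proj]) auto
  also have "\<dots> = (1 / yc_scalar) * (\<Sum>w\<in>words s n. \<Sum>\<pi>\<in>sym_grp n. yc \<pi> * (if w \<circ> \<pi> = w then 1 else 0))"
    by (simp add: fun_scale_def wact_def sum_divide_distrib)
  also have "\<dots> = (1 / yc_scalar) * (\<Sum>\<pi>\<in>sym_grp n. yc \<pi> * of_nat (card (fix_words s n \<pi>)))"
  proof -
    have "(\<Sum>w\<in>words s n. if w \<circ> \<pi> = w then 1 else 0) = (of_nat (card (fix_words s n \<pi>)) :: complex)" for \<pi>
      unfolding fix_words_def using words_finite by (simp flip: sum.inter_filter)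
    then show ?thesis by (subst sum.swap) (simp flip: sum_distrib_left)
  qed
  finally show thesis using that[of "fun_vs.dim V"] yc_scalar_nonzero by (simp add: yc_sum)
qed

end

definition srow :: "nat \<Rightarrow> nat \<Rightarrow> nat" where "srow s k = k div s"
definition scol :: "nat \<Rightarrow> nat \<Rightarrow> nat" where "scol s k = k mod s"

lemma srow_less: "k < s * s \<Longrightarrow> srow s k < s" by (simp add: srow_def less_mult_imp_div_less)

lemma scol_less: "k < s * s \<Longrightarrow> scol s k < s" by (cases s) (simp_all add: scol_def)

lemma square_inj: "srow s i = srow s j \<Longrightarrow> scol s i = scol s j \<Longrightarrow> i = j"
  unfolding srow_def scol_def by (metis div_mult_mod_eq)

lemma square_box:
  assumes "i < s" "j < s"
  shows "i * s + j < s * s" "srow s (i * s + j) = i" "scol s (i * s + j) = j"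
proof -
  have "i * s + j < (i + 1) * s" using assms by simp
  also have "\<dots> \<le> s * s" using assms by (intro mult_right_mono) auto
  finally show "i * s + j < s * s" .
qed (use assms in \<open>auto simp: srow_def scol_def\<close>)

text \<open>  If no two boxes of a row come from the same column under \<open>g\<close>, then sending each box of a row to the column that it
  comes from permutes the row. This row permutation after \<open>g\<close> is a column permutation.\<close>

lemma square_dichotomy:
  assumes g: "g \<in> sym_grp (s * s)"
  shows "(\<exists>p\<in>fib_grp (s * s) (srow s). \<exists>q\<in>fib_grp (s * s) (scol s). g = p \<circ> q) \<or>
      (\<exists>u v. u < s * s \<and> v < s * s \<and> u \<noteq> v \<and> srow s u = srow s v \<and> scol s (inv g u) = scol s (inv g v))"
proof (rule disjCI)
  assume no: "\<not> (\<exists>u v. u < s * s \<and> v < s * s \<and> u \<noteq> v \<and> srow s u = srow s v \<and> scol s (inv g u) = scol s (inv g v))"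
  let ?n = "s * s"
  have gp: "g permutes {..<?n}" using g by (simp add: sym_grp_iff)
  have invg: "inv g k < ?n" if "k < ?n" for k
    using permutes_in_image[OF permutes_inv[OF gp], of k] that by simp
  define p where "p = (\<lambda>k. if k < ?n then srow s k * s + scol s (inv g k) else k)"
  have p: "p k < ?n" "srow s (p k) = srow s k" "scol s (p k) = scol s (inv g k)" if "k < ?n" for k
    using that square_box[OF srow_less[OF that] scol_less[OF invg[OF that]]] by (simp_all add: p_def)
  have "inj_on p {..<?n}"
  proof (rule inj_onI)
    fix u v assume "u \<in> {..<?n}" "v \<in> {..<?n}" "p u = p v"
    then show "u = v" using no p[of u] p[of v] by (metis lessThan_iff)
  qed
  moreover have "p ` {..<?n} \<subseteq> {..<?n}" using p(1) by auto
  ultimately have "bij_betw p {..<?n} {..<?n}"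
    by (simp add: bij_betw_def endo_inj_surj)
  then have pp: "p permutes {..<?n}" by (rule bij_imp_permutes) (simp add: p_def)
  have psym: "p \<in> sym_grp ?n" using pp by (simp add: sym_grp_iff)
  have "srow s (p k) = srow s k" for k using p(2)[of k] by (cases "k < ?n") (auto simp: p_def)
  then have pR: "p \<in> fib_grp ?n (srow s)" using pp by (simp add: fib_grp_def)
  have "scol s ((p \<circ> g) k) = scol s k" for k
  proof (cases "k < ?n")
    case True
    then have "g k < ?n" using permutes_in_image[OF gp, of k] by simp
    then show ?thesis using p(3)[of "g k"] permutes_inverses(2)[OF gp] by simp
  next
    case False
    then show ?thesis using permutes_not_in[OF gp, of k] by (simp add: p_def)
  qed
  then have qL: "p \<circ> g \<in> fib_grp ?n (scol s)" using permutes_compose[OF gp pp] by (simp add: fib_grp_def)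
  have "g = inv p \<circ> (p \<circ> g)" by (rule sym_grp_inverse(5)[OF psym, symmetric])
  then show "\<exists>p\<in>fib_grp ?n (srow s). \<exists>q\<in>fib_grp ?n (scol s). g = p \<circ> q"
    using fib_grp_inv[OF pR] qL by blast
qed

lemma square_young_pair: "young_pair (s * s) (srow s) (scol s)"
proof
  show "i = j" if "srow s i = srow s j" "scol s i = scol s j" for i j using that by (rule square_inj)
qed (rule square_dichotomy)

lemma square_peelable: "peelable (s * s) (srow s) (scol s)"
  unfolding peelable_def
proof (intro conjI allI impI)
  show "i = j" if "srow s i = srow s j" "scol s i = scol s j" for i j using that by (rule square_inj)
  fix d u v assume a: "d < u" "u < s * s" "d < v" "v < s * s" "srow s u = srow s d" "scol s v = scol s d"
  let ?w = "srow s v * s + scol s u"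
  note w = square_box[OF srow_less[OF a(4)] scol_less[OF a(2)]]
  have "scol s d < scol s u" using a(1,5) unfolding srow_def scol_def
    by (metis add_less_cancel_left div_mult_mod_eq)
  moreover have "v = srow s v * s + scol s d" using a(6) unfolding srow_def scol_def by (metis div_mult_mod_eq)
  ultimately have "d < ?w" using a(3) by linarith
  then show "\<exists>w>d. w < s * s \<and> srow s w = srow s v \<and> scol s w = scol s u" using w by blast
qed

lemma square_hook_cards:
  assumes "d < s * s"
  shows "card {u. d < u \<and> u < s * s \<and> srow s u = srow s d} < s"
    and "card {v. d < v \<and> v < s * s \<and> scol s v = scol s d} < s"
proof -
  have "card {u. d < u \<and> u < s * s \<and> srow s u = srow s d} \<le> card ({..<s} - {scol s d})"
  proof (rule card_inj_on_le)
    show "inj_on (scol s) {u. d < u \<and> u < s * s \<and> srow s u = srow s d}"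
      by (rule inj_onI, rule square_inj) auto
  qed (auto simp: scol_less dest: square_inj)
  also have "\<dots> < s" using scol_less[OF assms] by simp
  finally show "card {u. d < u \<and> u < s * s \<and> srow s u = srow s d} < s" .
  have "card {v. d < v \<and> v < s * s \<and> scol s v = scol s d} \<le> card ({..<s} - {srow s d})"
  proof (rule card_inj_on_le)
    show "inj_on (srow s) {u. d < u \<and> u < s * s \<and> scol s u = scol s d}"
      by (rule inj_onI, rule square_inj) auto
  qed (auto simp: srow_less dest: square_inj)
  also have "\<dots> < s" using srow_less[OF assms] by simp
  finally show "card {v. d < v \<and> v < s * s \<and> scol s v = scol s d} < s" .
qed

text \<open>  The numbers \<open>a d\<close> and \<open>b d\<close> are less than \<open>s\<close> because the boxes after \<open>d\<close> in its row or column do not include \<open>d\<close>.\<close>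

lemma square_content:
  obtains a b :: "nat \<Rightarrow> nat" where "\<And>d. d < s * s \<Longrightarrow> a d < s" "\<And>d. d < s * s \<Longrightarrow> b d < s"
    and "\<And>\<tau> \<psi> t. \<lbrakk>cycle_trace \<tau> \<psi>; \<And>k. k \<ge> 1 \<Longrightarrow> \<tau> k = t\<rbrakk>
      \<Longrightarrow> young_sum (s * s) (srow s) (scol s) (\<psi> (s * s) (\<lambda>_. 1)) = (\<Prod>d<s * s. t + of_nat (a d) - of_nat (b d))"
proof (rule that)
  let ?a = "\<lambda>d. card {u. d < u \<and> u < s * s \<and> srow s u = srow s d}"
  let ?b = "\<lambda>d. card {v. d < v \<and> v < s * s \<and> scol s v = scol s d}"
  show "?a d < s" "?b d < s" if "d < s * s" for d using square_hook_cards[OF that] .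
  show "young_sum (s * s) (srow s) (scol s) (\<psi> (s * s) (\<lambda>_. 1)) = (\<Prod>d<s * s. t + of_nat (?a d) - of_nat (?b d))"
    if "cycle_trace \<tau> \<psi>" "\<And>k. k \<ge> 1 \<Longrightarrow> \<tau> k = t" for \<tau> \<psi> t
    using that by (intro content_formula square_peelable)
qed

text \<open>  At \<open>t = s\<close> every factor of the content formula is between \<open>1\<close> and \<open>2 s\<close>. So the trace \<open>r\<close> of \<open>yc_scalar_word_trace\<close> is a positive
  integer, and the scalar is at most the product.\<close>

lemma square_yc_scalar_bound:
  obtains x where "young_pair.yc_scalar (s * s) (srow s) (scol s) = of_real x" "0 < x" "x \<le> (2 * real s) ^ (s * s)"
proof -
  interpret young_pair "s * s" "srow s" "scol s" by (rule square_young_pair)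
  obtain a b where ab: "\<And>d. d < s * s \<Longrightarrow> a d < s" "\<And>d. d < s * s \<Longrightarrow> b d < s"
    and content: "\<And>\<tau> \<psi> t. \<lbrakk>cycle_trace \<tau> \<psi>; \<And>k. k \<ge> 1 \<Longrightarrow> \<tau> k = t\<rbrakk>
      \<Longrightarrow> young_sum (s * s) (srow s) (scol s) (\<psi> (s * s) (\<lambda>_. 1)) = (\<Prod>d<s * s. t + of_nat (a d) - of_nat (b d))"
    using square_content[of s] by blast
  let ?f = "\<lambda>m \<pi>. of_nat (card (fix_words s m \<pi>)) :: complex"
  obtain r :: nat where r: "yc_scalar * of_nat r = young_sum (s * s) (srow s) (scol s) (?f (s * s))"
    by (rule yc_scalar_word_trace)
  define X where "X = (\<Prod>d<s * s. real s + real (a d) - real (b d))"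
  have "cycle_trace (\<lambda>_. of_nat s) (\<lambda>m _. ?f m)"
    by (simp add: cycle_trace_def fix_words_0 fix_words_shiftp fix_words_merge)
  from content[OF this] have "yc_scalar * of_nat r = (\<Prod>d<s * s. of_nat s + of_nat (a d) - of_nat (b d))"
    unfolding r by simp
  also have "\<dots> = of_real X" by (simp add: X_def)
  finally have X: "yc_scalar * of_nat r = of_real X" .
  have "X \<ge> (\<Prod>d<s * s. 1)" unfolding X_def
  proof (intro prod_mono conjI)
    show "1 \<le> real s + real (a d) - real (b d)" if "d \<in> {..<s * s}" for d
      using ab(2)[of d] that by simp
  qed auto
  then have X1: "X \<ge> 1" by simp
  have X2: "X \<le> (\<Prod>d<s * s. 2 * real s)" unfolding X_def
  proof (intro prod_mono conjI)
    fix d assume "d \<in> {..<s * s}"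
    then show "0 \<le> real s + real (a d) - real (b d)" "real s + real (a d) - real (b d) \<le> 2 * real s"
      using ab[of d] by simp_all
  qed
  have "r \<noteq> 0" using X X1 by (intro notI) simp
  then have "yc_scalar = of_real (X / real r)" using X by (simp add: field_simps)
  moreover have "X / real r \<le> X" using X1 \<open>r \<noteq> 0\<close> by (simp add: field_simps)
  ultimately show thesis using X1 X2 \<open>r \<noteq> 0\<close> by (intro that[of "X / real r"]) auto
qed

section \<open>Coherence in symmetric monoidal categories\<close>

text \<open>  A morphism together with its source and target. All laws of the category become equations between arrows whose
  side conditions contain no variables that the equation does not determine, so that they can be used as
  conditional rewrite rules.\<close>

datatype ('o, 'm) arrow = Arrow (src: 'o) (mor: 'm) (tgt: 'o)

context linear_symmetric_category
begin

lemma in_Hom_scale: "x \<in> Hom a b \<Longrightarrow> k \<star> x \<in> Hom a b"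
  using subspace_Hom subspace_scale by blast

lemma in_Hom_add: "x \<in> Hom a b \<Longrightarrow> y \<in> Hom a b \<Longrightarrow> x + y \<in> Hom a b"
  using subspace_Hom subspace_add by blast

lemma in_Hom_sum: "(\<And>i. i \<in> I \<Longrightarrow> x i \<in> Hom a b) \<Longrightarrow> (\<Sum>i\<in>I. x i) \<in> Hom a b"
  using subspace_Hom subspace_sum by blast

definition ok :: "('o, 'm) arrow \<Rightarrow> bool" where
  "ok F \<longleftrightarrow> mor F \<in> Hom (src F) (tgt F)"

text \<open>As in the category, \<open>F ** G\<close> is "first \<open>G\<close>, then \<open>F\<close>".\<close>

definition arrow_comp :: "('o, 'm) arrow \<Rightarrow> ('o, 'm) arrow \<Rightarrow> ('o, 'm) arrow" (infixr "**" 55) where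
  "F ** G = Arrow (src G) (mor F \<cdot> mor G) (tgt F)"

definition arrow_tens :: "('o, 'm) arrow \<Rightarrow> ('o, 'm) arrow \<Rightarrow> ('o, 'm) arrow" (infixr "<*>" 70) where
  "F <*> G = Arrow (src F \<otimes> src G) (mor F \<boxtimes> mor G) (tgt F \<otimes> tgt G)"

text \<open>  Identities, associators, unitors and braidings as arrows; a prime marks an inverse.\<close>

definition aI where "aI a = Arrow a (Id a) a"
definition aA where "aA a b c = Arrow ((a \<otimes> b) \<otimes> c) (\<alpha> a b c) (a \<otimes> (b \<otimes> c))"
definition aA' where "aA' a b c = Arrow (a \<otimes> (b \<otimes> c)) (assoc_inv C a b c) ((a \<otimes> b) \<otimes> c)"
definition aL where "aL a = Arrow (\<one> \<otimes> a) (\<l> a) a"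
definition lunit_inv where "lunit_inv a = (SOME g. inverses C (\<one> \<otimes> a) a (\<l> a) g)"
definition aL' where "aL' a = Arrow a (lunit_inv a) (\<one> \<otimes> a)"
definition aR where "aR a = Arrow (a \<otimes> \<one>) (\<r> a) a"
definition aC where "aC a b = Arrow (a \<otimes> b) (\<c> a b) (b \<otimes> a)"

lemma inverses_unique: "inverses C a b f g \<Longrightarrow> inverses C a b f h \<Longrightarrow> g = h"
proof -
  assume g: "inverses C a b f g" and h: "inverses C a b f h"
  have "g = g \<cdot> (f \<cdot> h)" using g h by (simp add: inverses_def comp_Id_right[of g b a])
  also have "\<dots> = (g \<cdot> f) \<cdot> h" using g h comp_assoc[of h b a f b g a] by (simp add: inverses_def)
  also have "\<dots> = h" using g h by (simp add: inverses_def comp_Id_left[of h b a])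
  finally show "g = h" .
qed

lemma assoc_inv: "inverses C ((a \<otimes> b) \<otimes> c) (a \<otimes> (b \<otimes> c)) (\<alpha> a b c) (assoc_inv C a b c)"
  unfolding assoc_inv_def using assoc_iso[unfolded iso_mor_def, of a b c]
  by (metis inverses_unique theI)

lemma lunit_inv: "inverses C (\<one> \<otimes> a) a (\<l> a) (lunit_inv a)"
  unfolding lunit_inv_def using lunit_iso[unfolded iso_mor_def, of a] by (metis someI)

lemmas src_tgt_defs = arrow_comp_def arrow_tens_def aI_def aA_def aA'_def aL_def aL'_def aR_def aC_def

lemma src_simps [simp]:
  "src (F ** G) = src G" "src (F <*> G) = src F \<otimes> src G" "src (aI a) = a"
  "src (aA a b c) = (a \<otimes> b) \<otimes> c" "src (aA' a b c) = a \<otimes> (b \<otimes> c)"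
  "src (aL a) = \<one> \<otimes> a" "src (aL' a) = a" "src (aR a) = a \<otimes> \<one>" "src (aC a b) = a \<otimes> b"
  by (simp_all add: src_tgt_defs)

lemma tgt_simps [simp]:
  "tgt (F ** G) = tgt F" "tgt (F <*> G) = tgt F \<otimes> tgt G" "tgt (aI a) = a"
  "tgt (aA' a b c) = (a \<otimes> b) \<otimes> c" "tgt (aA a b c) = a \<otimes> (b \<otimes> c)"
  "tgt (aL' a) = \<one> \<otimes> a" "tgt (aL a) = a" "tgt (aR a) = a" "tgt (aC a b) = b \<otimes> a"
  by (simp_all add: src_tgt_defs)

lemma ok_simps [simp]:
  "\<lbrakk>ok F; ok G; src F = tgt G\<rbrakk> \<Longrightarrow> ok (F ** G)" "\<lbrakk>ok F; ok G\<rbrakk> \<Longrightarrow> ok (F <*> G)"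
  "ok (aI a)" "ok (aA a b c)" "ok (aA' a b c)" "ok (aL a)" "ok (aL' a)" "ok (aR a)" "ok (aC a b)"
  using assoc_inv lunit_inv runit_iso
  by (auto simp: ok_def src_tgt_defs inverses_def iso_mor_def
      intro: comp_in_Hom tens_in_Hom Id_in_Hom braid_in_Hom)

lemma arrow_comp_assoc [simp]:
  "\<lbrakk>ok F; ok G; ok H; src F = tgt G; src G = tgt H\<rbrakk> \<Longrightarrow> (F ** G) ** H = F ** G ** H"
  by (auto simp: ok_def arrow_comp_def intro: comp_assoc)

lemma arrow_comp_id [simp]: "\<lbrakk>ok F; src F = a\<rbrakk> \<Longrightarrow> F ** aI a = F" "\<lbrakk>ok F; tgt F = a\<rbrakk> \<Longrightarrow> aI a ** F = F"
  by (cases F; auto simp: ok_def arrow_comp_def aI_def comp_Id_right comp_Id_left)+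

lemma arrow_tens_id [simp]: "aI a <*> aI b = aI (a \<otimes> b)"
  by (simp add: arrow_tens_def aI_def tens_Id)

lemma interchange: "\<lbrakk>ok F; ok F'; ok G; ok G'; src F = tgt F'; src G = tgt G'\<rbrakk>
    \<Longrightarrow> (F ** F') <*> (G ** G') = (F <*> G) ** (F' <*> G')"
  by (auto simp: ok_def arrow_comp_def arrow_tens_def intro: tens_comp)

lemma interchange_left: "\<lbrakk>ok F; ok F'; src F = tgt F'\<rbrakk> \<Longrightarrow> (F ** F') <*> aI a = (F <*> aI a) ** (F' <*> aI a)"
  using interchange[of F F' "aI a" "aI a"] by simp

lemma interchange_right: "\<lbrakk>ok F; ok F'; src F = tgt F'\<rbrakk> \<Longrightarrow> aI a <*> (F ** F') = (aI a <*> F) ** (aI a <*> F')"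
  using interchange[of "aI a" "aI a" F F'] by simp

lemma A_inverse [simp]: "aA a b c ** aA' a b c = aI (a \<otimes> b \<otimes> c)" "aA' a b c ** aA a b c = aI ((a \<otimes> b) \<otimes> c)"
  using assoc_inv[of a b c] by (simp_all add: inverses_def src_tgt_defs)

lemma L_inverse [simp]: "aL a ** aL' a = aI a" "aL' a ** aL a = aI (\<one> \<otimes> a)"
  using lunit_inv[of a] by (simp_all add: inverses_def src_tgt_defs)

lemma C_inverse [simp]: "aC b a ** aC a b = aI (a \<otimes> b)"
  using braid_symmetric[of b a] by (simp_all add: src_tgt_defs)

lemma cancel [simp]:
  "\<lbrakk>ok F; tgt F = a \<otimes> b \<otimes> c\<rbrakk> \<Longrightarrow> aA a b c ** aA' a b c ** F = F"
  "\<lbrakk>ok F; tgt F = (a \<otimes> b) \<otimes> c\<rbrakk> \<Longrightarrow> aA' a b c ** aA a b c ** F = F"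
  "\<lbrakk>ok F; tgt F = a\<rbrakk> \<Longrightarrow> aL a ** aL' a ** F = F"
  "\<lbrakk>ok F; tgt F = \<one> \<otimes> a\<rbrakk> \<Longrightarrow> aL' a ** aL a ** F = F"
  "\<lbrakk>ok F; tgt F = a \<otimes> b\<rbrakk> \<Longrightarrow> aC b a ** aC a b ** F = F"
  by (simp_all flip: arrow_comp_assoc)

lemma A_nat: "\<lbrakk>ok F; ok G; ok H\<rbrakk> \<Longrightarrow>
    aA (tgt F) (tgt G) (tgt H) ** ((F <*> G) <*> H) = (F <*> G <*> H) ** aA (src F) (src G) (src H)"
  by (auto simp: ok_def src_tgt_defs intro: assoc_natural)

lemma L_nat: "ok F \<Longrightarrow> aL (tgt F) ** (aI \<one> <*> F) = F ** aL (src F)"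
  by (auto simp: ok_def src_tgt_defs intro: lunit_natural)

lemma R_nat: "ok F \<Longrightarrow> aR (tgt F) ** (F <*> aI \<one>) = F ** aR (src F)"
  by (auto simp: ok_def src_tgt_defs intro: runit_natural)

lemma C_nat: "\<lbrakk>ok F; ok G\<rbrakk> \<Longrightarrow> aC (tgt F) (tgt G) ** (F <*> G) = (G <*> F) ** aC (src F) (src G)"
  by (auto simp: ok_def src_tgt_defs intro: braid_natural)

lemma pentagon_arrow: "aA a b (c \<otimes> d) ** aA (a \<otimes> b) c d
    = (aI a <*> aA b c d) ** aA a (b \<otimes> c) d ** (aA a b c <*> aI d)"
proof -
  have "aA a b (c \<otimes> d) ** aA (a \<otimes> b) c d
      = ((aI a <*> aA b c d) ** aA a (b \<otimes> c) d) ** (aA a b c <*> aI d)"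
    unfolding src_tgt_defs using pentagon[of a b c d] by simp
  then show ?thesis by simp
qed

lemma triangle_arrow: "(aI a <*> aL b) ** aA a \<one> b = aR a <*> aI b"
  using triangle[of a b] by (simp add: src_tgt_defs)

lemma hexagon_arrow: "aA b c a ** aC a (b \<otimes> c) ** aA a b c
    = (aI b <*> aC a c) ** aA b a c ** (aC a b <*> aI c)"
proof -
  have "(aA b c a ** aC a (b \<otimes> c)) ** aA a b c
      = ((aI b <*> aC a c) ** aA b a c) ** (aC a b <*> aI c)"
    unfolding src_tgt_defs using hexagon[of b c a] by simp
  then show ?thesis by simp
qed

text \<open>Each equation \<open>X ** Y = Z\<close> is also needed in the form \<open>X ** Y ** F = Z ** F\<close>.\<close>

lemma reassoc: "\<lbrakk>X ** Y = Z; ok X; ok Y; src X = tgt Y; ok F; tgt F = src Y\<rbrakk> \<Longrightarrow> X ** Y ** F = Z ** F"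
  by (metis arrow_comp_assoc)

lemma cancel_left: "\<lbrakk>X ** F = X ** G; Y ** X = aI (src X); ok X; ok Y; src Y = tgt X; ok F; ok G;
    tgt F = src X; tgt G = src X\<rbrakk> \<Longrightarrow> F = G"
  by (metis arrow_comp_assoc arrow_comp_id(2))

lemma cancel_right: "\<lbrakk>F ** X = G ** X; X ** Y = aI (tgt X); ok X; ok Y; tgt Y = src X; ok F; ok G;
    src F = tgt X; src G = tgt X\<rbrakk> \<Longrightarrow> F = G"
  by (metis arrow_comp_assoc arrow_comp_id(1))

text \<open>  Tensoring with the unit object is isomorphic to the identity functor.\<close>

lemma unit_tensor_faithful:
  assumes "aI \<one> <*> F = aI \<one> <*> G" "ok F" "ok G" "src F = src G" "tgt F = tgt G" shows "F = G"
proof -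
  have "F ** aL (src F) = G ** aL (src F)" using L_nat[OF assms(2)] L_nat[OF assms(3)] unfolding assms(1,4,5) by (rule trans[OF sym])
  then show ?thesis by (rule cancel_right[where Y = "aL' (src F)"]) (use assms in auto)
qed

lemma tensor_unit_faithful:
  assumes "F <*> aI \<one> = G <*> aI \<one>" "ok F" "ok G" "src F = src G" "tgt F = tgt G" shows "F = G"
proof -
  obtain r where r: "inverses C (src F \<otimes> \<one>) (src F) (\<r> (src F)) r"
    using runit_iso[of "src F"] by (auto simp: iso_mor_def)
  let ?r = "Arrow (src F) r (src F \<otimes> \<one>)"
  have "F ** aR (src F) = G ** aR (src F)" using R_nat[OF assms(2)] R_nat[OF assms(3)] unfolding assms(1,4,5) by (rule trans[OF sym])
  then show ?thesis by (rule cancel_right[where Y = ?r])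
    (use assms r in \<open>auto simp: inverses_def ok_def src_tgt_defs\<close>)
qed

text \<open>  By faithfulness of \<open>\<one> \<otimes> _\<close> it suffices to compare the two sides tensored with \<open>\<one>\<close> on the left. There the pentagon for
  \<open>\<one>, \<one>, a, b\<close> and two triangles apply, up to composition with an isomorphism.\<close>

lemma lunit_tensor: "aL (a \<otimes> b) ** aA \<one> a b = aL a <*> aI b"
proof -
  let ?X = "aA \<one> (\<one> \<otimes> a) b ** (aA \<one> \<one> a <*> aI b)"
  let ?Y = "(aA' \<one> \<one> a <*> aI b) ** aA' \<one> (\<one> \<otimes> a) b"
  have inv: "?X ** ?Y = aI (tgt ?X)"
    by (simp add: reassoc[OF interchange_left[symmetric]])
  have "((aI \<one> <*> aL (a \<otimes> b)) ** (aI \<one> <*> aA \<one> a b)) ** ?X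
      = (aI \<one> <*> aL (a \<otimes> b)) ** aA \<one> \<one> (a \<otimes> b) ** aA (\<one> \<otimes> \<one>) a b"
    by (simp add: pentagon_arrow)
  also have "\<dots> = (aR \<one> <*> aI (a \<otimes> b)) ** aA (\<one> \<otimes> \<one>) a b"
    by (simp add: reassoc[OF triangle_arrow])
  also have "\<dots> = aA \<one> a b ** ((aR \<one> <*> aI a) <*> aI b)"
    using A_nat[of "aR \<one>" "aI a" "aI b"] by simp
  also have "\<dots> = aA \<one> a b ** ((aI \<one> <*> aL a) <*> aI b) ** (aA \<one> \<one> a <*> aI b)"
    by (simp add: triangle_arrow[symmetric] interchange_left)
  also have "\<dots> = (aI \<one> <*> (aL a <*> aI b)) ** ?X"
    using reassoc[OF A_nat[of "aI \<one>" "aL a" "aI b"], of "aA \<one> \<one> a <*> aI b"] by simp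
  finally have "(aI \<one> <*> aL (a \<otimes> b)) ** (aI \<one> <*> aA \<one> a b) = aI \<one> <*> (aL a <*> aI b)"
    by (rule cancel_right[OF _ inv]) simp_all
  then have "aI \<one> <*> (aL (a \<otimes> b) ** aA \<one> a b) = aI \<one> <*> (aL a <*> aI b)" by (simp add: interchange_right)
  then show ?thesis by (rule unit_tensor_faithful) simp_all
qed

text \<open>  The hexagon for \<open>a, \<one>, \<one>\<close> gives the equation tensored with \<open>\<one>\<close> on the right and composed with a braiding.\<close>

lemma lunit_braid: "aL a ** aC a \<one> = aR a"
proof -
  have "aC a \<one> ** ((aL a ** aC a \<one>) <*> aI \<one>) = aC a \<one> ** (aL a <*> aI \<one>) ** (aC a \<one> <*> aI \<one>)"
    by (simp add: interchange_left)
  also have "\<dots> = aC a \<one> ** aL (a \<otimes> \<one>) ** aA \<one> a \<one> ** (aC a \<one> <*> aI \<one>)"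
    by (simp add: lunit_tensor[symmetric])
  also have "\<dots> = aL (\<one> \<otimes> a) ** (aI \<one> <*> aC a \<one>) ** aA \<one> a \<one> ** (aC a \<one> <*> aI \<one>)"
    using reassoc[OF L_nat[of "aC a \<one>"]] by simp
  also have "\<dots> = aL (\<one> \<otimes> a) ** aA \<one> \<one> a ** aC a (\<one> \<otimes> \<one>) ** aA a \<one> \<one>"
    by (simp add: hexagon_arrow)
  also have "\<dots> = (aL \<one> <*> aI a) ** aC a (\<one> \<otimes> \<one>) ** aA a \<one> \<one>"
    by (simp add: reassoc[OF lunit_tensor])
  also have "\<dots> = aC a \<one> ** (aI a <*> aL \<one>) ** aA a \<one> \<one>"
    using reassoc[OF C_nat[of "aI a" "aL \<one>"], of "aA a \<one> \<one>"] by simp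
  also have "\<dots> = aC a \<one> ** (aR a <*> aI \<one>)" by (simp add: triangle_arrow)
  finally have "(aL a ** aC a \<one>) <*> aI \<one> = aR a <*> aI \<one>"
    by (rule cancel_left[where Y = "aC \<one> a"]) simp_all
  then show ?thesis by (rule tensor_unit_faithful) simp_all
qed

text \<open>  The braiding of the first two factors of \<open>a \<otimes> (b \<otimes> v)\<close>. In terms of these maps, no associators occur in the
  relations of the symmetric group.\<close>

definition aS :: "'o \<Rightarrow> 'o \<Rightarrow> 'o \<Rightarrow> ('o, 'm) arrow" where
  "aS a b v = aA b a v ** (aC a b <*> aI v) ** aA' a b v"

lemma aS_simps [simp]: "src (aS a b v) = a \<otimes> b \<otimes> v" "tgt (aS a b v) = b \<otimes> a \<otimes> v" "ok (aS a b v)"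
  by (simp_all add: aS_def)

lemma aS_inverse [simp]: "aS b a v ** aS a b v = aI (a \<otimes> b \<otimes> v)"
  by (simp add: aS_def reassoc[OF interchange_left[symmetric]])

lemma aS_natural:
  assumes "ok F" "ok G" "ok H"
  shows "aS (tgt F) (tgt G) (tgt H) ** (F <*> G <*> H) = (G <*> F <*> H) ** aS (src F) (src G) (src H)"
proof -
  let ?A' = "aA' (src F) (src G) (src H)"
  have "aA' (tgt F) (tgt G) (tgt H) ** (F <*> G <*> H) = ((F <*> G) <*> H) ** ?A'"
    by (rule cancel_left[of "aA (tgt F) (tgt G) (tgt H)" _ _ "aA' (tgt F) (tgt G) (tgt H)"])
      (use assms in \<open>simp_all add: reassoc[OF A_nat]\<close>)
  then have "aS (tgt F) (tgt G) (tgt H) ** (F <*> G <*> H)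
      = aA (tgt G) (tgt F) (tgt H) ** (aC (tgt F) (tgt G) <*> aI (tgt H)) ** ((F <*> G) <*> H) ** ?A'"
    using assms by (simp add: aS_def)
  also have "\<dots> = aA (tgt G) (tgt F) (tgt H) ** (((G <*> F) ** aC (src F) (src G)) <*> H) ** ?A'"
    using assms reassoc[OF interchange[symmetric], of "aC (tgt F) (tgt G)" "F <*> G" "aI (tgt H)" H]
    by (simp add: C_nat)
  also have "\<dots> = aA (tgt G) (tgt F) (tgt H) ** ((G <*> F) <*> H) ** (aC (src F) (src G) <*> aI (src H)) ** ?A'"
    using assms interchange[of "G <*> F" "aC (src F) (src G)" H "aI (src H)"] by simp
  also have "\<dots> = (G <*> F <*> H) ** aS (src F) (src G) (src H)"
    using assms by (simp add: aS_def reassoc[OF A_nat])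
  finally show ?thesis .
qed

lemma pentagon_mixed: "(aI a <*> aA' b c d) ** aA a b (c \<otimes> d) ** aA (a \<otimes> b) c d = aA a (b \<otimes> c) d ** (aA a b c <*> aI d)"
  by (simp add: pentagon_arrow reassoc[OF interchange_right[symmetric]])

lemma pentagon_inverse: "aA (a \<otimes> b) c d ** (aA' a b c <*> aI d) ** aA' a (b \<otimes> c) d = aA' a b (c \<otimes> d) ** (aI a <*> aA b c d)"
proof -
  have "aA a b (c \<otimes> d) ** (aA (a \<otimes> b) c d ** (aA' a b c <*> aI d) ** aA' a (b \<otimes> c) d)
      = (aI a <*> aA b c d) ** aA a (b \<otimes> c) d ** (aA a b c <*> aI d) ** (aA' a b c <*> aI d) ** aA' a (b \<otimes> c) d"
    using reassoc[OF pentagon_arrow[of a b c d], of "(aA' a b c <*> aI d) ** aA' a (b \<otimes> c) d"] by simp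
  also have "\<dots> = aA a b (c \<otimes> d) ** (aA' a b (c \<otimes> d) ** (aI a <*> aA b c d))"
    by (simp add: reassoc[OF interchange_left[symmetric]])
  finally show ?thesis
    by (rule cancel_left[where Y = "aA' a b (c \<otimes> d)"]) simp_all
qed

text \<open>  The hexagon in terms of \<open>aS\<close>: braiding \<open>a\<close> past \<open>b \<otimes> c\<close> is braiding it past \<open>b\<close>, then past \<open>c\<close>. All remaining
  associators are moved by naturality and three pentagons.\<close>

lemma aS_tensor:
  "aA b c (a \<otimes> v) ** aS a (b \<otimes> c) v = (aI b <*> aS a c v) ** aS a b (c \<otimes> v) ** (aI a <*> aA b c v)"
proof -
  have "aA b c (a \<otimes> v) ** aS a (b \<otimes> c) v
      = (aA b c (a \<otimes> v) ** aA (b \<otimes> c) a v) ** (aC a (b \<otimes> c) <*> aI v) ** aA' a (b \<otimes> c) v"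
    by (simp add: aS_def)
  also have "\<dots> = (aI b <*> aA c a v) ** aA b (c \<otimes> a) v ** ((aA b c a ** aC a (b \<otimes> c) ** aA a b c) <*> aI v)
      ** (aA' a b c <*> aI v) ** aA' a (b \<otimes> c) v"
    by (simp add: pentagon_arrow interchange_left) (simp add: reassoc[OF interchange_left[symmetric]])
  also have "\<dots> = (aI b <*> aA c a v) ** (aA b (c \<otimes> a) v ** ((aI b <*> aC a c) <*> aI v)) ** (aA b a c <*> aI v)
      ** ((aC a b <*> aI c) <*> aI v) ** (aA' a b c <*> aI v) ** aA' a (b \<otimes> c) v"
    by (simp add: hexagon_arrow interchange_left)
  also have "\<dots> = (aI b <*> aA c a v) ** (aI b <*> (aC a c <*> aI v)) ** (aA b (a \<otimes> c) v ** (aA b a c <*> aI v))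
      ** ((aC a b <*> aI c) <*> aI v) ** (aA' a b c <*> aI v) ** aA' a (b \<otimes> c) v"
    using A_nat[of "aI b" "aC a c" "aI v"] by simp
  also have "\<dots> = (aI b <*> aA c a v) ** (aI b <*> (aC a c <*> aI v)) ** (aI b <*> aA' a c v) ** aA b a (c \<otimes> v)
      ** (aA (b \<otimes> a) c v ** ((aC a b <*> aI c) <*> aI v)) ** (aA' a b c <*> aI v) ** aA' a (b \<otimes> c) v"
    by (simp add: pentagon_mixed[symmetric])
  also have "\<dots> = (aI b <*> aA c a v) ** (aI b <*> (aC a c <*> aI v)) ** (aI b <*> aA' a c v) ** aA b a (c \<otimes> v)
      ** (aC a b <*> aI (c \<otimes> v)) ** (aA (a \<otimes> b) c v ** (aA' a b c <*> aI v) ** aA' a (b \<otimes> c) v)"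
    using A_nat[of "aC a b" "aI c" "aI v"] by simp
  also have "\<dots> = (aI b <*> aS a c v) ** aS a b (c \<otimes> v) ** (aI a <*> aA b c v)"
    by (simp only: pentagon_inverse) (simp add: aS_def interchange_right)
  finally show ?thesis .
qed

text \<open>  Naturality of braiding \<open>a\<close> past an object, applied to the braiding of \<open>b\<close> and \<open>c\<close>, with both sides rewritten by
  \<open>aS_tensor\<close>.\<close>

lemma yang_baxter:
  "(aI c <*> aS a b v) ** aS a c (b \<otimes> v) ** (aI a <*> aS b c v)
    = aS b c (a \<otimes> v) ** (aI b <*> aS a c v) ** aS a b (c \<otimes> v)"
proof -
  have *: "(aI a <*> aS b c v) ** (aI a <*> aA b c v) = (aI a <*> aA c b v) ** (aI a <*> (aC b c <*> aI v))"
    by (simp add: interchange_right[symmetric]) (simp add: aS_def)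
  have "((aI c <*> aS a b v) ** aS a c (b \<otimes> v) ** (aI a <*> aS b c v)) ** (aI a <*> aA b c v)
      = ((aI c <*> aS a b v) ** aS a c (b \<otimes> v) ** (aI a <*> aA c b v)) ** (aI a <*> (aC b c <*> aI v))"
    by (simp add: *)
  also have "\<dots> = aA c b (a \<otimes> v) ** aS a (c \<otimes> b) v ** (aI a <*> (aC b c <*> aI v))"
    by (simp only: aS_tensor[symmetric]) simp
  also have "\<dots> = aA c b (a \<otimes> v) ** (aC b c <*> aI (a \<otimes> v)) ** aS a (b \<otimes> c) v"
    using aS_natural[of "aI a" "aC b c" "aI v"] by simp
  also have "\<dots> = aS b c (a \<otimes> v) ** (aA b c (a \<otimes> v) ** aS a (b \<otimes> c) v)"
    by (simp add: aS_def[of b c])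
  also have "\<dots> = (aS b c (a \<otimes> v) ** (aI b <*> aS a c v) ** aS a b (c \<otimes> v)) ** (aI a <*> aA b c v)"
    by (simp add: aS_tensor)
  finally show ?thesis
    by (rule cancel_right[where Y = "aI a <*> aA' b c v"]) (simp_all add: interchange_right[symmetric])
qed

lemma aS_unit: "aL (a \<otimes> v) ** aS a \<one> v = aI a <*> aL v"
proof -
  have "aL (a \<otimes> v) ** aS a \<one> v = (aL (a \<otimes> v) ** aA \<one> a v) ** (aC a \<one> <*> aI v) ** aA' a \<one> v"
    by (simp add: aS_def)
  also have "\<dots> = (aR a <*> aI v) ** aA' a \<one> v"
    by (simp add: lunit_tensor reassoc[OF interchange_left[symmetric]] lunit_braid)
  also have "\<dots> = aI a <*> aL v" by (simp add: triangle_arrow[symmetric])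
  finally show ?thesis .
qed

lemma aA'_lunit: "aA' \<one> a b ** aL' (a \<otimes> b) = aL' a <*> aI b"
proof -
  have "(aL (a \<otimes> b) ** aA \<one> a b) ** (aA' \<one> a b ** aL' (a \<otimes> b)) = (aL (a \<otimes> b) ** aA \<one> a b) ** (aL' a <*> aI b)"
    by (simp only: lunit_tensor interchange_left[symmetric] ok_simps src_simps tgt_simps L_inverse)
       (simp add: lunit_tensor[symmetric])
  then show ?thesis
    by (rule cancel_left[where Y = "aA' \<one> a b ** aL' (a \<otimes> b)"]) simp_all
qed

lemma lunit_inv_natural: "ok F \<Longrightarrow> aL' (tgt F) ** F = (aI \<one> <*> F) ** aL' (src F)"
  by (rule cancel_left[where X = "aL (tgt F)" and Y = "aL' (tgt F)"])
     (simp_all add: reassoc[OF L_nat])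

lemma A'_nat: "\<lbrakk>ok F; ok G; ok H\<rbrakk> \<Longrightarrow>
    aA' (tgt F) (tgt G) (tgt H) ** (F <*> G <*> H) = ((F <*> G) <*> H) ** aA' (src F) (src G) (src H)"
  by (rule cancel_left[where X = "aA (tgt F) (tgt G) (tgt H)" and Y = "aA' (tgt F) (tgt G) (tgt H)"])
     (simp_all add: reassoc[OF A_nat])

text \<open>
  The partial trace over the first factor \<open>a\<close> of \<open>a \<otimes> v\<close>, for a dual \<open>b\<close> of \<open>a\<close>. The coevaluation followed by the braiding
  creates \<open>b \<otimes> a\<close>, with \<open>a\<close> next to \<open>v\<close>.
\<close>

definition partial_trace_arrow :: "'o \<Rightarrow> 'o \<Rightarrow> 'm \<Rightarrow> 'm \<Rightarrow> 'o \<Rightarrow> ('o, 'm) arrow \<Rightarrow> ('o, 'm) arrow" where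
  "partial_trace_arrow a b ev coev v X = aL v ** (Arrow (b \<otimes> a) ev \<one> <*> aI v) ** aA' b a v ** (aI b <*> X) ** aA b a v **
     ((aC a b ** Arrow \<one> coev (a \<otimes> b)) <*> aI v) ** aL' v"

lemma partial_trace_arrow_bimodule:
  assumes "is_dual C a b ev coev" and [simp]: "ok X" "ok Y" "ok W" "src X = a \<otimes> v" "tgt X = a \<otimes> v"
    "src Y = v" "tgt Y = v" "src W = v" "tgt W = v"
  shows "partial_trace_arrow a b ev coev v ((aI a <*> Y) ** X ** (aI a <*> W)) = Y ** partial_trace_arrow a b ev coev v X ** W"
proof -
  define E where "E = Arrow (b \<otimes> a) ev \<one>"
  define D where "D = aC a b ** Arrow \<one> coev (a \<otimes> b)"
  have [simp]: "ok E" "src E = b \<otimes> a" "tgt E = \<one>"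
    using assms(1) by (simp_all add: is_dual_def ok_def E_def)
  have "ok (Arrow \<one> coev (a \<otimes> b))"
    using assms(1) by (simp add: is_dual_def ok_def)
  then have [simp]: "ok D" "src D = \<one>" "tgt D = b \<otimes> a"
    by (simp_all add: D_def)
  have 1: "aL v ** (E <*> aI v) ** aA' b a v ** (aI b <*> aI a <*> Y) = Y ** aL v ** (E <*> aI v) ** aA' b a v"
  proof -
    have "aL v ** (E <*> aI v) ** aA' b a v ** (aI b <*> aI a <*> Y) = aL v ** (E <*> aI v) ** (aI (b \<otimes> a) <*> Y) ** aA' b a v"
      using A'_nat[of "aI b" "aI a" Y] by simp
    also have "\<dots> = aL v ** (aI \<one> <*> Y) ** (E <*> aI v) ** aA' b a v"
      using reassoc[OF interchange[symmetric], of E "aI (b \<otimes> a)" "aI v" Y "aA' b a v"]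
        reassoc[OF interchange[symmetric], of "aI \<one>" E Y "aI v" "aA' b a v"] by simp
    also have "\<dots> = Y ** aL v ** (E <*> aI v) ** aA' b a v"
      using reassoc[OF L_nat[of Y]] by simp
    finally show ?thesis .
  qed
  have 2: "(aI b <*> aI a <*> W) ** aA b a v ** (D <*> aI v) ** aL' v = aA b a v ** (D <*> aI v) ** aL' v ** W"
  proof -
    have "(aI b <*> aI a <*> W) ** aA b a v ** (D <*> aI v) ** aL' v = aA b a v ** (aI (b \<otimes> a) <*> W) ** (D <*> aI v) ** aL' v"
      using reassoc[OF A_nat[of "aI b" "aI a" W, symmetric], of "(D <*> aI v) ** aL' v"] by simp
    also have "\<dots> = aA b a v ** (D <*> aI v) ** (aI \<one> <*> W) ** aL' v"
      using reassoc[OF interchange[symmetric], of D "aI \<one>" "aI v" W "aL' v"]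
        reassoc[OF interchange[symmetric], of "aI (b \<otimes> a)" D W "aI v" "aL' v"] by simp
    also have "\<dots> = aA b a v ** (D <*> aI v) ** aL' v ** W"
      using lunit_inv_natural[of W] by simp
    finally show ?thesis .
  qed
  have "partial_trace_arrow a b ev coev v ((aI a <*> Y) ** X ** (aI a <*> W))
     = (aL v ** (E <*> aI v) ** aA' b a v ** (aI b <*> aI a <*> Y)) ** (aI b <*> X)
       ** ((aI b <*> aI a <*> W) ** aA b a v ** (D <*> aI v) ** aL' v)"
    unfolding partial_trace_arrow_def E_def[symmetric] D_def[symmetric] by (simp add: interchange_right)
  also have "\<dots> = Y ** partial_trace_arrow a b ev coev v X ** W"
    unfolding 1 2 partial_trace_arrow_def E_def[symmetric] D_def[symmetric] by simp
  finally show ?thesis .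
qed

lemma partial_trace_arrow_tensor:
  assumes "is_dual C a b ev coev" and [simp]: "ok X" "ok Y" "src X = a" "tgt X = a" "src Y = v" "tgt Y = v"
    and k: "k \<star> Id \<one> = ev \<cdot> \<c> a b \<cdot> (mor X \<boxtimes> Id b) \<cdot> coev"
  shows "partial_trace_arrow a b ev coev v (X <*> Y) = Arrow v (k \<star> mor Y) v"
proof -
  define E where "E = Arrow (b \<otimes> a) ev \<one>"
  define D0 where "D0 = Arrow \<one> coev (a \<otimes> b)"
  have [simp]: "ok E" "src E = b \<otimes> a" "tgt E = \<one>" "ok D0" "src D0 = \<one>" "tgt D0 = a \<otimes> b"
    using assms(1) by (simp_all add: is_dual_def ok_def E_def D0_def)
  have "((E ** aC a b) ** (X <*> aI b)) ** D0 = Arrow \<one> (k \<star> Id \<one>) \<one>"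
    unfolding k E_def D0_def aC_def aI_def arrow_comp_def arrow_tens_def by simp
  moreover have "E ** aC a b ** (X <*> aI b) ** D0 = E ** (aI b <*> X) ** aC a b ** D0"
    using reassoc[OF C_nat[of X "aI b"], of D0] by simp
  ultimately have *: "E ** (aI b <*> X) ** aC a b ** D0 = Arrow \<one> (k \<star> Id \<one>) \<one>" by simp
  have "partial_trace_arrow a b ev coev v (X <*> Y) = aL v ** (E <*> aI v) ** aA' b a v ** ((aI b <*> X <*> Y) ** aA b a v) **
     ((aC a b ** D0) <*> aI v) ** aL' v"
    unfolding partial_trace_arrow_def E_def[symmetric] D0_def[symmetric] by simp
  also have "(aI b <*> X <*> Y) ** aA b a v = aA b a v ** ((aI b <*> X) <*> Y)"
    using A_nat[of "aI b" X Y] by simp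
  also have "aL v ** (E <*> aI v) ** aA' b a v ** (aA b a v ** ((aI b <*> X) <*> Y)) ** ((aC a b ** D0) <*> aI v) ** aL' v
     = aL v ** (E <*> aI v) ** ((aI b <*> X) <*> Y) ** ((aC a b ** D0) <*> aI v) ** aL' v" by simp
  also have "\<dots> = aL v ** ((E ** (aI b <*> X) ** aC a b ** D0) <*> Y) ** aL' v"
    using reassoc[OF interchange[symmetric], of "aI b <*> X" "aC a b ** D0" Y "aI v" "aL' v"]
     reassoc[OF interchange[symmetric], of E "(aI b <*> X) ** aC a b ** D0" "aI v" Y "aL' v"] by simp
  also have "\<dots> = Arrow v (k \<star> mor Y) v"
  proof -
    have Y: "mor Y \<in> Hom v v" using \<open>ok Y\<close> by (simp add: ok_def)
    have "aL v ** (aI \<one> <*> Y) ** aL' v = Y"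
      using reassoc[OF L_nat[of Y], of "aL' v"] by simp
    moreover have "mor (aL v ** (Arrow \<one> (k \<star> Id \<one>) \<one> <*> Y) ** aL' v) = k \<star> mor (aL v ** (aI \<one> <*> Y) ** aL' v)"
    proof -
      have "Id \<one> \<boxtimes> mor Y \<in> Hom (\<one> \<otimes> v) (\<one> \<otimes> v)" using tens_in_Hom[OF Id_in_Hom Y] .
      moreover have "\<l> v \<in> Hom (\<one> \<otimes> v) v" "lunit_inv v \<in> Hom v (\<one> \<otimes> v)"
        using lunit_inv[of v] by (simp_all add: inverses_def)
      ultimately show ?thesis
        using comp_scale_left[of "lunit_inv v" v "\<one> \<otimes> v" "Id \<one> \<boxtimes> mor Y" "\<one> \<otimes> v" k]
          comp_scale_right[of "(Id \<one> \<boxtimes> mor Y) \<cdot> lunit_inv v" v "\<one> \<otimes> v" "\<l> v" v k]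
          tens_scale_left[OF Id_in_Hom Y, of k \<one>]
        by (simp add: src_tgt_defs comp_in_Hom)
    qed
    ultimately have "mor (aL v ** (Arrow \<one> (k \<star> Id \<one>) \<one> <*> Y) ** aL' v) = k \<star> mor Y" by simp
    then show ?thesis unfolding * by (intro arrow.expand) simp
  qed
  finally show ?thesis .
qed

text \<open>  The closed strand of a crossing can be pulled straight. The braiding \<open>a \<otimes> b \<rightarrow> b \<otimes> a\<close> of the closure and the braiding
  of \<open>a\<close> with \<open>a\<close> combine to the braiding of \<open>a\<close> past \<open>b \<otimes> a\<close> (\<open>aS_tensor\<close>). By naturality the evaluation moves
  through it, after which the braiding is past the unit object and only the zigzag identity of the dual is left.\<close>

lemma partial_trace_arrow_swap:
  assumes dual: "is_dual C a b ev coev"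
  shows "partial_trace_arrow a b ev coev (a \<otimes> v) (aS a a v) = aI (a \<otimes> v)"
proof -
  define E where "E = Arrow (b \<otimes> a) ev \<one>"
  define D where "D = Arrow \<one> coev (a \<otimes> b)"
  have [simp]: "ok E" "src E = b \<otimes> a" "tgt E = \<one>" "ok D" "src D = \<one>" "tgt D = a \<otimes> b"
    using assms(1) by (simp_all add: is_dual_def ok_def E_def D_def)
  have "((aR a ** (aI a <*> E)) ** aA a b a) ** (D <*> aI a) = aL a"
    using dual unfolding is_dual_def E_def D_def src_tgt_defs by simp
  then have zig: "aR a ** (aI a <*> E) ** aA a b a ** (D <*> aI a) = aL a" by simp
  have "partial_trace_arrow a b ev coev (a \<otimes> v) (aS a a v) = aL (a \<otimes> v) ** (E <*> aI (a \<otimes> v)) ** aA' b a (a \<otimes> v) **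
      (aI b <*> aS a a v) ** (aA b a (a \<otimes> v) ** (aC a b <*> aI (a \<otimes> v))) ** (D <*> aI (a \<otimes> v)) ** aL' (a \<otimes> v)"
    unfolding partial_trace_arrow_def E_def[symmetric] D_def[symmetric] by (simp add: interchange_left del: arrow_tens_id)
  also have "aA b a (a \<otimes> v) ** (aC a b <*> aI (a \<otimes> v)) = aS a b (a \<otimes> v) ** aA a b (a \<otimes> v)"
    by (simp add: aS_def)
  also have "aL (a \<otimes> v) ** (E <*> aI (a \<otimes> v)) ** aA' b a (a \<otimes> v) **
      (aI b <*> aS a a v) ** (aS a b (a \<otimes> v) ** aA a b (a \<otimes> v)) ** (D <*> aI (a \<otimes> v)) ** aL' (a \<otimes> v)
     = aL (a \<otimes> v) ** (E <*> aI (a \<otimes> v)) ** aA' b a (a \<otimes> v) **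
      ((aI b <*> aS a a v) ** aS a b (a \<otimes> v) ** (aI a <*> aA b a v)) ** (aI a <*> aA' b a v) ** aA a b (a \<otimes> v)
      ** (D <*> aI (a \<otimes> v)) ** aL' (a \<otimes> v)"
    by (simp add: reassoc[OF interchange_right[symmetric]])
  also have "\<dots> = aL (a \<otimes> v) ** ((E <*> aI a <*> aI v) ** aS a (b \<otimes> a) v) ** (aI a <*> aA' b a v) ** aA a b (a \<otimes> v)
      ** (D <*> aI (a \<otimes> v)) ** aL' (a \<otimes> v)"
    by (simp add: aS_tensor[symmetric])
  also have "(E <*> aI a <*> aI v) ** aS a (b \<otimes> a) v = aS a \<one> v ** (aI a <*> E <*> aI v)"
    using aS_natural[of "aI a" E "aI v"] by simp
  also have "aL (a \<otimes> v) ** (aS a \<one> v ** (aI a <*> E <*> aI v)) ** (aI a <*> aA' b a v) ** aA a b (a \<otimes> v)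
      ** (D <*> aI (a \<otimes> v)) ** aL' (a \<otimes> v)
    = (aI a <*> aL v) ** (aI a <*> E <*> aI v) ** ((aI a <*> aA' b a v) ** aA a b (a \<otimes> v) ** aA (a \<otimes> b) a v)
      ** aA' (a \<otimes> b) a v ** (D <*> aI (a \<otimes> v)) ** aL' (a \<otimes> v)"
    by (simp add: reassoc[OF aS_unit])
  also have "\<dots> = (aI a <*> aL v) ** ((aI a <*> E <*> aI v) ** aA a (b \<otimes> a) v) ** (aA a b a <*> aI v)
      ** (aA' (a \<otimes> b) a v ** (D <*> aI a <*> aI v)) ** aL' (a \<otimes> v)"
    by (simp only: pentagon_mixed) simp
  also have "(aI a <*> E <*> aI v) ** aA a (b \<otimes> a) v = aA a \<one> v ** ((aI a <*> E) <*> aI v)"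
    using A_nat[of "aI a" E "aI v"] by simp
  also have "aA' (a \<otimes> b) a v ** (D <*> aI a <*> aI v) = ((D <*> aI a) <*> aI v) ** aA' \<one> a v"
    using A'_nat[of D "aI a" "aI v"] by simp
  also have "(aI a <*> aL v) ** (aA a \<one> v ** ((aI a <*> E) <*> aI v)) ** (aA a b a <*> aI v)
      ** (((D <*> aI a) <*> aI v) ** aA' \<one> a v) ** aL' (a \<otimes> v)
    = (aR a <*> aI v) ** ((aI a <*> E) <*> aI v) ** (aA a b a <*> aI v) ** ((D <*> aI a) <*> aI v) ** (aL' a <*> aI v)"
    by (simp add: reassoc[OF triangle_arrow] aA'_lunit)
  also have "\<dots> = ((aR a ** (aI a <*> E) ** aA a b a ** (D <*> aI a)) ** aL' a) <*> aI v"
    by (simp add: interchange_left)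
  also have "\<dots> = aI (a \<otimes> v)" by (simp only: zig) simp
  finally show ?thesis .
qed

end

section \<open>The action of the symmetric groups\<close>

context linear_symmetric_category
begin

context
  fixes Z :: 'o
begin

abbreviation "tp \<equiv> tens_pow C Z"

definition adj_arrow :: "nat \<Rightarrow> nat \<Rightarrow> ('o, 'm) arrow" where
  "adj_arrow n i = Arrow (tp n) (adj_swap C Z n i) (tp n)"

lemma adj_arrow_0: "adj_arrow (Suc (Suc n)) 0 = aS Z Z (tp n)"
proof -
  have "adj_arrow (Suc (Suc n)) 0 = (aA Z Z (tp n) ** (aC Z Z <*> aI (tp n))) ** aA' Z Z (tp n)"
    by (simp add: adj_arrow_def src_tgt_defs)
  then show ?thesis by (simp add: aS_def)
qed

lemma adj_arrow_Suc: "adj_arrow (Suc n) (Suc i) = aI Z <*> adj_arrow n i"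
  by (simp add: adj_arrow_def src_tgt_defs)

lemma adj_arrow_simps [simp]: "src (adj_arrow n i) = tp n" "tgt (adj_arrow n i) = tp n"
  by (simp_all add: adj_arrow_def)

lemma adj_arrow_ok [simp]: "Suc i < n \<Longrightarrow> ok (adj_arrow n i)"
proof (induction i arbitrary: n)
  case 0
  then obtain m where "n = Suc (Suc m)" using less_iff_Suc_add[of "Suc 0" n] by auto
  then show ?case by (simp add: adj_arrow_0)
next
  case (Suc i)
  then show ?case by (cases n) (simp_all add: adj_arrow_Suc)
qed

lemma adj_arrow_involution: "Suc i < n \<Longrightarrow> adj_arrow n i ** adj_arrow n i = aI (tp n)"
proof (induction i arbitrary: n)
  case 0
  then obtain m where "n = Suc (Suc m)" using less_iff_Suc_add[of "Suc 0" n] by auto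
  then show ?case by (simp add: adj_arrow_0)
next
  case (Suc i)
  then show ?case by (cases n) (simp_all add: adj_arrow_Suc interchange_right[symmetric])
qed

lemma adj_arrow_commute: "\<lbrakk>Suc i < j; Suc j < n\<rbrakk> \<Longrightarrow> adj_arrow n i ** adj_arrow n j = adj_arrow n j ** adj_arrow n i"
proof (induction i arbitrary: n j)
  case 0
  then obtain m j' where m: "n = Suc (Suc m)" "j = Suc (Suc j')" "Suc j' < m"
    by (cases n; cases "n - 1"; cases j; cases "j - 1") auto
  then show ?case using aS_natural[of "aI Z" "aI Z" "adj_arrow m j'"] by (simp add: adj_arrow_0 adj_arrow_Suc)
next
  case (Suc i)
  then show ?case by (cases n; cases j) (simp_all add: adj_arrow_Suc interchange_right[symmetric])
qed

lemma adj_arrow_braid: "Suc (Suc i) < n \<Longrightarrow> adj_arrow n i ** adj_arrow n (Suc i) ** adj_arrow n i = adj_arrow n (Suc i) ** adj_arrow n i ** adj_arrow n (Suc i)"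
proof (induction i arbitrary: n)
  case 0
  then obtain m where "n = Suc (Suc (Suc m))" using less_iff_Suc_add[of "Suc (Suc 0)" n] by auto
  then show ?case using yang_baxter[of Z Z Z "tp m"] by (simp add: adj_arrow_0 adj_arrow_Suc)
next
  case (Suc i)
  then show ?case by (cases n) (simp_all add: adj_arrow_Suc interchange_right[symmetric])
qed

text \<open>The product of adjacent swaps that corresponds to \<open>cyc_up k\<close>.\<close>

primrec cyc_arrow :: "nat \<Rightarrow> nat \<Rightarrow> ('o, 'm) arrow" where
  "cyc_arrow n 0 = aI (tp n)"
| "cyc_arrow n (Suc k) = adj_arrow n k ** cyc_arrow n k"

lemma cyc_mor_simps [simp]: "k < n \<Longrightarrow> ok (cyc_arrow n k) \<and> src (cyc_arrow n k) = tp n \<and> tgt (cyc_arrow n k) = tp n"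
  by (induction k) auto

lemma cyc_mor_above: "\<lbrakk>k < i; Suc i < n\<rbrakk> \<Longrightarrow> adj_arrow n i ** cyc_arrow n k = cyc_arrow n k ** adj_arrow n i"
proof (induction k)
  case (Suc k)
  have "adj_arrow n i ** cyc_arrow n (Suc k) = adj_arrow n k ** (adj_arrow n i ** cyc_arrow n k)"
    using Suc.prems reassoc[OF adj_arrow_commute[of k i n, symmetric]] by simp
  also have "\<dots> = cyc_arrow n (Suc k) ** adj_arrow n i" using Suc by simp
  finally show ?case .
qed simp

lemma cyc_mor_below: "\<lbrakk>Suc i < k; k < n\<rbrakk> \<Longrightarrow> adj_arrow n i ** cyc_arrow n k = cyc_arrow n k ** adj_arrow n (Suc i)"
proof (induction k)
  case (Suc k)
  show ?case
  proof (cases "Suc i < k")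
    case True
    have "adj_arrow n i ** cyc_arrow n (Suc k) = adj_arrow n k ** (adj_arrow n i ** cyc_arrow n k)"
      using Suc.prems True reassoc[OF adj_arrow_commute[of i k n]] by simp
    also have "\<dots> = cyc_arrow n (Suc k) ** adj_arrow n (Suc i)" using Suc True by simp
    finally show ?thesis .
  next
    case False
    then have k: "k = Suc i" using Suc.prems by simp
    have "adj_arrow n i ** cyc_arrow n (Suc k) = (adj_arrow n i ** adj_arrow n (Suc i) ** adj_arrow n i) ** cyc_arrow n i"
      using Suc.prems k by simp
    also have "\<dots> = adj_arrow n (Suc i) ** adj_arrow n i ** (adj_arrow n (Suc i) ** cyc_arrow n i)"
      using Suc.prems k by (simp add: adj_arrow_braid)
    also have "\<dots> = cyc_arrow n (Suc k) ** adj_arrow n (Suc i)"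
      using Suc.prems k cyc_mor_above[of i "Suc i" n] by simp
    finally show ?thesis .
  qed
qed simp

text \<open>  The morphism of a permutation from its coset decomposition \<open>\<pi> = cyc_up (\<pi> 0) \<circ> shiftp \<sigma>\<close>. That this is well
  behaved under multiplication with adjacent transpositions (\<open>perm_arrow_swap\<close>) says that products of adjacent swaps
  depend only on the permutation.\<close>

fun perm_arrow :: "nat \<Rightarrow> (nat \<Rightarrow> nat) \<Rightarrow> ('o, 'm) arrow" where
  "perm_arrow 0 \<pi> = aI \<one>"
| "perm_arrow (Suc n) \<pi> = cyc_arrow (Suc n) (\<pi> 0) ** (aI Z <*> perm_arrow n (THE \<sigma>. \<pi> = cyc_up (\<pi> 0) \<circ> shiftp \<sigma>))"

declare perm_arrow.simps(2) [simp del]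

lemma perm_arrow_cyc_up:
  assumes "\<sigma> permutes {..<n}" "k \<le> n"
  shows "perm_arrow (Suc n) (cyc_up k \<circ> shiftp \<sigma>) = cyc_arrow (Suc n) k ** (aI Z <*> perm_arrow n \<sigma>)"
proof -
  have "inj (cyc_up k)" using permutes_inj[OF cyc_up_permutes[of k "Suc n"]] assms by simp
  then have "\<sigma>' = \<sigma>" if "cyc_up k \<circ> shiftp \<sigma> = cyc_up k \<circ> shiftp \<sigma>'" for \<sigma>'
    using that by (metis fun.inj_map_strong injD shiftp_inj)
  then have "(THE \<sigma>'. cyc_up k \<circ> shiftp \<sigma> = cyc_up k \<circ> shiftp \<sigma>') = \<sigma>" by (intro the_equality) auto
  then show ?thesis by (simp add: perm_arrow.simps(2))
qed

lemma perm_arrow_simps [simp]: "\<pi> permutes {..<n} \<Longrightarrow> ok (perm_arrow n \<pi>) \<and> src (perm_arrow n \<pi>) = tp n \<and> tgt (perm_arrow n \<pi>) = tp n"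
proof (induction n arbitrary: \<pi>)
  case (Suc n)
  obtain \<sigma> where \<sigma>: "\<pi> = cyc_up (\<pi> 0) \<circ> shiftp \<sigma>" "\<sigma> permutes {..<n}" using Suc.prems(1) by (rule cyc_up_decomp)
  moreover have "\<pi> 0 < Suc n" using permutes_in_image[OF Suc.prems, of 0] by simp
  ultimately have "perm_arrow (Suc n) \<pi> = cyc_arrow (Suc n) (\<pi> 0) ** (aI Z <*> perm_arrow n \<sigma>)"
    using perm_arrow_cyc_up[of \<sigma> n "\<pi> 0"] by simp
  then show ?case using Suc.IH[OF \<sigma>(2)] \<open>\<pi> 0 < Suc n\<close> by simp
qed simp

lemma perm_arrow_shiftp: "\<sigma> permutes {..<n} \<Longrightarrow> perm_arrow (Suc n) (shiftp \<sigma>) = aI Z <*> perm_arrow n \<sigma>"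
  using perm_arrow_cyc_up[of \<sigma> n 0] by simp

lemma perm_arrow_id: "perm_arrow n id = aI (tp n)"
proof (induction n)
  case (Suc n)
  show ?case using perm_arrow_shiftp[OF permutes_id, of n] by (simp only: shiftp_id Suc arrow_tens_id tens_pow.simps)
qed simp

text \<open>  Multiplication by \<open>s\<^sub>i = (i i+1)\<close> changes the decomposition as follows, with \<open>k = \<pi> 0\<close>. For \<open>i = k\<close> and
  \<open>i = k - 1\<close> the coset changes; otherwise \<open>s\<^sub>i\<close> passes through the cycle, as \<open>s\<^sub>i\<close> if \<open>i > k\<close> and as \<open>s\<^sub>i\<^sub>+\<^sub>1\<close> if \<open>i < k - 1\<close>, and
  then acts on \<open>\<sigma>\<close>. The swaps follow along because of the involution, commutation and braid relations.\<close>

lemma perm_arrow_swap: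
  "\<lbrakk>\<pi> permutes {..<n}; Suc i < n\<rbrakk> \<Longrightarrow> perm_arrow n (transpose i (Suc i) \<circ> \<pi>) = adj_arrow n i ** perm_arrow n \<pi>"
proof (induction n arbitrary: \<pi> i)
  case (Suc n)
  obtain \<sigma> where \<sigma>: "\<pi> = cyc_up (\<pi> 0) \<circ> shiftp \<sigma>" "\<sigma> permutes {..<n}" using Suc.prems(1) by (rule cyc_up_decomp)
  define k where "k = \<pi> 0"
  have k: "k < Suc n" using permutes_in_image[OF Suc.prems(1), of 0] by (simp add: k_def)
  have \<pi>: "\<pi> = cyc_up k \<circ> shiftp \<sigma>" using \<sigma> by (simp add: k_def)
  have [simp]: "ok (perm_arrow n \<sigma>)" "src (perm_arrow n \<sigma>) = tp n" "tgt (perm_arrow n \<sigma>) = tp n" using perm_arrow_simps[OF \<sigma>(2)] by auto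
  have perm_arrow: "perm_arrow (Suc n) \<pi> = cyc_arrow (Suc n) k ** (aI Z <*> perm_arrow n \<sigma>)"
    unfolding \<pi> using perm_arrow_cyc_up[OF \<sigma>(2)] k by simp
  have K: "ok (cyc_arrow (Suc n) k)" "src (cyc_arrow (Suc n) k) = tp (Suc n)" "tgt (cyc_arrow (Suc n) k) = tp (Suc n)"
    using cyc_mor_simps[OF k] by auto
  consider "i = k" | "k = Suc i" | "k < i" | "Suc i < k" by linarith
  then show ?case
  proof cases
    case 1
    then have "transpose i (Suc i) \<circ> \<pi> = cyc_up (Suc k) \<circ> shiftp \<sigma>" by (simp add: \<pi> cyc_up_Suc o_assoc)
    then have "perm_arrow (Suc n) (transpose i (Suc i) \<circ> \<pi>) = cyc_arrow (Suc n) (Suc k) ** (aI Z <*> perm_arrow n \<sigma>)"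
      using perm_arrow_cyc_up[OF \<sigma>(2), of "Suc k"] 1 Suc.prems(2) by (metis Suc_less_SucD Suc_leI)
    also have "\<dots> = adj_arrow (Suc n) i ** perm_arrow (Suc n) \<pi>" unfolding perm_arrow using 1 Suc.prems K by simp
    finally show ?thesis .
  next
    case 2
    then have "transpose i (Suc i) \<circ> \<pi> = cyc_up i \<circ> shiftp \<sigma>" by (simp add: \<pi> cyc_up_Suc o_assoc)
    then have "perm_arrow (Suc n) (transpose i (Suc i) \<circ> \<pi>) = cyc_arrow (Suc n) i ** (aI Z <*> perm_arrow n \<sigma>)"
      using perm_arrow_cyc_up[OF \<sigma>(2), of i] Suc.prems(2) by (metis Suc_less_SucD less_imp_le)
    also have "\<dots> = adj_arrow (Suc n) i ** perm_arrow (Suc n) \<pi>" unfolding perm_arrow using 2 Suc.prems K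
      reassoc[OF adj_arrow_involution[of i "Suc n"], of "cyc_arrow (Suc n) i ** (aI Z <*> perm_arrow n \<sigma>)"] cyc_mor_simps[of i "Suc n"]
      by simp
    finally show ?thesis .
  next
    case 3
    then obtain j where j: "i = Suc j" by (cases i) auto
    then have "transpose i (Suc i) \<circ> \<pi> = cyc_up k \<circ> shiftp (transpose j (Suc j) \<circ> \<sigma>)"
      using cyc_up_above[OF 3] by (simp add: \<pi> o_assoc shiftp_comp shiftp_transpose)
    moreover have "perm_arrow (Suc n) (cyc_up k \<circ> shiftp (transpose j (Suc j) \<circ> \<sigma>))
        = cyc_arrow (Suc n) k ** (aI Z <*> perm_arrow n (transpose j (Suc j) \<circ> \<sigma>))"
      using Suc.prems j k \<sigma>(2) by (intro perm_arrow_cyc_up permutes_compose adjacent_permutes) auto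
    moreover have "perm_arrow n (transpose j (Suc j) \<circ> \<sigma>) = adj_arrow n j ** perm_arrow n \<sigma>"
      using Suc.prems j \<sigma>(2) by (intro Suc.IH) auto
    ultimately have "perm_arrow (Suc n) (transpose i (Suc i) \<circ> \<pi>) = cyc_arrow (Suc n) k ** (aI Z <*> (adj_arrow n j ** perm_arrow n \<sigma>))"
      by (simp only:)
    also have "\<dots> = (cyc_arrow (Suc n) k ** adj_arrow (Suc n) i) ** (aI Z <*> perm_arrow n \<sigma>)"
      using K Suc.prems j by (simp add: adj_arrow_Suc interchange_right)
    also have "\<dots> = adj_arrow (Suc n) i ** perm_arrow (Suc n) \<pi>"
      using K Suc.prems by (simp add: perm_arrow cyc_mor_above[OF 3, symmetric])
    finally show ?thesis .
  next
    case 4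
    have "transpose i (Suc i) \<circ> \<pi> = cyc_up k \<circ> shiftp (transpose i (Suc i) \<circ> \<sigma>)"
      using cyc_up_below[OF 4] by (simp add: \<pi> o_assoc shiftp_comp shiftp_transpose)
    moreover have "perm_arrow (Suc n) (cyc_up k \<circ> shiftp (transpose i (Suc i) \<circ> \<sigma>))
        = cyc_arrow (Suc n) k ** (aI Z <*> perm_arrow n (transpose i (Suc i) \<circ> \<sigma>))"
      using 4 k \<sigma>(2) by (intro perm_arrow_cyc_up permutes_compose adjacent_permutes) auto
    moreover have "perm_arrow n (transpose i (Suc i) \<circ> \<sigma>) = adj_arrow n i ** perm_arrow n \<sigma>"
      using 4 k \<sigma>(2) by (intro Suc.IH) auto
    ultimately have "perm_arrow (Suc n) (transpose i (Suc i) \<circ> \<pi>) = cyc_arrow (Suc n) k ** (aI Z <*> (adj_arrow n i ** perm_arrow n \<sigma>))"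
      by (simp only:)
    also have "\<dots> = (cyc_arrow (Suc n) k ** adj_arrow (Suc n) (Suc i)) ** (aI Z <*> perm_arrow n \<sigma>)"
      using K Suc.prems 4 k by (simp add: adj_arrow_Suc interchange_right)
    also have "\<dots> = adj_arrow (Suc n) i ** perm_arrow (Suc n) \<pi>"
      using K Suc.prems k by (simp add: perm_arrow cyc_mor_below[OF 4, symmetric])
    finally show ?thesis .
  qed
qed simp

lemma perm_arrow_comp:
  assumes "\<sigma> permutes {..<n}" "\<pi> permutes {..<n}"
  shows "perm_arrow n (\<sigma> \<circ> \<pi>) = perm_arrow n \<sigma> ** perm_arrow n \<pi>"
  using assms(1)
proof (induction rule: permutes_adjacent_induct)
  case id
  show ?case using perm_arrow_simps[OF assms(2)] by (simp only: perm_arrow_id id_o arrow_comp_id)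
next
  case (swap i \<tau>)
  have "perm_arrow n (transpose i (Suc i) \<circ> (\<tau> \<circ> \<pi>)) = adj_arrow n i ** perm_arrow n (\<tau> \<circ> \<pi>)"
    using swap assms(2) by (intro perm_arrow_swap permutes_compose) auto
  also have "\<dots> = (adj_arrow n i ** perm_arrow n \<tau>) ** perm_arrow n \<pi>"
    unfolding swap.IH using perm_arrow_simps[OF swap.hyps(1)] perm_arrow_simps[OF assms(2)] swap.hyps by simp
  also have "adj_arrow n i ** perm_arrow n \<tau> = perm_arrow n (transpose i (Suc i) \<circ> \<tau>)"
    using swap.hyps by (simp only: perm_arrow_swap)
  finally show ?case by (simp only: o_assoc)
qed

lemma perm_graph_iff:
  assumes "\<pi> permutes {..<n}"
  shows "perm_graph C Z n \<pi> f \<longleftrightarrow> f = mor (perm_arrow n \<pi>)"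
proof
  have "\<pi> permutes {..<n} \<and> f = mor (perm_arrow n \<pi>)" if "perm_graph C Z n \<pi> f" for \<pi> f
    using that
  proof induction
    case 1
    show ?case by (simp only: permutes_id perm_arrow_id) (simp add: aI_def)
  next
    case (2 \<pi> f i)
    then have "transpose i (Suc i) \<circ> \<pi> permutes {..<n}" by (intro permutes_compose adjacent_permutes) auto
    moreover have "perm_arrow n (transpose i (Suc i) \<circ> \<pi>) = adj_arrow n i ** perm_arrow n \<pi>"
      using 2 by (intro perm_arrow_swap) auto
    ultimately show ?case using 2 by (simp only:) (simp add: arrow_comp_def adj_arrow_def)
  qed
  then show "f = mor (perm_arrow n \<pi>)" if "perm_graph C Z n \<pi> f" using that by blast
next
  assume f: "f = mor (perm_arrow n \<pi>)"
  have "perm_graph C Z n \<pi> (mor (perm_arrow n \<pi>))" using assms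
  proof (induction rule: permutes_adjacent_induct)
    case id
    show ?case using perm_graph.intros(1)[of C Z n] by (simp only: perm_arrow_id aI_def arrow.sel)
  next
    case (swap i \<pi>)
    then show ?case using perm_graph.intros(2)[of C Z n \<pi> "mor (perm_arrow n \<pi>)" i]
      by (simp only: perm_arrow_swap arrow_comp_def adj_arrow_def arrow.sel)
  qed
  then show "perm_graph C Z n \<pi> f" using f by simp
qed

lemma perm_arrow_perm_mor: "\<pi> permutes {..<n} \<Longrightarrow> perm_arrow n \<pi> = Arrow (tp n) (perm_mor C Z n \<pi>) (tp n)"
proof -
  assume \<pi>: "\<pi> permutes {..<n}"
  have "perm_mor C Z n \<pi> = mor (perm_arrow n \<pi>)"
    unfolding perm_mor_def by (intro the_equality) (simp_all only: perm_graph_iff[OF \<pi>])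
  then show ?thesis using perm_arrow_simps[OF \<pi>] by (cases "perm_arrow n \<pi>") simp
qed

lemma perm_mor_in_Hom: "\<pi> permutes {..<n} \<Longrightarrow> perm_mor C Z n \<pi> \<in> Hom (tp n) (tp n)"
  using perm_arrow_simps[of \<pi> n] perm_arrow_perm_mor[of \<pi> n] by (simp add: ok_def)

lemma perm_mor_comp: "\<lbrakk>\<sigma> permutes {..<n}; \<pi> permutes {..<n}\<rbrakk>
   \<Longrightarrow> perm_mor C Z n (\<sigma> \<circ> \<pi>) = perm_mor C Z n \<sigma> \<cdot> perm_mor C Z n \<pi>"
  using perm_arrow_comp[of \<sigma> n \<pi>] perm_arrow_perm_mor[OF permutes_compose[of \<pi> "{..<n}" \<sigma>]]
  by (simp add: perm_arrow_perm_mor arrow_comp_def)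

context
  fixes f :: 'm
  assumes f_in_End: "f \<in> Hom Z Z"
begin

definition pow_arrow :: "nat \<Rightarrow> ('o, 'm) arrow" where "pow_arrow k = Arrow Z (mor_pow C Z f k) Z"

lemma mor_pow_in_Hom: "mor_pow C Z f k \<in> Hom Z Z"
  by (induction k) (auto intro: Id_in_Hom comp_in_Hom f_in_End)

lemma pow_arrow_simps [simp]: "ok (pow_arrow k)" "src (pow_arrow k) = Z" "tgt (pow_arrow k) = Z"
  by (simp_all add: pow_arrow_def ok_def mor_pow_in_Hom)

lemma pow_arrow_0 [simp]: "pow_arrow 0 = aI Z" by (simp add: pow_arrow_def aI_def)

lemma pow_arrow_add: "pow_arrow i ** pow_arrow j = pow_arrow (i + j)"
proof (induction i)
  case (Suc i)
  have *: "pow_arrow (Suc k) = pow_arrow 1 ** pow_arrow k" for k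
    using comp_Id_right[OF f_in_End] by (simp add: pow_arrow_def arrow_comp_def)
  show ?case using Suc by (simp add: *[of i] *[of "i + j"])
qed simp


primrec tens_arrow :: "nat \<Rightarrow> (nat \<Rightarrow> nat) \<Rightarrow> ('o, 'm) arrow" where
  "tens_arrow 0 ks = aI \<one>"
| "tens_arrow (Suc n) ks = pow_arrow (ks 0) <*> tens_arrow n (\<lambda>i. ks (Suc i))"

lemma tens_arrow_simps [simp]: "ok (tens_arrow n ks)" "src (tens_arrow n ks) = tp n" "tgt (tens_arrow n ks) = tp n"
proof -
  have "ok (tens_arrow n ks) \<and> src (tens_arrow n ks) = tp n \<and> tgt (tens_arrow n ks) = tp n" by (induction n arbitrary: ks) auto
  then show "ok (tens_arrow n ks)" "src (tens_arrow n ks) = tp n" "tgt (tens_arrow n ks) = tp n" by auto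
qed

lemma tens_arrow_add: "tens_arrow n ks ** tens_arrow n ls = tens_arrow n (\<lambda>i. ks i + ls i)"
proof (induction n arbitrary: ks ls)
  case (Suc n)
  have "tens_arrow (Suc n) ks ** tens_arrow (Suc n) ls = (pow_arrow (ks 0) ** pow_arrow (ls 0)) <*> (tens_arrow n (\<lambda>i. ks (Suc i)) ** tens_arrow n (\<lambda>i. ls (Suc i)))"
    by (simp add: interchange)
  then show ?case by (simp add: Suc pow_arrow_add)
qed simp

lemma tens_arrow_0: "tens_arrow n (\<lambda>_. 0) = aI (tp n)"
  by (induction n) auto

lemma adj_arrow_tens_arrow: "Suc i < n \<Longrightarrow> adj_arrow n i ** tens_arrow n ks = tens_arrow n (\<lambda>j. ks (transpose i (Suc i) j)) ** adj_arrow n i"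
proof (induction i arbitrary: n ks)
  case 0
  then obtain m where n: "n = Suc (Suc m)" using less_iff_Suc_add[of "Suc 0" n] by auto
  have "(\<lambda>i. ks (transpose 0 (Suc 0) (Suc (Suc i)))) = (\<lambda>i. ks (Suc (Suc i)))"
    by (auto simp: transpose_def)
  then show ?case
    using aS_natural[of "pow_arrow (ks 0)" "pow_arrow (ks (Suc 0))" "tens_arrow m (\<lambda>i. ks (Suc (Suc i)))"] by (simp add: n adj_arrow_0)
next
  case (Suc i)
  then obtain m where n: "n = Suc m" "Suc i < m" by (cases n) auto
  have "(\<lambda>j. ks (transpose (Suc i) (Suc (Suc i)) (Suc j))) = (\<lambda>j. ks (Suc (transpose i (Suc i) j)))"
    by (auto simp: transpose_def)
  moreover have "transpose (Suc i) (Suc (Suc i)) 0 = 0" by (simp add: transpose_def)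
  ultimately show ?case using Suc.IH[OF n(2), of "\<lambda>j. ks (Suc j)"] n
    by (simp add: adj_arrow_Suc interchange[symmetric])
qed

lemma perm_arrow_tens_arrow:
  assumes "\<pi> permutes {..<n}"
  shows "perm_arrow n \<pi> ** tens_arrow n (\<lambda>i. ks (\<pi> i)) = tens_arrow n ks ** perm_arrow n \<pi>"
  using assms
proof (induction arbitrary: ks rule: permutes_adjacent_induct)
  case id
  show ?case unfolding perm_arrow_id by simp
next
  case (swap i \<tau>)
  let ?s = "transpose i (Suc i)"
  note [simp] = perm_arrow_simps[OF swap.hyps(1)]
  have "perm_arrow n (?s \<circ> \<tau>) ** tens_arrow n (\<lambda>j. ks ((?s \<circ> \<tau>) j)) = adj_arrow n i ** (perm_arrow n \<tau> ** tens_arrow n (\<lambda>j. (\<lambda>k. ks (?s k)) (\<tau> j)))"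
    unfolding perm_arrow_swap[OF swap.hyps] using swap.hyps by simp
  also have "\<dots> = (adj_arrow n i ** tens_arrow n (\<lambda>k. ks (?s k))) ** perm_arrow n \<tau>"
    using swap.IH[of "\<lambda>k. ks (?s k)"] swap.hyps by simp
  also have "\<dots> = (tens_arrow n ks ** adj_arrow n i) ** perm_arrow n \<tau>"
    unfolding adj_arrow_tens_arrow[OF swap.hyps(2)] by simp
  also have "\<dots> = tens_arrow n ks ** perm_arrow n (?s \<circ> \<tau>)"
    unfolding perm_arrow_swap[OF swap.hyps] using swap.hyps by simp
  finally show ?case .
qed

end
end
end

section \<open>Partial traces\<close>

context rigid_symmetric_linear_category
begin


definition scal :: "'m \<Rightarrow> complex" where
  "scal x = (THE k. k \<star> Id \<one> = x)"

lemma scal_eq: "k \<star> Id \<one> = x \<Longrightarrow> scal x = k"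
  unfolding scal_def using End_unit by (intro the_equality) (auto simp: bij_betw_def inj_on_def)

lemma scal_Id: "x \<in> Hom \<one> \<one> \<Longrightarrow> scal x \<star> Id \<one> = x"
proof -
  assume "x \<in> Hom \<one> \<one>"
  then obtain k where k: "k \<star> Id \<one> = x" using End_unit unfolding bij_betw_def by (metis image_iff)
  show ?thesis unfolding scal_eq[OF k] by (rule k)
qed

lemma scal_add: "x \<in> Hom \<one> \<one> \<Longrightarrow> y \<in> Hom \<one> \<one> \<Longrightarrow> scal (x + y) = scal x + scal y"
  by (rule scal_eq) (simp add: scale_left_distrib scal_Id)

lemma scal_scale: "x \<in> Hom \<one> \<one> \<Longrightarrow> scal (k \<star> x) = k * scal x"
  by (rule scal_eq) (simp add: scal_Id flip: scale_scale)

text \<open>  The dual chosen in the definition of the trace; all partial traces below are taken with respect to it.\<close>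

lemma cat_trace_dual:
  obtains b ev coev where "is_dual C a b ev coev"
    "\<And>g. g \<in> Hom a a \<Longrightarrow> cat_trace C a g \<star> Id \<one> = ev \<cdot> \<c> a b \<cdot> (g \<boxtimes> Id b) \<cdot> coev"
proof -
  obtain b ev coev where s: "(SOME (b, ev, coev). is_dual C a b ev coev) = (b, ev, coev)"
    by (metis prod_cases3)
  have dual: "is_dual C a b ev coev"
    using someI_ex[of "\<lambda>(b, ev, coev). is_dual C a b ev coev"] rigid[of a] unfolding s by auto
  show thesis
  proof (rule that[OF dual])
    fix g assume g: "g \<in> Hom a a"
    have "ev \<cdot> \<c> a b \<cdot> (g \<boxtimes> Id b) \<cdot> coev \<in> Hom \<one> \<one>"
      using dual tens_in_Hom[OF g Id_in_Hom[of b]] braid_in_Hom unfolding is_dual_def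
      by (auto intro!: comp_in_Hom)
    from scal_Id[OF this] show "cat_trace C a g \<star> Id \<one> = ev \<cdot> \<c> a b \<cdot> (g \<boxtimes> Id b) \<cdot> coev"
      unfolding cat_trace_def s scal_def by simp
  qed
qed

context
  fixes Z b :: 'o and ev coev :: 'm
  assumes dual: "is_dual C Z b ev coev"
    and trace: "\<And>g. g \<in> Hom Z Z \<Longrightarrow> cat_trace C Z g \<star> Id \<one> = ev \<cdot> \<c> Z b \<cdot> (g \<boxtimes> Id b) \<cdot> coev"
begin

text \<open>  The first factor is closed. Closing all factors in turn gives \<open>full_trace\<close>, which avoids duals of tensor powers.\<close>

definition partial_trace :: "'o \<Rightarrow> 'm \<Rightarrow> 'm" where
  "partial_trace v x = mor (partial_trace_arrow Z b ev coev v (Arrow (Z \<otimes> v) x (Z \<otimes> v)))"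

lemma partial_trace_form:
  obtains P Q where "P \<in> Hom (b \<otimes> Z \<otimes> v) v" "Q \<in> Hom v (b \<otimes> Z \<otimes> v)"
    "\<And>x. x \<in> Hom (Z \<otimes> v) (Z \<otimes> v) \<Longrightarrow> partial_trace v x = P \<cdot> ((Id b \<boxtimes> x) \<cdot> Q)"
proof -
  define E where "E = Arrow (b \<otimes> Z) ev \<one>"
  define D where "D = Arrow \<one> coev (Z \<otimes> b)"
  have [simp]: "ok E" "src E = b \<otimes> Z" "tgt E = \<one>" "ok D" "src D = \<one>" "tgt D = Z \<otimes> b"
    using dual by (simp_all add: is_dual_def ok_def E_def D_def)
  define P where "P = aL v ** (E <*> aI v) ** aA' b Z v"
  define Q where "Q = aA b Z v ** ((aC Z b ** D) <*> aI v) ** aL' v"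
  have P: "ok P" "src P = b \<otimes> Z \<otimes> v" "tgt P = v" and Q: "ok Q" "src Q = v" "tgt Q = b \<otimes> Z \<otimes> v"
    by (simp_all add: P_def Q_def)
  show thesis
  proof (rule that[of "mor P" "mor Q"])
    show "mor P \<in> Hom (b \<otimes> Z \<otimes> v) v" "mor Q \<in> Hom v (b \<otimes> Z \<otimes> v)"
      using P Q by (simp_all add: ok_def)
    fix x assume "x \<in> Hom (Z \<otimes> v) (Z \<otimes> v)"
    then have x: "ok (Arrow (Z \<otimes> v) x (Z \<otimes> v))" by (simp add: ok_def)
    then have "partial_trace_arrow Z b ev coev v (Arrow (Z \<otimes> v) x (Z \<otimes> v)) = P ** (aI b <*> Arrow (Z \<otimes> v) x (Z \<otimes> v)) ** Q"
      unfolding partial_trace_arrow_def E_def[symmetric] D_def[symmetric] by (simp add: P_def Q_def)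
    then show "partial_trace v x = mor P \<cdot> ((Id b \<boxtimes> x) \<cdot> mor Q)"
      unfolding partial_trace_def by (simp add: arrow_comp_def arrow_tens_def aI_def)
  qed
qed

lemma partial_trace_linear:
  assumes "x \<in> Hom (Z \<otimes> v) (Z \<otimes> v)" "y \<in> Hom (Z \<otimes> v) (Z \<otimes> v)"
  shows "partial_trace v x \<in> Hom v v" "partial_trace v (x + y) = partial_trace v x + partial_trace v y" "partial_trace v (k \<star> x) = k \<star> partial_trace v x"
proof -
  obtain P Q where P: "P \<in> Hom (b \<otimes> Z \<otimes> v) v" and Q: "Q \<in> Hom v (b \<otimes> Z \<otimes> v)"
    and partial_trace: "\<And>x. x \<in> Hom (Z \<otimes> v) (Z \<otimes> v) \<Longrightarrow> partial_trace v x = P \<cdot> ((Id b \<boxtimes> x) \<cdot> Q)"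
    using partial_trace_form[of v] by blast
  note t = tens_in_Hom[OF Id_in_Hom[of b] assms(1)] tens_in_Hom[OF Id_in_Hom[of b] assms(2)]
  note c = comp_in_Hom[OF Q t(1)] comp_in_Hom[OF Q t(2)]
  show "partial_trace v x \<in> Hom v v" unfolding partial_trace[OF assms(1)] by (rule comp_in_Hom[OF c(1) P])
  show "partial_trace v (x + y) = partial_trace v x + partial_trace v y"
    using in_Hom_add[OF assms] assms
    by (simp add: partial_trace tens_add_right[OF Id_in_Hom assms] comp_add_left[OF Q t] comp_add_right[OF c P])
  show "partial_trace v (k \<star> x) = k \<star> partial_trace v x"
    using in_Hom_scale[OF assms(1)] assms
    by (simp add: partial_trace tens_scale_right[OF Id_in_Hom assms(1)] comp_scale_left[OF Q t(1)] comp_scale_right[OF c(1) P])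
qed

primrec full_trace :: "nat \<Rightarrow> 'm \<Rightarrow> complex" where
  "full_trace 0 x = scal x"
| "full_trace (Suc n) x = full_trace n (partial_trace (tp Z n) x)"

lemma full_trace_linear:
  assumes "x \<in> Hom (tp Z n) (tp Z n)" "y \<in> Hom (tp Z n) (tp Z n)"
  shows "full_trace n (x + y) = full_trace n x + full_trace n y \<and> full_trace n (k \<star> x) = k * full_trace n x"
  using assms
proof (induction n arbitrary: x y)
  case (Suc n)
  then have xy: "x \<in> Hom (Z \<otimes> tp Z n) (Z \<otimes> tp Z n)"
    "y \<in> Hom (Z \<otimes> tp Z n) (Z \<otimes> tp Z n)" by simp_all
  show ?case using Suc.IH[OF partial_trace_linear(1)[OF xy] partial_trace_linear(1)[OF xy(2,1)]]
    by (simp add: partial_trace_linear(2,3)[OF xy])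
qed (simp add: scal_add scal_scale)

lemma full_trace_sum:
  assumes "finite I" "\<And>i. i \<in> I \<Longrightarrow> x i \<in> Hom (tp Z n) (tp Z n)"
  shows "full_trace n (\<Sum>i\<in>I. k i \<star> x i) = (\<Sum>i\<in>I. k i * full_trace n (x i))"
  using assms
proof (induction I)
  case empty
  have "0 \<in> Hom (tp Z n) (tp Z n)" using subspace_0[OF subspace_Hom] .
  from full_trace_linear[OF this this] show ?case by simp
next
  case (insert i I)
  have "(\<Sum>i\<in>I. k i \<star> x i) \<in> Hom (tp Z n) (tp Z n)"
    using insert.prems by (intro subspace_sum[OF subspace_Hom] in_Hom_scale) auto
  moreover have x: "x i \<in> Hom (tp Z n) (tp Z n)" using insert.prems by simp
  ultimately show ?case using insert full_trace_linear[OF in_Hom_scale[OF x]] full_trace_linear[OF x x] by simp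
qed

context
  fixes f :: 'm
  assumes f_End: "f \<in> Hom Z Z"
begin

definition perm_trace :: "nat \<Rightarrow> (nat \<Rightarrow> nat) \<Rightarrow> (nat \<Rightarrow> nat) \<Rightarrow> complex" where
  "perm_trace n ks \<pi> = full_trace n (mor (tens_arrow Z f n ks ** perm_arrow Z n \<pi>))"

lemmas tens_arrow_simps' [simp] = tens_arrow_simps[OF f_End] pow_arrow_simps[OF f_End] tens_arrow.simps[OF f_End] pow_arrow_0[OF f_End]

lemma mor_pow_arrow [simp]: "mor (pow_arrow Z f k) = mor_pow C Z f k"
  by (simp add: pow_arrow_def[OF f_End])

lemma perm_trace_0: "perm_trace 0 ks \<pi> = 1"
proof -
  have "mor (aI \<one> ** aI \<one>) = 1 \<star> Id \<one>" by (simp only: arrow_comp_id ok_simps src_simps) (simp add: aI_def)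
  then show ?thesis by (simp add: perm_trace_def scal_eq)
qed

lemma arrow_eta: "src X = a \<Longrightarrow> tgt X = c \<Longrightarrow> Arrow a (mor X) c = X" by (cases X) auto

lemma perm_trace_shiftp:
  assumes "\<pi> permutes {..<n}"
  shows "perm_trace (Suc n) ks (shiftp \<pi>) = cat_trace C Z (mor_pow C Z f (ks 0)) * perm_trace n (\<lambda>i. ks (Suc i)) \<pi>"
proof -
  note [simp] = perm_arrow_simps[OF assms, of Z]
  let ?Y = "tens_arrow Z f n (\<lambda>i. ks (Suc i)) ** perm_arrow Z n \<pi>"
  let ?k = "cat_trace C Z (mor_pow C Z f (ks 0))"
  have "tens_arrow Z f (Suc n) ks ** perm_arrow Z (Suc n) (shiftp \<pi>) = pow_arrow Z f (ks 0) <*> ?Y"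
    using interchange[of "pow_arrow Z f (ks 0)" "aI Z" "tens_arrow Z f n (\<lambda>i. ks (Suc i))" "perm_arrow Z n \<pi>"] f_End
    by (simp add: perm_arrow_shiftp[OF assms])
  moreover have "partial_trace_arrow Z b ev coev (tp Z n) (pow_arrow Z f (ks 0) <*> ?Y)
      = Arrow (tp Z n) (?k \<star> mor ?Y) (tp Z n)"
    using f_End trace[OF mor_pow_in_Hom[OF f_End]]
    by (intro partial_trace_arrow_tensor[OF dual]) simp_all
  ultimately have "perm_trace (Suc n) ks (shiftp \<pi>) = full_trace n (?k \<star> mor ?Y)"
    by (simp add: perm_trace_def partial_trace_def arrow_eta)
  also have "\<dots> = ?k * full_trace n (mor ?Y)"
  proof -
    have "ok ?Y" by simp
    then have "mor ?Y \<in> Hom (tp Z n) (tp Z n)" unfolding ok_def by simp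
    then show ?thesis using full_trace_linear by blast
  qed
  finally show ?thesis by (simp add: perm_trace_def)
qed

text \<open>  Write \<open>(0 l+1) = \<beta> (0 1) \<beta>\<close> with \<open>\<beta> = (1 l+1)\<close>. Everything except the crossing \<open>(0 1)\<close> and the power \<open>f ^ ks 0\<close> on the
  first strand acts on the other strands and leaves the partial trace; \<open>f ^ ks 0\<close> slides along the crossing to the
  second strand, and the closed crossing is the identity (\<open>partial_trace_arrow_swap\<close>). The permutations \<open>\<beta>\<close> and \<open>\<pi>\<close> then
  carry \<open>f ^ ks 0\<close> to the position \<open>\<pi> l\<close>.\<close>

lemma perm_trace_merge:
  assumes \<pi>: "\<pi> permutes {..<n}" and l: "l < n"
  shows "perm_trace (Suc n) ks (shiftp \<pi> \<circ> transpose 0 (Suc l))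
    = perm_trace n (\<lambda>i. if i = \<pi> l then ks (Suc i) + ks 0 else ks (Suc i)) \<pi>"
proof -
  obtain m where n: "n = Suc m" using l by (cases n) auto
  let ?V = "tp Z m" and ?F = "tens_arrow Z f" and ?P = "perm_arrow Z"
  have tpn: "tp Z n = Z \<otimes> ?V" by (simp add: n)
  let ?ks = "\<lambda>i. ks (Suc i)"
  define \<beta> where "\<beta> = transpose 0 l"
  have \<beta>: "\<beta> permutes {..<n}" using l unfolding \<beta>_def by (intro permutes_swap_id) auto
  have \<beta>\<beta>: "\<beta> \<circ> \<beta> = id" by (simp add: \<beta>_def)
  have s0: "transpose 0 (Suc 0) permutes {..<Suc n}" using n by (intro adjacent_permutes) simp
  have "transpose 0 (Suc l) = shiftp \<beta> \<circ> (transpose 0 (Suc 0) \<circ> shiftp \<beta>)"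
    by (auto simp: fun_eq_iff \<beta>_def shiftp_transpose transpose_def)
  note [simp] = perm_arrow_simps[OF \<pi>, of Z] perm_arrow_simps[OF \<beta>, of Z]
  have swap: "?P (Suc n) (transpose 0 (Suc 0)) = aS Z Z ?V"
    using perm_arrow_swap[OF permutes_id, of 0 "Suc n" Z] unfolding perm_arrow_id o_id n by (simp add: adj_arrow_0)
  have "?P (Suc n) (shiftp \<pi> \<circ> transpose 0 (Suc l))
      = (aI Z <*> ?P n \<pi>) ** (aI Z <*> ?P n \<beta>) ** aS Z Z ?V ** (aI Z <*> ?P n \<beta>)"
    unfolding \<open>transpose 0 (Suc l) = _\<close> using \<pi> \<beta> s0
    by (simp only: perm_arrow_comp permutes_compose shiftp_permutes perm_arrow_shiftp swap)
  then have "?F (Suc n) ks ** ?P (Suc n) (shiftp \<pi> \<circ> transpose 0 (Suc l))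
      = (pow_arrow Z f (ks 0) <*> ?F n ?ks) ** (aI Z <*> (?P n \<pi> ** ?P n \<beta>)) ** aS Z Z ?V ** (aI Z <*> ?P n \<beta>)"
    using tpn by (simp add: interchange_right)
  also have "\<dots> = (aI Z <*> (?F n ?ks ** ?P n \<pi> ** ?P n \<beta>)) ** ((pow_arrow Z f (ks 0) <*> aI Z <*> aI ?V) ** aS Z Z ?V) ** (aI Z <*> ?P n \<beta>)"
    using tpn reassoc[OF interchange[symmetric], of "pow_arrow Z f (ks 0)" "aI Z" "?F n ?ks" "?P n \<pi> ** ?P n \<beta>" "aS Z Z ?V ** (aI Z <*> ?P n \<beta>)"]
     reassoc[OF interchange[symmetric], of "aI Z" "pow_arrow Z f (ks 0)" "?F n ?ks ** ?P n \<pi> ** ?P n \<beta>" "aI (Z \<otimes> ?V)" "aS Z Z ?V ** (aI Z <*> ?P n \<beta>)"]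
    by simp
  also have "(pow_arrow Z f (ks 0) <*> aI Z <*> aI ?V) ** aS Z Z ?V = aS Z Z ?V ** (aI Z <*> pow_arrow Z f (ks 0) <*> aI ?V)"
    using aS_natural[of "aI Z" "pow_arrow Z f (ks 0)" "aI ?V"] by simp
  also have "(aI Z <*> (?F n ?ks ** ?P n \<pi> ** ?P n \<beta>)) ** (aS Z Z ?V ** (aI Z <*> pow_arrow Z f (ks 0) <*> aI ?V)) ** (aI Z <*> ?P n \<beta>)
     = (aI Z <*> (?F n ?ks ** ?P n \<pi> ** ?P n \<beta>)) ** aS Z Z ?V ** (aI Z <*> ((pow_arrow Z f (ks 0) <*> aI ?V) ** ?P n \<beta>))"
    using tpn by (simp add: interchange_right)
  finally have X: "?F (Suc n) ks ** ?P (Suc n) (shiftp \<pi> \<circ> transpose 0 (Suc l)) = \<dots>" .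
  let ?d = "\<lambda>i. if i = 0 then ks 0 else 0" let ?e = "\<lambda>i. if i = l then ks 0 else 0"
  let ?g = "\<lambda>i. if i = \<pi> l then ks 0 else 0"
  have d: "pow_arrow Z f (ks 0) <*> aI ?V = ?F n ?d" using n by (simp add: tens_arrow_0[OF f_End])
  have pt: "partial_trace_arrow Z b ev coev (tp Z n) (?F (Suc n) ks ** ?P (Suc n) (shiftp \<pi> \<circ> transpose 0 (Suc l)))
     = (?F n ?ks ** ?P n \<pi> ** ?P n \<beta>) ** partial_trace_arrow Z b ev coev (tp Z n) (aS Z Z ?V) ** (?F n ?d ** ?P n \<beta>)"
    unfolding X d using tpn by (intro partial_trace_arrow_bimodule[OF dual]) simp_all
  also have "\<dots> = ?F n ?ks ** ?P n \<pi> ** (?P n \<beta> ** ?F n ?d) ** ?P n \<beta>"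
    using partial_trace_arrow_swap[OF dual, of ?V] tpn by simp
  also have "?P n \<beta> ** ?F n ?d = ?F n ?e ** ?P n \<beta>"
  proof -
    have "?d = (\<lambda>i. ?e (\<beta> i))" by (auto simp: fun_eq_iff \<beta>_def transpose_def)
    then show ?thesis using perm_arrow_tens_arrow[OF f_End \<beta>, of ?e] by simp
  qed
  also have "?F n ?ks ** ?P n \<pi> ** (?F n ?e ** ?P n \<beta>) ** ?P n \<beta> = ?F n ?ks ** (?P n \<pi> ** ?F n ?e) ** (?P n \<beta> ** ?P n \<beta>)"
    by simp
  also have "?P n \<beta> ** ?P n \<beta> = aI (tp Z n)"
    using perm_arrow_comp[OF \<beta> \<beta>, of Z] by (simp only: \<beta>\<beta> perm_arrow_id)
  also have "?P n \<pi> ** ?F n ?e = ?F n ?g ** ?P n \<pi>"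
  proof -
    have "?e = (\<lambda>i. ?g (\<pi> i))" using permutes_inj[OF \<pi>] by (auto simp: fun_eq_iff inj_eq)
    then show ?thesis using perm_arrow_tens_arrow[OF f_End \<pi>, of ?g] by simp
  qed
  also have "?F n ?ks ** (?F n ?g ** ?P n \<pi>) ** aI (tp Z n) = (?F n ?ks ** ?F n ?g) ** ?P n \<pi>"
    by simp
  also have "?F n ?ks ** ?F n ?g = ?F n (\<lambda>i. if i = \<pi> l then ks (Suc i) + ks 0 else ks (Suc i))"
    unfolding tens_arrow_add[OF f_End] by (rule arg_cong[of _ _ "?F n"]) auto
  finally have "partial_trace_arrow Z b ev coev (tp Z n) (?F (Suc n) ks ** ?P (Suc n) (shiftp \<pi> \<circ> transpose 0 (Suc l)))
     = ?F n (\<lambda>i. if i = \<pi> l then ks (Suc i) + ks 0 else ks (Suc i)) ** ?P n \<pi>" .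
  moreover have "src (?F (Suc n) ks ** ?P (Suc n) (shiftp \<pi> \<circ> transpose 0 (Suc l))) = Z \<otimes> tp Z n"
    "tgt (?F (Suc n) ks ** ?P (Suc n) (shiftp \<pi> \<circ> transpose 0 (Suc l))) = Z \<otimes> tp Z n"
    unfolding X using tpn by simp_all
  ultimately show ?thesis by (simp only: perm_trace_def full_trace.simps partial_trace_def arrow_eta)
qed

lemma cycle_trace_perm_trace: "cycle_trace (\<lambda>k. cat_trace C Z (mor_pow C Z f k)) perm_trace"
  by (simp add: cycle_trace_def perm_trace_0 perm_trace_shiftp perm_trace_merge)

end
end
end

section \<open>The square dies\<close>

context linear_symmetric_category
begin

lemma comp_zero_left: "f \<in> Hom a b \<Longrightarrow> 0 \<cdot> f = 0"
  using comp_scale_left[of f a b 0 b 0] subspace_0[OF subspace_Hom] by simp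

lemma comp_zero_right: "g \<in> Hom b c \<Longrightarrow> g \<cdot> 0 = 0"
  using comp_scale_right[of 0 b b g c 0] subspace_0[OF subspace_Hom] by simp

lemma comp_sum_left:
  assumes "f \<in> Hom a b" "\<And>i. i \<in> I \<Longrightarrow> g i \<in> Hom b c"
  shows "(\<Sum>i\<in>I. g i) \<cdot> f = (\<Sum>i\<in>I. g i \<cdot> f)"
  using assms(2)
proof (induction I rule: infinite_finite_induct)
  case (insert i I)
  then show ?case using comp_add_left[OF assms(1), of "g i" c "\<Sum>i\<in>I. g i"] in_Hom_sum[of I g b c] by simp
qed (simp_all add: comp_zero_left[OF assms(1)])

lemma comp_sum_right:
  assumes "g \<in> Hom b c" "\<And>i. i \<in> I \<Longrightarrow> f i \<in> Hom a b"
  shows "g \<cdot> (\<Sum>i\<in>I. f i) = (\<Sum>i\<in>I. g \<cdot> f i)"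
  using assms(2)
proof (induction I rule: infinite_finite_induct)
  case (insert i I)
  then show ?case using comp_add_right[of "f i" a b "\<Sum>i\<in>I. f i" g c] in_Hom_sum[of I f a b] assms(1) by simp
qed (simp_all add: comp_zero_right[OF assms(1)])

lemma perm_mor_Hom: "\<pi> \<in> sym_grp n \<Longrightarrow> perm_mor C Z n \<pi> \<in> Hom (tp Z n) (tp Z n)"
  by (simp add: perm_mor_in_Hom sym_grp_iff)

lemma Phi_in_Hom: "Phi C Z n x \<in> Hom (tp Z n) (tp Z n)"
  unfolding Phi_def by (intro in_Hom_sum in_Hom_scale perm_mor_Hom)

lemma Phi_add: "Phi C Z n (x + y) = Phi C Z n x + Phi C Z n y"
  by (simp add: Phi_def plus_fun_def scale_left_distrib sum.distrib)

lemma Phi_scale: "Phi C Z n (fun_scale k x) = k \<star> Phi C Z n x"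
  by (simp add: Phi_def fun_scale_def scale_sum_right)

lemma Phi_zero: "Phi C Z n 0 = 0"
  by (simp add: Phi_def zero_fun_def)

lemma Phi_sum: "Phi C Z n (\<Sum>i\<in>I. x i) = (\<Sum>i\<in>I. Phi C Z n (x i))"
  by (induction I rule: infinite_finite_induct)
    (simp_all only: sum.infinite sum.empty sum.insert Phi_zero Phi_add not_False_eq_True)

lemma Phi_mult: "Phi C Z n (ga_mult n x y) = Phi C Z n x \<cdot> Phi C Z n y"
proof -
  let ?P = "perm_mor C Z n"
  have "Phi C Z n (ga_mult n x y) = (\<Sum>\<pi>\<in>sym_grp n. \<Sum>\<sigma>\<in>sym_grp n. (x \<sigma> * y (inv \<sigma> \<circ> \<pi>)) \<star> ?P \<pi>)"
    by (simp add: Phi_def ga_mult_def scale_sum_left)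
  also have "\<dots> = (\<Sum>\<sigma>\<in>sym_grp n. \<Sum>\<pi>\<in>sym_grp n. (x \<sigma> * y (inv \<sigma> \<circ> \<pi>)) \<star> ?P \<pi>)"
    by (rule sum.swap)
  also have "\<dots> = (\<Sum>\<sigma>\<in>sym_grp n. \<Sum>\<pi>\<in>sym_grp n. (x \<sigma> * y (inv \<sigma> \<circ> (\<sigma> \<circ> \<pi>))) \<star> ?P (\<sigma> \<circ> \<pi>))"
    by (intro sum.cong[OF refl] sum_sym_grp_left[symmetric])
  also have "\<dots> = (\<Sum>\<sigma>\<in>sym_grp n. (x \<sigma> \<star> ?P \<sigma>) \<cdot> Phi C Z n y)"
  proof (rule sum.cong[OF refl])
    fix \<sigma> assume \<sigma>: "\<sigma> \<in> sym_grp n"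
    note P\<sigma> = perm_mor_Hom[OF \<sigma>, of Z]
    have "(x \<sigma> \<star> ?P \<sigma>) \<cdot> Phi C Z n y = (\<Sum>\<pi>\<in>sym_grp n. (x \<sigma> \<star> ?P \<sigma>) \<cdot> (y \<pi> \<star> ?P \<pi>))"
      unfolding Phi_def by (intro comp_sum_right[OF in_Hom_scale[OF P\<sigma>], where a = "tp Z n"] in_Hom_scale perm_mor_Hom)
    also have "\<dots> = (\<Sum>\<pi>\<in>sym_grp n. (x \<sigma> * y (inv \<sigma> \<circ> (\<sigma> \<circ> \<pi>))) \<star> ?P (\<sigma> \<circ> \<pi>))"
    proof (rule sum.cong[OF refl])
      fix \<pi> assume \<pi>: "\<pi> \<in> sym_grp n"
      note P\<pi> = perm_mor_Hom[OF \<pi>, of Z]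
      have "?P (\<sigma> \<circ> \<pi>) = ?P \<sigma> \<cdot> ?P \<pi>" using \<sigma> \<pi> by (simp add: perm_mor_comp sym_grp_iff)
      moreover have "(x \<sigma> \<star> ?P \<sigma>) \<cdot> (y \<pi> \<star> ?P \<pi>) = (x \<sigma> * y \<pi>) \<star> (?P \<sigma> \<cdot> ?P \<pi>)"
        using comp_scale_left[OF in_Hom_scale[OF P\<pi>] P\<sigma>] comp_scale_right[OF P\<pi> P\<sigma>] by simp
      ultimately show "(x \<sigma> \<star> ?P \<sigma>) \<cdot> (y \<pi> \<star> ?P \<pi>) = (x \<sigma> * y (inv \<sigma> \<circ> (\<sigma> \<circ> \<pi>))) \<star> ?P (\<sigma> \<circ> \<pi>)"
        by (simp only: sym_grp_inverse(5)[OF \<sigma>])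
    qed
    finally show "(\<Sum>\<pi>\<in>sym_grp n. (x \<sigma> * y (inv \<sigma> \<circ> (\<sigma> \<circ> \<pi>))) \<star> ?P (\<sigma> \<circ> \<pi>)) = (x \<sigma> \<star> ?P \<sigma>) \<cdot> Phi C Z n y" by simp
  qed
  also have "\<dots> = Phi C Z n x \<cdot> Phi C Z n y"
    unfolding Phi_def[of C Z n x] by (intro comp_sum_left[OF Phi_in_Hom, where c = "tp Z n", symmetric] in_Hom_scale perm_mor_Hom)
  finally show ?thesis .
qed

context
  fixes n row col
  assumes yp: "young_pair n row col"
begin

interpretation young_pair n row col by (rule yp)

lemma Phi_conj_sum_zero:
  assumes "Phi C Z n yc = 0" shows "Phi C Z n (conj_sum (ga_star n yc)) = 0"
proof -
  note z = comp_zero_left[OF Phi_in_Hom] comp_zero_right[OF Phi_in_Hom]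
  have "Phi C Z n (ga_star n yc) = 0"
    by (simp add: star_yc_factor Phi_scale Phi_mult assms z)
  then show ?thesis by (simp add: conj_sum_def Phi_sum Phi_mult z)
qed

text \<open>  The kernel of \<open>\<Phi>\<close> is a two-sided ideal, and the block is simple.\<close>

lemma Phi_inj_block:
  assumes "Phi C Z n yc \<noteq> 0" "u \<in> block" "Phi C Z n u = 0" shows "u = 0"
proof (rule ccontr)
  note z = comp_zero_left[OF Phi_in_Hom] comp_zero_right[OF Phi_in_Hom]
  assume "u \<noteq> 0"
  with assms(2) obtain w \<tau> k where k: "k \<noteq> 0" "ga_mult n yc (ga_mult n w (ga_mult n u (ga_mult n (ga_single \<tau>) yc))) = fun_scale k yc"
    by (rule block_simple)
  define v where "v = ga_mult n (ga_single \<tau>) yc"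
  have "k \<star> Phi C Z n yc = 0"
    unfolding Phi_scale[symmetric] k(2)[symmetric] v_def[symmetric] by (simp add: Phi_mult assms(3) z)
  then show False using k(1) assms(1) by simp
qed

lemma dim_block_le:
  assumes ne: "Phi C Z n yc \<noteq> 0" and fin: "finite_dim (Hom (tp Z n) (tp Z n))"
  shows "fun_vs.dim block \<le> dim (Hom (tp Z n) (tp Z n))"
proof -
  let ?H = "Hom (tp Z n) (tp Z n)"
  interpret vp: vector_space_pair "fun_scale :: complex \<Rightarrow> ((nat \<Rightarrow> nat) \<Rightarrow> complex) \<Rightarrow> _" "scl C" ..
  have lin: "Vector_Spaces.linear fun_scale (scl C) (Phi C Z n)"
    unfolding Vector_Spaces.linear_iff using fun_vs.vector_space_axioms vector_space_axioms
    by (simp add: Phi_add Phi_scale)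
  obtain B where B: "B \<subseteq> block" "fun_vs.independent B" "block \<subseteq> fun_vs.span B" "card B = fun_vs.dim block"
    by (rule fun_vs.basis_exists)
  have sp: "fun_vs.span B \<subseteq> block" using B(1) subspace_block by (rule fun_vs.span_minimal)
  have inj: "inj_on (Phi C Z n) (fun_vs.span B)"
    unfolding vp.linear_inj_on_iff_eq_0[OF lin fun_vs.subspace_span] using sp Phi_inj_block[OF ne] by blast
  have ind: "independent (Phi C Z n ` B)" by (rule vp.linear_independent_injective_image[OF lin B(2) inj])
  obtain B' where B': "B' \<subseteq> ?H" "independent B'" "?H \<subseteq> span B'" "card B' = dim ?H"
    by (rule basis_exists)
  obtain F where "finite F" "?H \<subseteq> span F" using fin unfolding finite_dim_def by blast
  then have "finite B'" using independent_span_bound[of F B'] B' by blast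
  moreover have "Phi C Z n ` B \<subseteq> span B'" using B'(3) Phi_in_Hom by blast
  ultimately have "card (Phi C Z n ` B) \<le> card B'" using independent_span_bound[of B' "Phi C Z n ` B"] ind by blast
  moreover have "card (Phi C Z n ` B) = card B"
    by (rule card_image) (rule inj_on_subset[OF inj fun_vs.span_superset])
  ultimately show ?thesis using B(4) B'(4) by simp
qed

end
end

lemma cell_replicate: "k < m * s \<Longrightarrow> cell (replicate m s) k = (k div s, k mod s)"
proof (induction m arbitrary: k)
  case (Suc m)
  show ?case
  proof (cases "k < s")
    case False
    then have "k - s < m * s" using Suc.prems by simp
    moreover have "s > 0" using Suc.prems by (cases s) auto
    ultimately show ?thesis using False Suc.IH[of "k - s"] by (simp add: le_div_geq le_mod_geq)
  qed simp
qed simp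

lemma fib_grp_bounded: "fib_grp n f = {\<pi> \<in> sym_grp n. \<forall>k<n. f (\<pi> k) = f k}"
proof -
  have "f (\<pi> k) = f k" if "\<pi> permutes {..<n}" "\<forall>k<n. f (\<pi> k) = f k" for \<pi> k
    using that permutes_not_in[OF that(1), of k] by (cases "k < n") auto
  then show ?thesis by (auto simp: fib_grp_def sym_grp_iff)
qed

lemma sum_list_square [simp]: "sum_list (replicate s s) = s * s"
  by (simp add: sum_list_replicate)

lemma square_groups: "row_grp (replicate s s) = fib_grp (s * s) (srow s)" "col_grp (replicate s s) = fib_grp (s * s) (scol s)"
proof -
  have *: "\<pi> k < s * s" if "\<pi> \<in> sym_grp (s * s)" "k < s * s" for \<pi> k
    using permutes_in_image[OF that(1)[unfolded sym_grp_iff], of k] that(2) by simp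
  show "row_grp (replicate s s) = fib_grp (s * s) (srow s)" "col_grp (replicate s s) = fib_grp (s * s) (scol s)"
    unfolding row_grp_def col_grp_def fib_grp_bounded sum_list_square
    by (auto simp: * cell_replicate srow_def scol_def)
qed

text \<open>One term of the exponential series at \<open>n\<close> is \<open>n ^ n / n!\<close>.\<close>

lemma fact_lower_bound: "(real n / exp 1) ^ n \<le> fact n"
proof -
  have "real n ^ n / fact n \<le> exp (real n)"
    using sum_le_suminf[OF sums_summable[OF exp_converges[of "real n"]], of "{n}"] sums_unique[OF exp_converges[of "real n"]]
    by (simp add: divide_inverse mult.commute)
  then show ?thesis using exp_of_nat_mult[of n "1 :: real"] by (simp add: power_divide field_simps)
qed

context linear_symmetric_category
begin

text \<open>  Otherwise \<open>(n! / N)\<^sup>2 \<le> A ^ n\<close> for \<open>n = s\<^sup>2\<close>. But \<open>n! / N \<ge> (n / e) ^ n / (2 s) ^ n = (s / (2 e)) ^ n > (\<surd>A) ^ n\<close>.\<close>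

lemma square_dies_core:
  fixes A :: real and Z s
  assumes "A \<ge> 1" "finite_dim (Hom (tp Z (s * s)) (tp Z (s * s)))"
    and bound: "real (dim (Hom (tp Z (s * s)) (tp Z (s * s)))) \<le> A ^ (s * s)"
    and s: "real s > 2 * exp 1 * sqrt A"
  shows "Phi C Z (s * s) (young_pair.yc (s * s) (srow s) (scol s)) = 0"
proof (rule ccontr)
  interpret young_pair "s * s" "srow s" "scol s" by (rule square_young_pair)
  let ?n = "s * s"
  assume "Phi C Z (s * s) yc \<noteq> 0"
  then have "fun_vs.dim block \<le> dim (Hom (tp Z ?n) (tp Z ?n))"
    using assms(2) by (rule dim_block_le[OF square_young_pair])
  then have dim: "real (fun_vs.dim block) \<le> A ^ ?n" using bound by simp
  obtain x where x: "yc_scalar = of_real x" "0 < x" "x \<le> (2 * real s) ^ ?n" by (rule square_yc_scalar_bound)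
  have "of_real (real (fun_vs.dim block)) = (of_real ((fact ?n / x) ^ 2) :: complex)"
    using dim_block x(1) by simp
  then have d: "real (fun_vs.dim block) = (fact ?n / x) ^ 2" by (simp only: of_real_eq_iff)
  have "sqrt A > 0" using assms(1) by simp
  then have spos: "real s > 0" using s by (smt (verit) exp_gt_zero mult_pos_pos)
  have "(sqrt A) ^ ?n < (real s / (2 * exp 1)) ^ ?n"
    using s spos assms(1) by (intro power_strict_mono) (auto simp: field_simps)
  also have "\<dots> = (real ?n / exp 1) ^ ?n / (2 * real s) ^ ?n"
    using spos by (simp add: power_divide[symmetric] field_simps)
  also have "\<dots> \<le> fact ?n / x"
    using x by (intro frac_le fact_lower_bound) auto
  finally have "((sqrt A) ^ ?n) ^ 2 < (fact ?n / x) ^ 2"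
    using assms(1) by (intro power_strict_mono) auto
  moreover have "((sqrt A) ^ m) ^ 2 = A ^ m" for m :: nat
    using assms(1) by (induction m) (simp_all add: power_mult_distrib)
  ultimately have "A ^ ?n < (fact ?n / x) ^ 2" by (simp only:)
  then show False using d dim by linarith
qed

lemma square_dies:
  assumes "Phi C Z (s * s) (young_pair.yc (s * s) (srow s) (scol s)) = 0" "s > 0"
  shows "dies C Z (replicate s s)"
proof -
  interpret young_pair "s * s" "srow s" "scol s" by (rule square_young_pair)
  have ys: "young_symmetrizer (replicate s s) = yc"
    unfolding young_symmetrizer_def square_groups sum_list_square yc_def row_sum_def col_sum_def ..
  have char: "irr_char (replicate s s) \<pi> = conj_sum (ga_star (s * s) yc) \<pi> / yc_scalar" if "\<pi> \<in> sym_grp (s * s)" for \<pi>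
    unfolding irr_char_def specht_def ys sum_list_square by (rule left_ideal_char[OF that])
  have "(\<Sum>\<pi>\<in>sym_grp (s * s). fun_scale (irr_char (replicate s s) \<pi>) (ga_single \<pi>))
     = fun_scale (1 / yc_scalar) (\<Sum>\<pi>\<in>sym_grp (s * s). fun_scale (conj_sum (ga_star (s * s) yc) \<pi>) (ga_single \<pi>))"
    by (simp add: char fun_vs.scale_sum_right fun_vs.scale_scale cong: sum.cong)
  also have "(\<Sum>\<pi>\<in>sym_grp (s * s). fun_scale (conj_sum (ga_star (s * s) yc) \<pi>) (ga_single \<pi>)) = conj_sum (ga_star (s * s) yc)"
    by (rule grp_alg_expand[OF conj_sum_in, symmetric])
  finally have "Phi C Z (s * s) (central_idem (replicate s s)) = 0"
    unfolding central_idem_def sum_list_square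
    by (simp add: Phi_scale Phi_conj_sum_zero[OF square_young_pair assms(1)])
  moreover have "is_partition (replicate s s)"
    using assms(2) by (auto simp: is_partition_def sorted_wrt_iff_nth_less)
  ultimately show ?thesis by (simp add: dies_def)
qed

end

context rigid_symmetric_linear_category
begin

text \<open>  The full trace of \<open>f \<otimes> \<dots> \<otimes> f\<close> composed with \<open>\<Phi> c = 0\<close>, expanded over the permutations.\<close>

lemma young_trace_zero:
  assumes yp: "young_pair n row col" and zero: "Phi C Z n (young_pair.yc n row col) = 0" and f: "f \<in> Hom Z Z"
  obtains \<psi> where "cycle_trace (\<lambda>k. cat_trace C Z (mor_pow C Z f k)) \<psi>"
    "young_sum n row col (\<psi> n (\<lambda>_. 1)) = 0"
proof -
  interpret young_pair n row col by (rule yp)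
  obtain b ev coev where dual: "is_dual C Z b ev coev"
    and tr: "\<And>g. g \<in> Hom Z Z \<Longrightarrow> cat_trace C Z g \<star> Id \<one> = ev \<cdot> \<c> Z b \<cdot> (g \<boxtimes> Id b) \<cdot> coev"
    by (rule cat_trace_dual[of Z]) blast
  define ks :: "nat \<Rightarrow> nat" where "ks = (\<lambda>_. 1)"
  let ?\<psi> = "perm_trace Z b ev coev f"
  let ?H = "Hom (tp Z n) (tp Z n)"
  let ?F = "mor (tens_arrow Z f n ks)"
  have F: "?F \<in> ?H" using tens_arrow_simps[OF f, of n ks] by (simp add: ok_def)
  have "(\<Sum>\<pi>\<in>sym_grp n. yc \<pi> * ?\<psi> n ks \<pi>) = (\<Sum>\<pi>\<in>sym_grp n. yc \<pi> * full_trace Z b ev coev n (?F \<cdot> perm_mor C Z n \<pi>))"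
    by (intro sum.cong refl) (simp add: perm_trace_def[OF dual tr f] perm_arrow_perm_mor sym_grp_iff arrow_comp_def)
  also have "\<dots> = full_trace Z b ev coev n (\<Sum>\<pi>\<in>sym_grp n. yc \<pi> \<star> (?F \<cdot> perm_mor C Z n \<pi>))"
    by (rule full_trace_sum[OF dual tr, symmetric]) (auto intro: comp_in_Hom[OF perm_mor_Hom F])
  also have "(\<Sum>\<pi>\<in>sym_grp n. yc \<pi> \<star> (?F \<cdot> perm_mor C Z n \<pi>)) = ?F \<cdot> Phi C Z n yc"
    unfolding Phi_def by (subst comp_sum_right[OF F, where a = "tp Z n"])
      (auto intro!: in_Hom_scale perm_mor_Hom sum.cong simp: comp_scale_right[OF perm_mor_Hom F])
  also have "\<dots> = 0 \<star> ?F" by (simp add: zero comp_zero_right[OF F])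
  also have "full_trace Z b ev coev n \<dots> = 0" using full_trace_linear[OF dual tr F F, of 0] by simp
  finally have "young_sum n row col (?\<psi> n (\<lambda>_. 1)) = 0" by (simp only: yc_sum ks_def)
  then show thesis using cycle_trace_perm_trace[OF dual tr f] by (rule that[rotated])
qed

end

section \<open>Traces of polynomials in an endomorphism\<close>

text \<open>  The condition that \<open>\<Phi> c = 0\<close> imposes on the traces \<open>\<tau> k\<close> of the powers of an endomorphism.\<close>

definition square_zero :: "nat \<Rightarrow> (nat \<Rightarrow> complex) \<Rightarrow> bool" where
  "square_zero s \<tau> \<longleftrightarrow> (\<exists>\<psi>. cycle_trace \<tau> \<psi> \<and> young_sum (s * s) (srow s) (scol s) (\<psi> (s * s) (\<lambda>_. 1)) = 0)"

lemma square_zero_nilpotent: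
  assumes "square_zero s \<tau>" "\<And>k. k \<ge> 2 \<Longrightarrow> \<tau> k = 0"
  shows "\<tau> 1 = 0"
proof -
  interpret young_pair "s * s" "srow s" "scol s" by (rule square_young_pair)
  obtain \<psi> where \<psi>: "cycle_trace \<tau> \<psi>" and sum: "(\<Sum>p\<in>R. \<Sum>q\<in>L. of_int (sign q) * \<psi> (s * s) (\<lambda>_. 1) (p \<circ> q)) = 0"
    using assms(1) unfolding square_zero_def young_sum_def by blast
  have "of_int (sign q) * \<psi> (s * s) (\<lambda>_. 1) (p \<circ> q) = (if p = id then if q = id then \<tau> 1 ^ (s * s) else 0 else 0)"
    if "p \<in> R" "q \<in> L" for p q
  proof -
    have "p \<circ> q permutes {..<s * s}" using that by (intro permutes_compose) (auto dest: fib_grpD(1))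
    moreover have "p \<circ> q = id \<longleftrightarrow> p = id \<and> q = id"
    proof
      assume "p \<circ> q = id"
      then have "p \<in> L" using comp_fib_grp(2)[OF that(2), of p] id_fib_grp by simp
      then show "p = id \<and> q = id" using R_L_id[OF that(1)] \<open>p \<circ> q = id\<close> by simp
    qed simp
    ultimately show ?thesis using cycle_trace_nilpotent[OF \<psi> assms(2), of "p \<circ> q" "s * s" "\<lambda>_. 1"] by simp
  qed
  then have "(\<Sum>p\<in>R. \<Sum>q\<in>L. of_int (sign q) * \<psi> (s * s) (\<lambda>_. 1) (p \<circ> q)) = (\<Sum>p\<in>R. \<Sum>q\<in>L. if p = id then if q = id then \<tau> 1 ^ (s * s) else 0 else 0)"
    by (intro sum.cong refl)
  also have "\<dots> = (\<Sum>p\<in>R. if p = id then \<tau> 1 ^ (s * s) else 0)"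
    by (intro sum.cong refl) simp
  also have "\<dots> = \<tau> 1 ^ (s * s)" by simp
  finally have "\<tau> 1 ^ (s * s) = 0" using sum by simp
  then show ?thesis by simp
qed

lemma square_zero_idempotent:
  assumes "square_zero s \<tau>" "\<And>k. k \<ge> 1 \<Longrightarrow> \<tau> k = t"
  obtains i :: int where "t = of_int i" "\<bar>i\<bar> < int s"
proof -
  obtain \<psi> where \<psi>: "cycle_trace \<tau> \<psi>" and sum: "young_sum (s * s) (srow s) (scol s) (\<psi> (s * s) (\<lambda>_. 1)) = 0"
    using assms(1) unfolding square_zero_def by blast
  obtain a b where ab: "\<And>d. d < s * s \<Longrightarrow> a d < s" "\<And>d. d < s * s \<Longrightarrow> b d < s"
    and content: "\<And>\<tau> \<psi> t. \<lbrakk>cycle_trace \<tau> \<psi>; \<And>k. k \<ge> 1 \<Longrightarrow> \<tau> k = t\<rbrakk>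
      \<Longrightarrow> young_sum (s * s) (srow s) (scol s) (\<psi> (s * s) (\<lambda>_. 1)) = (\<Prod>d<s * s. t + of_nat (a d) - of_nat (b d))"
    using square_content[of s] by blast
  have "(\<Prod>d<s * s. t + of_nat (a d) - of_nat (b d)) = 0"
    using content[OF \<psi> assms(2)] sum by simp
  then obtain d where d: "d < s * s" "t + of_nat (a d) - of_nat (b d) = 0" by auto
  show thesis
  proof (rule that[of "int (b d) - int (a d)"])
    show "t = of_int (int (b d) - int (a d))" using d(2) by (simp add: algebra_simps add_eq_0_iff2 eq_neg_iff_add_eq_0)
    show "\<bar>int (b d) - int (a d)\<bar> < int s" using ab[OF d(1)] by linarith
  qed
qed

text \<open>  \<open>L\<close> is the functional \<open>p \<mapsto> tr (p(g))\<close> for an endomorphism \<open>g\<close> with \<open>f0(g) = 0\<close>. If \<open>q\<close> vanishes on the roots of \<open>f0\<close>, then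
  \<open>q(g)\<close> is nilpotent; were \<open>L q \<noteq> 0\<close>, the highest power \<open>q ^ j\<close> with \<open>L (q ^ j) \<noteq> 0\<close> would contradict
  \<open>square_zero_nilpotent\<close>. So \<open>L\<close> depends only on the values at the roots. The Lagrange polynomials \<open>l x\<close> give the
  weights, and a sum of Lagrange polynomials is idempotent on the roots, so \<open>square_zero_idempotent\<close> bounds the partial
  sums of the weights.\<close>

lemma point_functional:
  fixes L :: "complex poly \<Rightarrow> complex"
  assumes add: "\<And>p q. L (p + q) = L p + L q" and smult: "\<And>c p. L (smult c p) = c * L p"
    and f0: "f0 \<noteq> 0" "\<And>q. L (f0 * q) = 0"
    and zero: "\<And>q. square_zero s (\<lambda>k. L (q ^ k))"
  obtains X \<nu> where "finite X" "\<And>q. L q = (\<Sum>x\<in>X. of_int (\<nu> x) * poly q x)"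
    "\<And>S. S \<subseteq> X \<Longrightarrow> \<bar>\<Sum>x\<in>S. \<nu> x\<bar> < int s"
proof -
  define X where "X = {x. poly f0 x = 0}"
  have X: "finite X" unfolding X_def by (rule poly_roots_finite[OF f0(1)])
  have L0: "L 0 = 0" using smult[of 0 0] by simp
  have Lsum: "L (\<Sum>i\<in>I. f i) = (\<Sum>i\<in>I. L (f i))" for I :: "complex set" and f
    by (induction I rule: infinite_finite_induct) (simp_all add: L0 add)
  have vanish: "L q = 0" if q: "\<And>x. x \<in> X \<Longrightarrow> poly q x = 0" for q
  proof (rule ccontr)
    assume "L q \<noteq> 0"
    have "f0 dvd q ^ degree f0"
      using nullstellensatz_univariate[of f0 q] q f0(1) by (auto simp: X_def)
    then have high: "L (q ^ j) = 0" if "j \<ge> degree f0" for j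
      using that f0(2) by (metis dvdE dvd_trans le_imp_power_dvd)
    define j where "j = (GREATEST j. L (q ^ j) \<noteq> 0)"
    have bound: "\<forall>j. L (q ^ j) \<noteq> 0 \<longrightarrow> j \<le> degree f0" using high by (meson nle_le)
    have 1: "L (q ^ 1) \<noteq> 0" using \<open>L q \<noteq> 0\<close> by simp
    have j: "L (q ^ j) \<noteq> 0" unfolding j_def
      by (rule GreatestI_nat[where P = "\<lambda>j. L (q ^ j) \<noteq> 0" and k = 1]) (use 1 bound in auto)
    have "1 \<le> j" unfolding j_def
      by (rule Greatest_le_nat[where P = "\<lambda>j. L (q ^ j) \<noteq> 0"]) (use 1 bound in auto)
    have "L ((q ^ j) ^ k) = 0" if "k \<ge> 2" for k
    proof (rule ccontr)
      assume "L ((q ^ j) ^ k) \<noteq> 0"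
      then have "j * k \<le> j" using Greatest_le_nat[where P = "\<lambda>j. L (q ^ j) \<noteq> 0" and k = "j * k" and b = "degree f0"] bound
        by (simp add: j_def[symmetric] power_mult)
      then show False using \<open>1 \<le> j\<close> that by simp
    qed
    then have "L ((q ^ j) ^ 1) = 0" by (rule square_zero_nilpotent[OF zero])
    then show False using j by simp
  qed
  define l where "l = (\<lambda>x. \<Prod>y\<in>X - {x}. smult (1 / (x - y)) [:- y, 1:])"
  have l: "poly (l x) z = (if z = x then 1 else 0)" if "x \<in> X" "z \<in> X" for x z
  proof (cases "z = x")
    case True
    then show ?thesis by (auto simp: l_def poly_prod diff_divide_distrib[symmetric] intro!: prod.neutral split: if_splits)
  next
    case False
    then have "\<exists>y\<in>X - {x}. poly (smult (1 / (x - y)) [:- y, 1:]) z = 0" using that by (intro bexI[of _ z]) auto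
    then show ?thesis using False X unfolding l_def poly_prod by (simp add: prod_zero)
  qed
  have rep: "L q = (\<Sum>x\<in>X. L (l x) * poly q x)" for q
  proof -
    define r where "r = (\<Sum>x\<in>X. smult (poly q x) (l x))"
    have "poly r z = poly q z" if "z \<in> X" for z
      using that X by (simp add: r_def poly_sum l if_distrib[where f = "\<lambda>c. _ * c"] cong: if_cong)
    then have "L (q + smult (-1) r) = 0" by (intro vanish) simp
    then have "L q = L r" unfolding add smult by simp
    also have "\<dots> = (\<Sum>x\<in>X. L (l x) * poly q x)" unfolding r_def Lsum smult by (simp add: mult.commute)
    finally show ?thesis .
  qed
  have ints: "\<exists>i :: int. (\<Sum>x\<in>S. L (l x)) = of_int i \<and> \<bar>i\<bar> < int s" if S: "S \<subseteq> X" for S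
  proof -
    define q where "q = (\<Sum>x\<in>S. l x)"
    have fS: "finite S" using S X by (rule finite_subset)
    have q: "poly q z = (if z \<in> S then 1 else 0)" if z: "z \<in> X" for z
    proof -
      have "poly q z = (\<Sum>x\<in>S. if z = x then 1 else 0)"
        unfolding q_def poly_sum by (intro sum.cong refl l) (use S z in auto)
      then show ?thesis using fS by simp
    qed
    have "L (q ^ k) = (\<Sum>x\<in>S. L (l x))" if "k \<ge> 1" for k
    proof -
      have "L (q ^ k) = (\<Sum>x\<in>X. if x \<in> S then L (l x) else 0)"
        unfolding rep[of "q ^ k"] using that by (intro sum.cong refl) (simp add: poly_power q)
      also have "\<dots> = (\<Sum>x\<in>S. L (l x))" by (rule sum.mono_neutral_cong_right) (use S X in auto)
      finally show ?thesis .
    qed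
    from square_zero_idempotent[OF zero this] show ?thesis by blast
  qed
  have "\<exists>\<nu> :: complex \<Rightarrow> int. \<forall>x\<in>X. L (l x) = of_int (\<nu> x)"
    using ints[of "{_}"] by (intro bchoice) (metis empty_subsetI finite.emptyI insert_subset sum.empty sum.insert add_0_right empty_iff finite.insertI)
  then obtain \<nu> :: "complex \<Rightarrow> int" where \<nu>: "\<And>x. x \<in> X \<Longrightarrow> L (l x) = of_int (\<nu> x)" by blast
  show thesis
  proof (rule that[OF X])
    show "L q = (\<Sum>x\<in>X. of_int (\<nu> x) * poly q x)" for q unfolding rep[of q] by (intro sum.cong refl) (simp add: \<nu>)
    fix S assume S: "S \<subseteq> X"
    obtain i where i: "(\<Sum>x\<in>S. L (l x)) = of_int i" "\<bar>i\<bar> < int s" using ints[OF S] by blast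
    have "(\<Sum>x\<in>S. L (l x)) = of_int (\<Sum>x\<in>S. \<nu> x)" using S by (auto simp: \<nu> intro!: sum.cong)
    then have "(\<Sum>x\<in>S. \<nu> x) = i" using i(1) by (simp only: of_int_eq_iff)
    then show "\<bar>\<Sum>x\<in>S. \<nu> x\<bar> < int s" using i(2) by simp
  qed
qed

section \<open>Rationality of the zeta function\<close>

definition log_deriv :: "complex fps \<Rightarrow> complex fps" where
  "log_deriv F = fps_deriv F * inverse F"

lemma log_deriv_mult:
  assumes "fps_nth F 0 \<noteq> 0" "fps_nth G 0 \<noteq> 0"
  shows "log_deriv (F * G) = log_deriv F + log_deriv G"
proof -
  have "F * inverse F = 1" "G * inverse G = 1" using assms by (simp_all add: inverse_mult_eq_1')
  moreover have "log_deriv (F * G) = fps_deriv F * inverse F * (G * inverse G) + fps_deriv G * inverse G * (F * inverse F)"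
    by (simp add: log_deriv_def fps_inverse_mult algebra_simps)
  ultimately show ?thesis by (simp add: log_deriv_def)
qed

lemma log_deriv_power: "fps_nth F 0 \<noteq> 0 \<Longrightarrow> log_deriv (F ^ k) = of_nat k * log_deriv F"
  by (induction k) (simp_all add: log_deriv_mult fps_nth_power_0 distrib_right log_deriv_def[of 1])

lemma log_deriv_prod:
  "(\<And>i. i \<in> I \<Longrightarrow> fps_nth (F i) 0 \<noteq> 0) \<Longrightarrow> log_deriv (\<Prod>i\<in>I. F i) = (\<Sum>i\<in>I. log_deriv (F i))"
proof (induction I rule: infinite_finite_induct)
  case (insert i I)
  moreover have "fps_nth (\<Prod>i\<in>I. F i) 0 = (\<Prod>i\<in>I. fps_nth (F i) 0)"
    by (induction I rule: infinite_finite_induct) simp_all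
  ultimately have "fps_nth (\<Prod>i\<in>I. F i) 0 \<noteq> 0" by simp
  then show ?case using insert by (simp add: log_deriv_mult)
qed (simp_all add: log_deriv_def)

text \<open>  Series with constant term \<open>1\<close> are compared through their logarithmic derivatives.\<close>

lemma log_deriv_unique:
  assumes "fps_nth F 0 = 1" "fps_nth G 0 = 1" "log_deriv F = log_deriv G"
  shows "F = G"
proof -
  have iF: "inverse F * F = 1" and iG: "inverse G * G = 1" using assms by (simp_all add: inverse_mult_eq_1)
  have "fps_deriv (F * inverse G) = 0"
  proof -
    have "log_deriv (F * inverse G) = log_deriv F + log_deriv (inverse G)" using assms by (intro log_deriv_mult) simp_all
    moreover have "log_deriv (G * inverse G) = log_deriv G + log_deriv (inverse G)" using assms by (intro log_deriv_mult) simp_all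
    moreover have "log_deriv (G * inverse G) = 0" using iG by (simp add: mult.commute log_deriv_def)
    ultimately have "fps_deriv (F * inverse G) * inverse (F * inverse G) = 0" using assms(3) by (simp add: log_deriv_def)
    moreover have "inverse (F * inverse G) \<noteq> 0" using assms by (simp add: fps_inverse_eq_0_iff)
    ultimately show ?thesis by simp
  qed
  then have "F * inverse G = fps_const (fps_nth (F * inverse G) 0)" by (simp only: fps_deriv_eq_0_iff)
  then have "F * inverse G = 1" using assms by simp
  then have "F * (inverse G * G) = G" by (simp flip: mult.assoc)
  then show ?thesis by (simp add: iG)
qed

lemma log_deriv_linear: "log_deriv (fps_of_poly [:1, - x:]) = - Abs_fps (\<lambda>m. x ^ Suc m)"
proof -
  define F where "F = fps_of_poly [:1, - x:]"
  have F: "F = 1 - fps_const x * fps_X" by (simp add: F_def fps_of_poly_pCons) 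
  have "Abs_fps (\<lambda>m. x ^ m) * F = Abs_fps (\<lambda>m. x ^ m) - fps_const x * (fps_X * Abs_fps (\<lambda>m. x ^ m))"
    by (simp add: F algebra_simps)
  also have "\<dots> = 1"
  proof (rule fps_ext)
    fix m show "fps_nth (Abs_fps (\<lambda>m. x ^ m) - fps_const x * (fps_X * Abs_fps (\<lambda>m. x ^ m))) m = fps_nth 1 m"
      by (cases m) (simp_all add: fps_X_mult_nth)
  qed
  finally have "Abs_fps (\<lambda>m. x ^ m) * F = 1" .
  then have "inverse F = Abs_fps (\<lambda>m. x ^ m)"
    using fps_inverse_unique[of F "Abs_fps (\<lambda>m. x ^ m)"] by (simp add: mult.commute)
  moreover have "fps_deriv F = - fps_const x" by (simp add: F)
  ultimately have "log_deriv F = fps_const (- x) * Abs_fps (\<lambda>m. x ^ m)" by (simp add: log_deriv_def)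
  then show ?thesis unfolding F_def[symmetric] by (simp add: fps_eq_iff)
qed

lemma coprime_no_common_root:
  fixes P Q :: "complex poly"
  assumes "P \<noteq> 0" "\<And>z. poly P z = 0 \<Longrightarrow> poly Q z = 0 \<Longrightarrow> False"
  shows "coprime P Q"
proof (rule coprimeI)
  fix c assume c: "c dvd P" "c dvd Q"
  have "c \<noteq> 0" using c(1) assms(1) by auto
  moreover have "degree c = 0"
  proof (rule ccontr)
    assume "degree c \<noteq> 0"
    then have "\<exists>z. poly c z = 0"
      by (intro fundamental_theorem_of_algebra) (simp add: constant_degree)
    then obtain z where "poly c z = 0" by blast
    then show False using c assms(2)[of z] by (auto elim!: dvdE)
  qed
  ultimately show "is_unit c" by (simp add: is_unit_iff_degree)
qed

text \<open>  \<open>P\<close> collects the points of negative weight and \<open>Q\<close> those of positive weight. The sets of roots are disjoint, and the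
  degrees are partial sums of the weights up to sign.\<close>

lemma zeta_rational:
  fixes X :: "complex set" and \<nu> :: "complex \<Rightarrow> int"
  assumes X: "finite X" and p: "\<And>m. p m = (\<Sum>x\<in>X. of_int (\<nu> x) * x ^ m)"
    and bound: "\<And>S. S \<subseteq> X \<Longrightarrow> \<bar>\<Sum>x\<in>S. \<nu> x\<bar> < int s"
  shows "\<exists>P Q :: complex poly.
     fps_compose (fps_exp 1) (Abs_fps (\<lambda>m. if m = 0 then 0 else p m / of_nat m)) = fps_of_poly P / fps_of_poly Q \<and>
     coprime P Q \<and> coeff P 0 = 1 \<and> coeff Q 0 = 1 \<and> degree P \<le> s - 1 \<and> degree Q \<le> s - 1"
proof -
  define N where "N = {x \<in> X. \<nu> x < 0}" define M where "M = {x \<in> X. \<nu> x > 0}"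
  define P where "P = (\<Prod>x\<in>N. [:1, - x:] ^ nat (- \<nu> x))"
  define Q where "Q = (\<Prod>x\<in>M. [:1, - x:] ^ nat (\<nu> x))"
  define F where "F = fps_compose (fps_exp 1) (Abs_fps (\<lambda>m. if m = 0 then 0 else p m / of_nat m))"
  define e where "e = (\<lambda>x :: complex. Abs_fps (\<lambda>m. x ^ Suc m))"
  have fin: "finite N" "finite M" using X by (auto simp: N_def M_def)
  have c0: "coeff P 0 = 1" "coeff Q 0 = 1"
    unfolding poly_0_coeff_0[symmetric] by (simp_all add: P_def Q_def poly_prod)
  have ldP: "log_deriv (fps_of_poly P) = (\<Sum>x\<in>N. of_int (\<nu> x) * e x)"
    unfolding P_def fps_of_poly_prod fps_of_poly_power
    by (subst log_deriv_prod) (auto simp: fps_nth_power_0 log_deriv_power log_deriv_linear e_def N_def intro!: sum.cong)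
  have ldQ: "log_deriv (fps_of_poly Q) = (\<Sum>x\<in>M. - of_int (\<nu> x) * e x)"
    unfolding Q_def fps_of_poly_prod fps_of_poly_power
    by (subst log_deriv_prod) (auto simp: fps_nth_power_0 log_deriv_power log_deriv_linear e_def M_def intro!: sum.cong)
  have F0: "fps_nth F 0 = 1" by (simp add: F_def)
  have ldF: "log_deriv F = (\<Sum>x\<in>X. of_int (\<nu> x) * e x)"
  proof -
    let ?G = "Abs_fps (\<lambda>m. if m = 0 then 0 else p m / of_nat m)"
    have "fps_deriv F = F * fps_deriv ?G" unfolding F_def by (subst fps_compose_deriv) simp_all
    then have "log_deriv F = fps_deriv ?G * (F * inverse F)" by (simp add: log_deriv_def mult_ac)
    also have "F * inverse F = 1" using F0 by (simp add: inverse_mult_eq_1')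
    also have "fps_deriv ?G * 1 = (\<Sum>x\<in>X. of_int (\<nu> x) * e x)"
    proof (rule fps_ext)
      fix m
      have "(of_nat (Suc m) :: complex) \<noteq> 0" by (rule of_nat_neq_0)
      then have "fps_nth (fps_deriv ?G) m = p (Suc m)" by simp
      also have "\<dots> = fps_nth (\<Sum>x\<in>X. of_int (\<nu> x) * e x) m"
        unfolding p fps_sum_nth by (intro sum.cong refl) (simp add: e_def fps_of_int[symmetric])
      finally show "fps_nth (fps_deriv ?G * 1) m = fps_nth (\<Sum>x\<in>X. of_int (\<nu> x) * e x) m" by simp
    qed
    finally show ?thesis .
  qed
  have "F * fps_of_poly Q = fps_of_poly P"
  proof (rule log_deriv_unique)
    have "\<nu> x = 0" if "x \<in> X - (N \<union> M)" for x using that by (auto simp: N_def M_def)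
    moreover have "N \<union> M \<subseteq> X" by (auto simp: N_def M_def)
    ultimately have "(\<Sum>x\<in>X. of_int (\<nu> x) * e x) = (\<Sum>x\<in>N \<union> M. of_int (\<nu> x) * e x)"
      by (intro sum.mono_neutral_right X) auto
    also have "\<dots> = (\<Sum>x\<in>N. of_int (\<nu> x) * e x) + (\<Sum>x\<in>M. of_int (\<nu> x) * e x)"
      by (rule sum.union_disjoint[OF fin]) (auto simp: N_def M_def)
    finally show "log_deriv (F * fps_of_poly Q) = log_deriv (fps_of_poly P)"
      using F0 c0 by (simp add: log_deriv_mult ldF ldP ldQ sum_negf)
  qed (use F0 c0 in simp_all)
  moreover have "fps_of_poly Q \<noteq> 0" using c0(2) by auto
  ultimately have "F = fps_of_poly P / fps_of_poly Q" by (metis nonzero_mult_div_cancel_right)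
  moreover have "coprime P Q"
  proof (rule coprime_no_common_root)
    fix z assume "poly P z = 0" "poly Q z = 0"
    then obtain x y where "x \<in> N" "z * x = 1" "y \<in> M" "z * y = 1"
      using fin by (auto simp: P_def Q_def poly_prod poly_power prod_zero_iff)
    then have "x \<in> N" "x \<in> M" by (metis mult_cancel_left mult_zero_left zero_neq_one)+
    then show False by (simp add: N_def M_def)
  qed (use c0 in auto)
  moreover have "degree P \<le> s - 1"
  proof -
    have "degree P \<le> (\<Sum>x\<in>N. degree ([:1, - x:] ^ nat (- \<nu> x)))" unfolding P_def by (rule degree_prod_sum_le[OF fin(1), unfolded o_def])
    also have "\<dots> \<le> (\<Sum>x\<in>N. nat (- \<nu> x))" by (intro sum_mono order_trans[OF degree_power_le]) simp
    finally have "int (degree P) \<le> (\<Sum>x\<in>N. - \<nu> x)" 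
      by (simp add: N_def flip: of_nat_le_iff[where ?'a = int])
    then show ?thesis using bound[of N] by (simp add: sum_negf N_def)
  qed
  moreover have "degree Q \<le> s - 1"
  proof -
    have "degree Q \<le> (\<Sum>x\<in>M. degree ([:1, - x:] ^ nat (\<nu> x)))" unfolding Q_def by (rule degree_prod_sum_le[OF fin(2), unfolded o_def])
    also have "\<dots> \<le> (\<Sum>x\<in>M. nat (\<nu> x))" by (intro sum_mono order_trans[OF degree_power_le]) simp
    finally have "int (degree Q) \<le> (\<Sum>x\<in>M. \<nu> x)" 
      by (simp add: M_def flip: of_nat_le_iff[where ?'a = int])
    then show ?thesis using bound[of M] by (simp add: M_def)
  qed
  ultimately show ?thesis using c0 unfolding F_def by blast
qed

context vector_space
begin

lemma linear_relation:
  assumes "finite_dim V" "\<And>k :: nat. x k \<in> V"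
  obtains N c where "\<exists>k\<le>N. c k \<noteq> 0" "(\<Sum>k\<le>N. scale (c k) (x k)) = 0"
proof -
  obtain F where F: "finite F" "V \<subseteq> span F" using assms(1) unfolding finite_dim_def by blast
  define N where "N = card F"
  show thesis
  proof (cases "inj_on x {..N}")
    case True
    have "\<not> independent (x ` {..N})"
    proof
      assume "independent (x ` {..N})"
      moreover have "x ` {..N} \<subseteq> span F" using assms(2) F(2) by auto
      ultimately have "card (x ` {..N}) \<le> card F" using independent_span_bound[OF F(1)] by blast
      then show False using True by (simp add: card_image N_def)
    qed
    then obtain u where u: "\<exists>v\<in>x ` {..N}. u v \<noteq> 0" "(\<Sum>v\<in>x ` {..N}. scale (u v) v) = 0"
      using dependent_finite[of "x ` {..N}"] by auto
    show thesis
    proof (rule that[of N "\<lambda>k. u (x k)"])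
      show "\<exists>k\<le>N. u (x k) \<noteq> 0" using u(1) by auto
      show "(\<Sum>k\<le>N. scale (u (x k)) (x k)) = 0" using u(2) by (simp add: sum.reindex[OF True])
    qed
  next
    case False
    then obtain i j where ij: "i \<le> N" "j \<le> N" "x i = x j" "i \<noteq> j" by (auto simp: inj_on_def)
    let ?c = "\<lambda>k. (if k = i then 1 else 0) - (if k = j then 1 else 0)"
    have "(\<Sum>k\<le>N. scale (?c k) (x k)) = (\<Sum>k\<le>N. (if k = i then x k else 0) - (if k = j then x k else 0))"
      by (intro sum.cong refl) auto
    also have "\<dots> = 0" using ij by (simp add: sum_subtractf)
    finally show thesis using ij by (intro that[of N ?c]) auto
  qed
qed

end

context rigid_symmetric_linear_category
begin

lemma cat_trace_linear:
  assumes f: "f \<in> Hom a a" and g: "g \<in> Hom a a"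
  shows "cat_trace C a (f + g) = cat_trace C a f + cat_trace C a g" "cat_trace C a (k \<star> f) = k * cat_trace C a f"
proof -
  obtain b ev coev where dual: "is_dual C a b ev coev"
    and tr: "\<And>g. g \<in> Hom a a \<Longrightarrow> cat_trace C a g \<star> Id \<one> = ev \<cdot> \<c> a b \<cdot> (g \<boxtimes> Id b) \<cdot> coev"
    by (rule cat_trace_dual[of a]) blast
  have h: "coev \<in> Hom \<one> (a \<otimes> b)" "ev \<cdot> \<c> a b \<in> Hom (a \<otimes> b) \<one>"
    using dual braid_in_Hom unfolding is_dual_def by (auto intro: comp_in_Hom)
  note t = tens_in_Hom[OF f Id_in_Hom[of b]] tens_in_Hom[OF g Id_in_Hom[of b]]
  note c = comp_in_Hom[OF t(1) h(2)] comp_in_Hom[OF t(2) h(2)]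
  have "cat_trace C a (f + g) \<star> Id \<one> = (cat_trace C a f + cat_trace C a g) \<star> Id \<one>"
    using tr[OF f] tr[OF g] tr[OF in_Hom_add[OF f g]]
    by (simp add: tens_add_left[OF f g Id_in_Hom] comp_add_right[OF t h(2)] comp_add_left[OF h(1) c] scale_left_distrib)
  then show "cat_trace C a (f + g) = cat_trace C a f + cat_trace C a g" by (metis scal_eq)
  have "cat_trace C a (k \<star> f) \<star> Id \<one> = (k * cat_trace C a f) \<star> Id \<one>"
    using tr[OF f] tr[OF in_Hom_scale[OF f, of k]]
    by (simp add: tens_scale_left[OF f Id_in_Hom] comp_scale_right[OF t(1) h(2)] comp_scale_left[OF h(1) c(1)] flip: scale_scale)
  then show "cat_trace C a (k \<star> f) = k * cat_trace C a f" by (metis scal_eq)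
qed

context
  fixes Z :: 'o and g :: 'm
  assumes g: "g \<in> Hom Z Z"
begin


definition peval :: "complex poly \<Rightarrow> 'm" where
  "peval p = (\<Sum>k\<le>degree p. coeff p k \<star> mor_pow C Z g k)"

lemmas pow_Hom = mor_pow_in_Hom[OF g]

lemma peval_Hom: "peval p \<in> Hom Z Z"
  unfolding peval_def by (intro in_Hom_sum in_Hom_scale pow_Hom)

lemma peval_bound: "degree p \<le> N \<Longrightarrow> peval p = (\<Sum>k\<le>N. coeff p k \<star> mor_pow C Z g k)"
  unfolding peval_def by (rule sum.mono_neutral_left) (auto simp: coeff_eq_0)

lemma peval_add: "peval (p + q) = peval p + peval q"
  using peval_bound[of p "max (degree p) (degree q)"] peval_bound[of q "max (degree p) (degree q)"]
    peval_bound[of "p + q" "max (degree p) (degree q)"]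
  by (simp add: degree_add_le_max scale_left_distrib sum.distrib)

lemma peval_smult: "peval (smult c p) = c \<star> peval p"
  using peval_bound[of "smult c p" "degree p"] by (simp add: peval_def degree_smult_le scale_sum_right)

lemma peval_shift: "peval (pCons 0 p) = g \<cdot> peval p"
proof -
  have "peval (pCons 0 p) = (\<Sum>k\<le>Suc (degree p). coeff (pCons 0 p) k \<star> mor_pow C Z g k)"
    by (rule peval_bound[OF degree_pCons_le])
  also have "\<dots> = (\<Sum>k\<le>degree p. coeff p k \<star> (g \<cdot> mor_pow C Z g k))"
    by (subst sum.atMost_Suc_shift) simp
  also have "\<dots> = g \<cdot> peval p"
    unfolding peval_def
    by (subst comp_sum_right[OF g, where a = Z]) (auto intro!: in_Hom_scale pow_Hom simp: comp_scale_right[OF pow_Hom g])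
  finally show ?thesis .
qed

lemma peval_1: "peval 1 = Id Z"
  by (simp add: peval_def)

lemma peval_0: "peval 0 = 0"
  by (simp add: peval_def)

lemma peval_monom: "peval (monom 1 m) = mor_pow C Z g m"
proof (induction m)
  case 0
  then show ?case using peval_1 by (simp add: monom_0 one_pCons)
next
  case (Suc m)
  then show ?case by (simp add: monom_Suc peval_shift)
qed

lemma peval_mult: "peval (p * q) = peval p \<cdot> peval q"
proof (induction p)
  case 0
  then show ?case by (simp add: peval_0 comp_zero_left[OF peval_Hom])
next
  case (pCons a p)
  have e: "peval (pCons a p) = a \<star> Id Z + (g \<cdot> peval p)"
  proof -
    have "pCons a p = smult a 1 + pCons 0 p" by (simp add: one_pCons)
    then show ?thesis by (simp only: peval_add peval_smult peval_1 peval_shift)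
  qed
  have "peval (pCons a p * q) = a \<star> peval q + (g \<cdot> (peval p \<cdot> peval q))"
    by (simp add: peval_add peval_smult peval_shift pCons.IH)
  also have "\<dots> = peval (pCons a p) \<cdot> peval q"
    unfolding e comp_add_left[OF peval_Hom in_Hom_scale[OF Id_in_Hom] comp_in_Hom[OF peval_Hom g]]
    by (simp add: comp_scale_left[OF peval_Hom Id_in_Hom] comp_Id_left[OF peval_Hom] comp_assoc[OF peval_Hom peval_Hom g])
  finally show ?case .
qed

lemma peval_power: "mor_pow C Z (peval q) k = peval (q ^ k)"
  by (induction k) (simp_all add: peval_1 peval_mult)

text \<open>  The powers of \<open>g\<close> are linearly dependent. The first tensor power is \<open>Z \<otimes> \<one>\<close>, so the dependence is found after tensoring
  with \<open>\<one>\<close>, which is faithful.\<close>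

lemma peval_annihilator:
  assumes "finite_dim (Hom (Z \<otimes> \<one>) (Z \<otimes> \<one>))"
  obtains f where "f \<noteq> 0" "peval f = 0"
proof -
  have "mor_pow C Z g k \<boxtimes> Id \<one> \<in> Hom (Z \<otimes> \<one>) (Z \<otimes> \<one>)" for k
    by (intro tens_in_Hom pow_Hom Id_in_Hom)
  then obtain N c where c: "\<exists>k\<le>N. c k \<noteq> 0" "(\<Sum>k\<le>N. c k \<star> (mor_pow C Z g k \<boxtimes> Id \<one>)) = 0"
    by (rule linear_relation[OF assms, where x = "\<lambda>k. mor_pow C Z g k \<boxtimes> Id \<one>"]) blast
  let ?x = "\<Sum>k\<le>N. c k \<star> mor_pow C Z g k"
  have x: "?x \<in> Hom Z Z" by (intro in_Hom_sum in_Hom_scale pow_Hom)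
  have tz: "0 \<boxtimes> Id \<one> = 0" using tens_scale_left[OF g Id_in_Hom, of 0 \<one>] by simp
  have "(\<Sum>k\<in>K. c k \<star> mor_pow C Z g k) \<boxtimes> Id \<one> = (\<Sum>k\<in>K. c k \<star> (mor_pow C Z g k \<boxtimes> Id \<one>))" for K
  proof (induction K rule: infinite_finite_induct)
    case (insert k K)
    have "(\<Sum>k\<in>K. c k \<star> mor_pow C Z g k) \<in> Hom Z Z" by (intro in_Hom_sum in_Hom_scale pow_Hom)
    then show ?case using insert
      by (simp add: tens_add_left[OF in_Hom_scale[OF pow_Hom] _ Id_in_Hom] tens_scale_left[OF pow_Hom Id_in_Hom])
  qed (simp_all add: tz)
  then have "?x \<boxtimes> Id \<one> = 0" using c(2) by simp
  have "Arrow Z ?x Z = Arrow Z 0 Z"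
  proof (rule tensor_unit_faithful)
    show "Arrow Z ?x Z <*> aI \<one> = Arrow Z 0 Z <*> aI \<one>"
      using \<open>?x \<boxtimes> Id \<one> = 0\<close> tz by (simp add: arrow_tens_def aI_def)
  qed (use x subspace_0[OF subspace_Hom] in \<open>simp_all add: ok_def\<close>)
  then have x0: "?x = 0" by simp
  define f where "f = (\<Sum>k\<le>N. monom (c k) k)"
  have cf: "coeff f k = (if k \<le> N then c k else 0)" for k
    by (simp add: f_def coeff_sum)
  show thesis
  proof (rule that[of f])
    show "f \<noteq> 0" using c(1) cf by (metis coeff_0)
    have "degree f \<le> N" by (rule degree_le) (simp add: cf)
    then show "peval f = 0" using x0 by (simp add: peval_bound cf)
  qed
qed

end

lemma zeta_rational_of_square_zero:
  assumes zero: "Phi C Z (s * s) (young_pair.yc (s * s) (srow s) (scol s)) = 0"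
    and fin: "finite_dim (Hom (Z \<otimes> \<one>) (Z \<otimes> \<one>))" and g: "g \<in> Hom Z Z"
  shows "\<exists>P Q :: complex poly.
       trace_zeta C Z g = fps_of_poly P / fps_of_poly Q \<and>
       coprime P Q \<and> coeff P 0 = 1 \<and> coeff Q 0 = 1 \<and>
       degree P \<le> s - 1 \<and> degree Q \<le> s - 1"
proof -
  define L where "L = (\<lambda>p. cat_trace C Z (peval Z g p))"
  note P = peval_Hom[OF g]
  obtain f where f: "f \<noteq> 0" "peval Z g f = 0" by (rule peval_annihilator[OF g fin])
  have smult: "L (smult c p) = c * L p" for c p
    by (simp add: L_def peval_smult[OF g] cat_trace_linear(2)[OF P P])
  have "square_zero s (\<lambda>k. L (q ^ k))" for q
    by (rule young_trace_zero[OF square_young_pair zero P[of q]])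
      (unfold square_zero_def L_def peval_power[OF g, symmetric], blast)
  moreover have "L (p + q) = L p + L q" for p q
    by (simp add: L_def peval_add[OF g] cat_trace_linear(1)[OF P P])
  moreover have "L (f * q) = 0" for q
    using smult[of 0 0] by (simp add: L_def peval_mult[OF g] f(2) comp_zero_left[OF P] peval_0[OF g])
  ultimately obtain X \<nu> where X: "finite X" and L: "\<And>q. L q = (\<Sum>x\<in>X. of_int (\<nu> x) * poly q x)"
    and bound: "\<And>S. S \<subseteq> X \<Longrightarrow> \<bar>\<Sum>x\<in>S. \<nu> x\<bar> < int s"
    using point_functional[of L f s] smult f(1) by blast
  have "cat_trace C Z (mor_pow C Z g m) = (\<Sum>x\<in>X. of_int (\<nu> x) * x ^ m)" for m
    using L[of "monom 1 m"] by (simp add: L_def peval_monom[OF g] poly_monom)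
  from zeta_rational[OF X this bound] show ?thesis unfolding trace_zeta_def .
qed

end

theorem corollaryA2:
  fixes C :: "('o, 'm::ab_group_add) sym_mon_cat"
    and Z :: 'o and A :: real and s :: nat
  assumes "rigid_symmetric_linear_category C"
    and "A \<ge> 1"
    and "\<And>n. vector_space.finite_dim (scl C) (Hom\<^bsub>C\<^esub> (tens_pow C Z n) (tens_pow C Z n))"
    and "\<And>n. real (vector_space.dim (scl C) (Hom\<^bsub>C\<^esub> (tens_pow C Z n) (tens_pow C Z n))) \<le> A ^ n"
    and "real s > 2 * exp 1 * sqrt A"
  shows "dies C Z (replicate s s) \<and>
    (\<forall>g \<in> Hom\<^bsub>C\<^esub> Z Z. \<exists>P Q :: complex poly.
       trace_zeta C Z g = fps_of_poly P / fps_of_poly Q \<and>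
       coprime P Q \<and> coeff P 0 = 1 \<and> coeff Q 0 = 1 \<and>
       degree P \<le> s - 1 \<and> degree Q \<le> s - 1)"
proof -
  interpret rigid_symmetric_linear_category C by (rule assms(1))
  have zero: "Phi C Z (s * s) (young_pair.yc (s * s) (srow s) (scol s)) = 0"
    using assms by (intro square_dies_core[of A])
  have "0 < real s" using assms(2,5) by (smt (verit) exp_gt_zero mult_nonneg_nonneg real_sqrt_ge_0_iff)
  then have "dies C Z (replicate s s)" by (intro square_dies zero) simp
  moreover have "finite_dim (Hom\<^bsub>C\<^esub> (Z \<otimes>\<^bsub>C\<^esub> \<one>\<^bsub>C\<^esub>) (Z \<otimes>\<^bsub>C\<^esub> \<one>\<^bsub>C\<^esub>))"
    using assms(3)[of 1] by simp
  ultimately show ?thesis using zeta_rational_of_square_zero[OF zero] by blast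
qed

end
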